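(* Let $X=(X_1,\dots,X_d)\in M_n(\mathbb C)^d$ be a row co-isometry, i.e. $\sum_{i=1}^dX_iX_i^*=I_n$. If the algebra generated by $X_1,\dots,X_d$ is all of $M_n(\mathbb C)$, then for every $s\times t$ block matrix $Y$ with blocks in $M_n(\mathbb C)$, $$\lim_{r\nearrow1}(P_{rX}^{-1/2}\otimes I_s)(I_n\otimes Y)(P_{rX}^{1/2}\otimes I_t)=I_n\otimes Y,$$ and consequently $$\|Y\|_{\mathrm{ANP}(X)}=\lim_{r\nearrow1}\|Y\|_{\mathrm{NP}(rX)}=\|Y\|.$$
   Context: Row ball: $\mathcal B^d=\bigsqcup_{m\ge1}\mathcal B^d_m$, where $\mathcal B^d_m$ is the set of $d$-tuples of complex $m\times m$ matrices $X$ with $\|\sum X_iX_i^*\|<1$. An nc function $f:\mathcal B^d\to\bigsqcup_m M_m(\mathbb C)$ is a graded function (mapping $\mathcal B^d_m$ into $M_m(\mathbb C)$) with $f(X\oplus Y)=f(X)\oplus f(Y)$ and $f(S^{-1}XS)=S^{-1}f(X)S$ whenever $S$ is invertible and $X,S^{-1}XS\in\mathcal B^d$. $H^\infty(\mathcal B^d)$ is the set of nc functions with $\sup_{X\in\mathcal B^d}\|f(X)\|<\infty$. For an $s\times t$ matrix $f=(f_{ij})$ of such functions, $f(X)=(f_{ij}(X))_{i,j}$ and $\|f\|_\infty=\sup_{X\in\mathcal B^d}\|f(X)\|$ (operator norm of block matrices). For $X\in\mathcal B^d_n$ and an $s\times t$ block matrix $Y$ with $n\times n$ blocks, $\|Y\|_{\mathrm{NP}(X)}=\inf\|f\|_\infty$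 over all $s\times t$ matrices $f$ over $H^\infty(\mathcal B^d)$ with $f(X)=Y$. If $\|\sum X_iX_i^*\|=1$, then $\|Y\|_{\mathrm{ANP}(X)}:=\lim_{r\nearrow1}\|Y\|_{\mathrm{NP}(rX)}$. Here $rX=(rX_1,\dots,rX_d)$. $\otimes$ is the Kronecker product. $\mathrm{vec}:M_n(\mathbb C)\to\mathbb C^{n^2}$ stacks columns. $\psi:M_{n^2}(\mathbb C)\to M_{n^2}(\mathbb C)$, $A\mapsto A^\psi$, is the linear map with $[C\otimes D]^\psi=\mathrm{vec}(D)\,\mathrm{vec}(C)^T$. For $X\in\mathcal B^d_n$, $P_X=\big[(I_n\otimes I_n-\sum_{i=1}^d\overline{X_i}\otimes X_i)^{-1}\big]^\psi$, with $\overline{X_i}$ the entrywise conjugate. $P_X$ is positive semidefinite, and it is invertible exactly when $X_1,\dots,X_d$ generate $M_n(\mathbb C)$ as a unital algebra. Tensor convention: in formulas such as $I_n\otimes Y$, the block matrix $Y=(Y_{ij})$ is identified with $\sum_{i,j}Y_{ij}\otimes\mathcal E_{ij}\in M_n(\mathbb C)\otimes M_{s\times t}(\mathbb C)$, with $\mathcal E_{ij}$ the $s\times t$ matrix units. *)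

theory Defs
  imports
    "Jordan_Normal_Form.Schur_Decomposition"
    "Jordan_Normal_Form.Gauss_Jordan_Elimination"
    "HOL-Analysis.L2_Norm"
    "HOL-Library.Extended_Real"
begin

section \<open>Matrices of varying size\<close>

definition cvec_norm :: "complex vec \<Rightarrow> real" where
  "cvec_norm v = L2_set (\<lambda>i. cmod (v $ i)) {..<dim_vec v}"

definition op_norm :: "complex mat \<Rightarrow> real" where
  "op_norm A = (SUP v\<in>{v \<in> carrier_vec (dim_col A). cvec_norm v \<le> 1}. cvec_norm (A *\<^sub>v v))"

definition mat_sum :: "nat \<Rightarrow> nat \<Rightarrow> ('i \<Rightarrow> complex mat) \<Rightarrow> 'i set \<Rightarrow> complex mat" where
  "mat_sum nr nc A I = mat nr nc (\<lambda>(p, q). \<Sum>i\<in>I. A i $$ (p, q))"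

definition kron :: "complex mat \<Rightarrow> complex mat \<Rightarrow> complex mat" where
  "kron A B = mat (dim_row A * dim_row B) (dim_col A * dim_col B)
     (\<lambda>(p, q). A $$ (p div dim_row B, q div dim_col B) * B $$ (p mod dim_row B, q mod dim_col B))"

definition mat_unit :: "nat \<Rightarrow> nat \<Rightarrow> nat \<Rightarrow> nat \<Rightarrow> complex mat" where
  "mat_unit s t i j = mat s t (\<lambda>(p, q). if p = i \<and> q = j then 1 else 0)"

text \<open>Only meaningful for invertible square matrices.\<close>

definition mat_inv :: "complex mat \<Rightarrow> complex mat" where
  "mat_inv A = the (mat_inverse A)"

definition psd_mat :: "complex mat \<Rightarrow> bool" where
  "psd_mat A \<longleftrightarrow> square_mat A \<and> mat_adjoint A = A \<and>
     (\<forall>v\<in>carrier_vec (dim_row A). 0 \<le> Re ((A *\<^sub>v v) \<bullet>c v))"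

text \<open>The positive semidefinite square root; only meaningful for positive semidefinite matrices.\<close>

definition mat_sqrt :: "complex mat \<Rightarrow> complex mat" where
  "mat_sqrt A = (THE B. psd_mat B \<and> B * B = A)"

text \<open>Convergence in the Euclidean topology on matrices of a fixed size.\<close>

definition mat_tendsto :: "('r \<Rightarrow> complex mat) \<Rightarrow> complex mat \<Rightarrow> 'r filter \<Rightarrow> bool" where
  "mat_tendsto A L F \<longleftrightarrow>
     (\<forall>\<^sub>F r in F. A r \<in> carrier_mat (dim_row L) (dim_col L)) \<and>
     (\<forall>p<dim_row L. \<forall>q<dim_col L. ((\<lambda>r. A r $$ (p, q)) \<longlongrightarrow> L $$ (p, q)) F)"

text \<open>The unital subalgebra of the \<open>n \<times> n\<close> matrices generated by a set of matrices.\<close>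

inductive_set gen_algebra :: "nat \<Rightarrow> complex mat set \<Rightarrow> complex mat set"
  for n :: nat and G :: "complex mat set" where
  one: "1\<^sub>m n \<in> gen_algebra n G"
| gen: "A \<in> G \<Longrightarrow> A \<in> gen_algebra n G"
| add: "A \<in> gen_algebra n G \<Longrightarrow> B \<in> gen_algebra n G \<Longrightarrow> A + B \<in> gen_algebra n G"
| smult: "A \<in> gen_algebra n G \<Longrightarrow> c \<cdot>\<^sub>m A \<in> gen_algebra n G"
| mult: "A \<in> gen_algebra n G \<Longrightarrow> B \<in> gen_algebra n G \<Longrightarrow> A * B \<in> gen_algebra n G"


section \<open>The row ball and bounded nc functions\<close>

text \<open>
  A \<open>d\<close>-tuple of matrices is a list of length \<open>d\<close>. For \<open>d \<ge> 1\<close> such a list determines the size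
  of its entries, so the levels \<open>row_ball d m\<close>, \<open>m \<ge> 1\<close>, are disjoint and a graded function on the
  row ball is a function on lists. (For \<open>d = 0\<close> the levels would not be disjoint.)
\<close>

type_synonym mat_tuple = "complex mat list"

definition mat_tuples :: "nat \<Rightarrow> nat \<Rightarrow> mat_tuple set" where
  "mat_tuples d m = {X. length X = d \<and> set X \<subseteq> carrier_mat m m}"

definition row_square :: "nat \<Rightarrow> mat_tuple \<Rightarrow> complex mat" where
  "row_square m X = mat_sum m m (\<lambda>i. X ! i * mat_adjoint (X ! i)) {..<length X}"

definition row_ball :: "nat \<Rightarrow> nat \<Rightarrow> mat_tuple set" where
  "row_ball d m = {X \<in> mat_tuples d m. op_norm (row_square m X) < 1}"

definition scale_tuple :: "real \<Rightarrow> mat_tuple \<Rightarrow> mat_tuple" where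
  "scale_tuple r X = map (\<lambda>A. complex_of_real r \<cdot>\<^sub>m A) X"

definition direct_sum :: "complex mat \<Rightarrow> complex mat \<Rightarrow> complex mat" where
  "direct_sum A B = diag_block_mat [A, B]"

definition nc_function :: "nat \<Rightarrow> (mat_tuple \<Rightarrow> complex mat) \<Rightarrow> bool" where
  "nc_function d f \<longleftrightarrow>
     (\<forall>m\<ge>1. \<forall>X\<in>row_ball d m. f X \<in> carrier_mat m m) \<and>
     (\<forall>m\<ge>1. \<forall>k\<ge>1. \<forall>X\<in>row_ball d m. \<forall>Z\<in>row_ball d k.
        f (map2 direct_sum X Z) = direct_sum (f X) (f Z)) \<and>
     (\<forall>m\<ge>1. \<forall>X\<in>row_ball d m. \<forall>S\<in>carrier_mat m m.
        invertible_mat S \<longrightarrow> map (\<lambda>A. mat_inv S * A * S) X \<in> row_ball d m \<longrightarrow>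
        f (map (\<lambda>A. mat_inv S * A * S) X) = mat_inv S * f X * S)"

definition H_infinity :: "nat \<Rightarrow> (mat_tuple \<Rightarrow> complex mat) set" where
  "H_infinity d = {f. nc_function d f \<and>
     (SUP m\<in>{1..}. SUP X\<in>row_ball d m. ereal (op_norm (f X))) < \<infinity>}"


section \<open>Block matrices and the Nevanlinna--Pick norms\<close>

text \<open>
  An \<open>s \<times> t\<close> block matrix with \<open>m \<times> m\<close> blocks is given by its blocks \<open>Y i j\<close>, \<open>i < s\<close>, \<open>j < t\<close>.
  It is turned into a scalar matrix in two ways, which differ by a permutation of rows and columns:
  \<open>block_mat\<close> lays out the blocks in the usual way, and \<open>block_tensor\<close> is the element
  \<open>\<Sum> Y i j \<otimes> E i j\<close> of the tensor product, written as a Kronecker product.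
\<close>

definition block_mat :: "nat \<Rightarrow> nat \<Rightarrow> nat \<Rightarrow> (nat \<Rightarrow> nat \<Rightarrow> complex mat) \<Rightarrow> complex mat" where
  "block_mat s t m Y = mat (s * m) (t * m)
     (\<lambda>(p, q). Y (p div m) (q div m) $$ (p mod m, q mod m))"

definition block_tensor :: "nat \<Rightarrow> nat \<Rightarrow> nat \<Rightarrow> (nat \<Rightarrow> nat \<Rightarrow> complex mat) \<Rightarrow> complex mat" where
  "block_tensor s t m Y = mat_sum (m * s) (m * t)
     (\<lambda>(i, j). kron (Y i j) (mat_unit s t i j)) ({..<s} \<times> {..<t})"

definition sup_norm ::
    "nat \<Rightarrow> nat \<Rightarrow> nat \<Rightarrow> (nat \<Rightarrow> nat \<Rightarrow> mat_tuple \<Rightarrow> complex mat) \<Rightarrow> ereal" where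
  "sup_norm d s t f =
     (SUP m\<in>{1..}. SUP X\<in>row_ball d m. ereal (op_norm (block_mat s t m (\<lambda>i j. f i j X))))"

text \<open>Extended-real valued, so that the infimum is infinite if there is no interpolant.\<close>

definition NP_norm ::
    "nat \<Rightarrow> nat \<Rightarrow> nat \<Rightarrow> mat_tuple \<Rightarrow> (nat \<Rightarrow> nat \<Rightarrow> complex mat) \<Rightarrow> ereal" where
  "NP_norm d s t X Y = Inf {sup_norm d s t f | f.
     (\<forall>i<s. \<forall>j<t. f i j \<in> H_infinity d) \<and> (\<forall>i<s. \<forall>j<t. f i j X = Y i j)}"

definition ANP_norm ::
    "nat \<Rightarrow> nat \<Rightarrow> nat \<Rightarrow> mat_tuple \<Rightarrow> (nat \<Rightarrow> nat \<Rightarrow> complex mat) \<Rightarrow> ereal" where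
  "ANP_norm d s t X Y = Lim (at_left (1::real)) (\<lambda>r. NP_norm d s t (scale_tuple r X) Y)"


section \<open>The matrix \<open>P\<^sub>X\<close>\<close>

definition vec_col :: "complex mat \<Rightarrow> complex mat" where
  "vec_col A = mat (dim_row A * dim_col A) 1 (\<lambda>(k, _). A $$ (k mod dim_row A, k div dim_row A))"

text \<open>
  The linear map \<open>\<psi>\<close> on \<open>n\<^sup>2 \<times> n\<^sup>2\<close> matrices, given by its entries; the lemma \<open>psi_kron\<close> below is
  the property which determines it.
\<close>

definition psi :: "nat \<Rightarrow> complex mat \<Rightarrow> complex mat" where
  "psi n A = mat (n * n) (n * n)
     (\<lambda>(k, l). A $$ ((l mod n) * n + k mod n, (l div n) * n + k div n))"

lemma psi_kron:
  assumes "C \<in> carrier_mat n n" "D \<in> carrier_mat n n"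
  shows "psi n (kron C D) = vec_col D * transpose_mat (vec_col C)"
proof (rule eq_matI)
  fix k l
  assume "k < dim_row (vec_col D * transpose_mat (vec_col C))"
    and "l < dim_col (vec_col D * transpose_mat (vec_col C))"
  then have kl: "k < n * n" "l < n * n"
    using assms by (auto simp: vec_col_def)
  then have n: "0 < n" by (cases n) auto
  have dm: "k div n < n" "l div n < n" "k mod n < n" "l mod n < n"
    using kl n by (auto simp: less_mult_imp_div_less)
  have bnd: "a * n + b < n * n" if "a < n" "b < n" for a b
  proof -
    have "a * n + b < Suc a * n" using that by simp
    also have "\<dots> \<le> n * n" using that by (intro mult_right_mono) auto
    finally show ?thesis .
  qed
  show "psi n (kron C D) $$ (k, l) = (vec_col D * transpose_mat (vec_col C)) $$ (k, l)"
    using assms kl dm n bnd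
    by (simp add: psi_def kron_def vec_col_def scalar_prod_def)
qed (use assms in \<open>auto simp: psi_def vec_col_def\<close>)

lemma psi_linear:
  assumes "A \<in> carrier_mat (n * n) (n * n)" "B \<in> carrier_mat (n * n) (n * n)"
  shows "psi n (A + c \<cdot>\<^sub>m B) = psi n A + c \<cdot>\<^sub>m psi n B"
proof (rule eq_matI)
  fix k l
  assume "k < dim_row (psi n A + c \<cdot>\<^sub>m psi n B)" and "l < dim_col (psi n A + c \<cdot>\<^sub>m psi n B)"
  then have kl: "k < n * n" "l < n * n" by (auto simp: psi_def)
  then have n: "0 < n" by (cases n) auto
  have dm: "k div n < n" "l div n < n" "k mod n < n" "l mod n < n"
    using kl n by (auto simp: less_mult_imp_div_less)
  have bnd: "a * n + b < n * n" if "a < n" "b < n" for a b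
  proof -
    have "a * n + b < Suc a * n" using that by simp
    also have "\<dots> \<le> n * n" using that by (intro mult_right_mono) auto
    finally show ?thesis .
  qed
  show "psi n (A + c \<cdot>\<^sub>m B) $$ (k, l) = (psi n A + c \<cdot>\<^sub>m psi n B) $$ (k, l)"
    using assms kl dm bnd by (simp add: psi_def)
qed (auto simp: psi_def)

definition P_mat :: "nat \<Rightarrow> mat_tuple \<Rightarrow> complex mat" where
  "P_mat n X = psi n (mat_inv (kron (1\<^sub>m n) (1\<^sub>m n) -
     mat_sum (n * n) (n * n) (\<lambda>i. kron (map_mat cnj (X ! i)) (X ! i)) {..<length X}))"

end

theory Submission
  imports Defs
begin

text \<open>
  Let \<open>\<Phi>(A) = \<Sum> X\<^sub>i A X\<^sub>i\<^sup>*\<close>. The matrix \<open>P\<^bsub>rX\<^esub>\<close> is the Choi matrix of \<open>(id - r\<^sup>2 \<Phi>)\<^sup>-\<^sup>1\<close>. As \<open>\<Phi>\<close> is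
  unital and irreducible, its fixed points are the scalars, so the resolvent has a simple pole at
  \<open>r = 1\<close>: \<open>(1 - r\<^sup>2) (id - r\<^sup>2 \<Phi>)\<^sup>-\<^sup>1 A\<close> tends to \<open>\<phi>(A) I\<close> with \<open>\<phi>\<close> the faithful invariant state. Hence
  \<open>(1 - r\<^sup>2) P\<^bsub>rX\<^esub>\<close> tends to \<open>\<phi> \<otimes> I\<close> with \<open>\<phi>\<close> positive definite. The scalar factor cancels in the conjugation
  by the square roots, and \<open>\<phi>\<^sup>1\<^sup>/\<^sup>2 \<otimes> I\<close> commutes with \<open>I \<otimes> Y\<close>.

  For the norms, \<open>\<parallel>Y\<parallel>\<close> is a lower bound because \<open>f(rX) = Y\<close>. If \<open>c > \<parallel>Y\<parallel>\<close>, then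
  \<open>c\<^sup>2 P \<otimes> I - (I \<otimes> Y) (P \<otimes> I) (I \<otimes> Y)\<^sup>*\<close> with \<open>P = P\<^bsub>rX\<^esub>\<close>, scaled by \<open>1 - r\<^sup>2\<close>, tends to the positive definite matrix
  \<open>\<phi> \<otimes> (c\<^sup>2 - Y Y\<^sup>*)\<close>. So it is positive definite for \<open>r\<close> close to \<open>1\<close>, and a lurking isometry argument
  realizes an interpolant of norm at most \<open>c\<close> as a transfer function \<open>c (D + C (1 - Z A)\<^sup>-\<^sup>1 Z B)\<close>.
\<close>

section \<open>Matrices and forms over finite index sets\<close>

text \<open>The obstacle is that P itself diverges as r tends to 1. Every limit is therefore taken
  of a quantity scaled by 1 - r^2, and nothing can be concluded from it unless the limit is strictly
  positive: the square root is continuous at a positive definite matrix, and only a positive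
  definite limit forces positivity for r close to 1. Irreducibility is used twice, for different
  families. That no proper subspace is invariant under all X_e^* makes the pole simple; that none is
  invariant under all X_e makes \<phi> faithful. The full matrix algebra gives both, since it
  contains matrices that move any nonzero vector to any basis vector. No spectral decomposition is
  used. Positivity is carried as an inequality with an explicit constant; eigenvectors come from an
  optimal constant, inverses from determinants, and differences of square roots are controlled by a
  trace estimate. Likewise the value of the transfer function is never written with an inverse: it
  is the output of a linear state equation, and contractivity, compatibility with direct sums and
  similarities, and interpolation are all read off that equation.\<close>

text \<open>Vectors and matrices over finite index sets are plain functions, so that products and sums of
  index sets need no encoding by numbers. Values outside the index set are irrelevant.\<close>

definition app_on :: "'j set \<Rightarrow> ('i \<Rightarrow> 'j \<Rightarrow> complex) \<Rightarrow> ('j \<Rightarrow> complex) \<Rightarrow> 'i \<Rightarrow> complex" where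
  "app_on J A x = (\<lambda>i. \<Sum>j\<in>J. A i j * x j)"

definition mult_on ::
    "'k set \<Rightarrow> ('i \<Rightarrow> 'k \<Rightarrow> complex) \<Rightarrow> ('k \<Rightarrow> 'j \<Rightarrow> complex) \<Rightarrow> 'i \<Rightarrow> 'j \<Rightarrow> complex" where
  "mult_on K A B = (\<lambda>i j. \<Sum>k\<in>K. A i k * B k j)"

definition adj :: "('i \<Rightarrow> 'j \<Rightarrow> complex) \<Rightarrow> 'j \<Rightarrow> 'i \<Rightarrow> complex" where
  "adj A = (\<lambda>j i. cnj (A i j))"

definition inner_on :: "'i set \<Rightarrow> ('i \<Rightarrow> complex) \<Rightarrow> ('i \<Rightarrow> complex) \<Rightarrow> complex" where
  "inner_on I x y = (\<Sum>i\<in>I. x i * cnj (y i))"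

definition norm2_on :: "'i set \<Rightarrow> ('i \<Rightarrow> complex) \<Rightarrow> real" where
  "norm2_on I x = (\<Sum>i\<in>I. (cmod (x i))\<^sup>2)"

definition kdelta :: "'i \<Rightarrow> 'i \<Rightarrow> complex" where
  "kdelta i j = (if i = j then 1 else 0)"

definition form_on :: "'i set \<Rightarrow> ('i \<Rightarrow> 'i \<Rightarrow> complex) \<Rightarrow> ('i \<Rightarrow> complex) \<Rightarrow> complex" where
  "form_on I A x = inner_on I (app_on I A x) x"

definition hermitian_on :: "'i set \<Rightarrow> ('i \<Rightarrow> 'i \<Rightarrow> complex) \<Rightarrow> bool" where
  "hermitian_on I A \<longleftrightarrow> (\<forall>i\<in>I. \<forall>j\<in>I. cnj (A i j) = A j i)"

text \<open>The operator inequality A >= c. With c > 0 it is positive definiteness in a form that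
  survives small perturbations and gives rates for square roots; with c = 0 it is
  semidefiniteness.\<close>

definition pos_on :: "'i set \<Rightarrow> real \<Rightarrow> ('i \<Rightarrow> 'i \<Rightarrow> complex) \<Rightarrow> bool" where
  "pos_on I c A \<longleftrightarrow> hermitian_on I A \<and> (\<forall>x. c * norm2_on I x \<le> Re (form_on I A x))"

lemma norm2_on_nonneg [simp]: "0 \<le> norm2_on I x"
  by (simp add: norm2_on_def sum_nonneg)

lemma norm2_on_eq_0: "finite I \<Longrightarrow> norm2_on I x = 0 \<longleftrightarrow> (\<forall>i\<in>I. x i = 0)"
  by (simp add: norm2_on_def sum_nonneg_eq_0_iff)

lemma norm2_on_cong: "(\<And>i. i \<in> I \<Longrightarrow> x i = y i) \<Longrightarrow> norm2_on I x = norm2_on I y"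
  by (simp add: norm2_on_def)

lemma inner_on_self: "inner_on I x x = of_real (norm2_on I x)"
  by (simp add: inner_on_def norm2_on_def complex_norm_square del: of_real_power)

lemma inner_on_cong:
  "(\<And>i. i \<in> I \<Longrightarrow> x i = x' i) \<Longrightarrow> (\<And>i. i \<in> I \<Longrightarrow> y i = y' i) \<Longrightarrow> inner_on I x y = inner_on I x' y'"
  by (simp add: inner_on_def)

lemma app_on_cong: "(\<And>i. i \<in> I \<Longrightarrow> x i = x' i) \<Longrightarrow> app_on I A x = app_on I A x'"
  by (simp add: app_on_def)

lemma cnj_inner_on: "cnj (inner_on I x y) = inner_on I y x"
  by (simp add: inner_on_def mult.commute)

lemma inner_on_add_left: "inner_on I (\<lambda>i. x i + y i) z = inner_on I x z + inner_on I y z"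
  by (simp add: inner_on_def sum.distrib distrib_right)

lemma inner_on_add_right: "inner_on I z (\<lambda>i. x i + y i) = inner_on I z x + inner_on I z y"
  by (simp add: inner_on_def sum.distrib distrib_left)

lemma inner_on_scale_left: "inner_on I (\<lambda>i. c * x i) z = c * inner_on I x z"
  by (simp add: inner_on_def sum_distrib_left mult.assoc)

lemma inner_on_scale_right: "inner_on I z (\<lambda>i. c * x i) = cnj c * inner_on I z x"
  by (simp add: inner_on_def sum_distrib_left mult_ac)

lemma app_on_add: "app_on J A (\<lambda>i. x i + y i) = (\<lambda>i. app_on J A x i + app_on J A y i)"
  by (simp add: app_on_def sum.distrib distrib_left)

lemma app_on_scale: "app_on J A (\<lambda>i. c * x i) = (\<lambda>i. c * app_on J A x i)"
  by (simp add: app_on_def sum_distrib_left mult_ac)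

lemma app_on_mult: "app_on J A (app_on K B x) = app_on K (mult_on J A B) x"
proof
  fix i
  have "app_on J A (app_on K B x) i = (\<Sum>j\<in>J. \<Sum>k\<in>K. A i j * B j k * x k)"
    by (simp add: app_on_def sum_distrib_left mult.assoc)
  also have "\<dots> = (\<Sum>k\<in>K. \<Sum>j\<in>J. A i j * B j k * x k)" by (rule sum.swap)
  finally show "app_on J A (app_on K B x) i = app_on K (mult_on J A B) x i"
    by (simp add: app_on_def mult_on_def sum_distrib_right)
qed

lemma mult_on_assoc: "mult_on K (mult_on J A B) C = mult_on J A (mult_on K B C)"
proof (intro ext)
  fix i l
  have "mult_on K (mult_on J A B) C i l = (\<Sum>k\<in>K. \<Sum>j\<in>J. A i j * B j k * C k l)"
    by (simp add: mult_on_def sum_distrib_right)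
  also have "\<dots> = (\<Sum>j\<in>J. \<Sum>k\<in>K. A i j * B j k * C k l)" by (rule sum.swap)
  finally show "mult_on K (mult_on J A B) C i l = mult_on J A (mult_on K B C) i l"
    by (simp add: mult_on_def sum_distrib_left mult.assoc)
qed

lemma app_on_kdelta: "finite I \<Longrightarrow> i \<in> I \<Longrightarrow> app_on I kdelta x i = x i"
  by (simp add: app_on_def kdelta_def if_distrib[of "\<lambda>a. a * _"] sum.delta' cong: if_cong)

lemma adj_adj [simp]: "adj (adj A) = A"
  by (simp add: adj_def)

lemma inner_on_app_on: "inner_on I (app_on J A x) y = inner_on J x (app_on I (adj A) y)"
proof -
  have "inner_on I (app_on J A x) y = (\<Sum>i\<in>I. \<Sum>j\<in>J. A i j * x j * cnj (y i))"
    by (simp add: inner_on_def app_on_def sum_distrib_right)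
  also have "\<dots> = (\<Sum>j\<in>J. \<Sum>i\<in>I. A i j * x j * cnj (y i))" by (rule sum.swap)
  also have "\<dots> = inner_on J x (app_on I (adj A) y)"
    by (simp add: inner_on_def app_on_def adj_def sum_distrib_left mult_ac)
  finally show ?thesis .
qed

lemma app_on_adj_hermitian:
  "hermitian_on I A \<Longrightarrow> i \<in> I \<Longrightarrow> app_on I (adj A) x i = app_on I A x i"
  by (simp add: app_on_def adj_def hermitian_on_def)

lemma inner_on_hermitian:
  "hermitian_on I A \<Longrightarrow> inner_on I (app_on I A x) y = inner_on I x (app_on I A y)"
  unfolding inner_on_app_on by (rule inner_on_cong) (simp_all add: app_on_adj_hermitian)

lemma form_on_eq: "form_on I A x = (\<Sum>i\<in>I. \<Sum>j\<in>I. cnj (x i) * A i j * x j)"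
  unfolding form_on_def inner_on_def app_on_def sum_distrib_right by (simp add: mult_ac)

lemma form_on_cong:
  "(\<And>i j. i \<in> I \<Longrightarrow> j \<in> I \<Longrightarrow> A i j = B i j) \<Longrightarrow> form_on I A x = form_on I B x"
  by (simp add: form_on_eq)

lemma form_on_cong_vec:
  "(\<And>i. i \<in> I \<Longrightarrow> x i = y i) \<Longrightarrow> form_on I A x = form_on I A y"
  by (simp add: form_on_eq)

lemma form_on_real: "hermitian_on I A \<Longrightarrow> form_on I A x = of_real (Re (form_on I A x))"
  using inner_on_hermitian[of I A x x] cnj_inner_on[of I "app_on I A x" x]
  by (simp add: form_on_def complex_eq_iff)

lemma form_on_add: "form_on I (\<lambda>i j. A i j + B i j) x = form_on I A x + form_on I B x"
  by (simp add: form_on_eq sum.distrib algebra_simps)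

lemma form_on_scale: "form_on I (\<lambda>i j. c * A i j) x = c * form_on I A x"
  by (simp add: form_on_eq sum_distrib_left mult_ac)

lemma form_on_diff: "form_on I (\<lambda>i j. A i j - B i j) x = form_on I A x - form_on I B x"
  by (simp add: form_on_eq sum_subtractf algebra_simps)

lemma form_on_kdelta: "finite I \<Longrightarrow> form_on I kdelta x = of_real (norm2_on I x)"
  unfolding form_on_def
  by (subst inner_on_cong[where x' = x and y' = x]) (simp_all add: app_on_kdelta inner_on_self)

lemma hermitian_on_kdelta: "hermitian_on I kdelta"
  by (auto simp: hermitian_on_def kdelta_def)

lemma hermitian_on_scale: "hermitian_on I A \<Longrightarrow> hermitian_on I (\<lambda>i j. of_real c * A i j)"
  by (simp add: hermitian_on_def)

lemma hermitian_on_diff: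
  "hermitian_on I A \<Longrightarrow> hermitian_on I B \<Longrightarrow> hermitian_on I (\<lambda>i j. A i j - B i j)"
  by (simp add: hermitian_on_def)

lemma pos_onD: "pos_on I c A \<Longrightarrow> c * norm2_on I x \<le> Re (form_on I A x)"
  by (simp add: pos_on_def)

lemma pos_on_hermitian: "pos_on I c A \<Longrightarrow> hermitian_on I A"
  by (simp add: pos_on_def)

lemma pos_on_mono:
  assumes "pos_on I c A" "c' \<le> c"
  shows "pos_on I c' A"
  unfolding pos_on_def
proof (intro conjI allI)
  fix x
  have "c' * norm2_on I x \<le> c * norm2_on I x"
    using assms(2) by (simp add: mult_right_mono)
  also have "\<dots> \<le> Re (form_on I A x)" using assms(1) by (rule pos_onD)
  finally show "c' * norm2_on I x \<le> Re (form_on I A x)" .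
qed (use assms in \<open>simp add: pos_on_def\<close>)

lemma pos_on_cong:
  assumes "\<And>i j. i \<in> I \<Longrightarrow> j \<in> I \<Longrightarrow> A i j = B i j"
  shows "pos_on I c A \<longleftrightarrow> pos_on I c B"
proof -
  have "form_on I A = form_on I B" by (rule ext) (rule form_on_cong, rule assms)
  then show ?thesis using assms by (simp add: pos_on_def hermitian_on_def)
qed

text \<open>Evaluate the form at \<open>x - t\<beta> y\<close> with \<open>\<beta> = \<langle>A x, y\<rangle>\<close> and \<open>t\<close> real.\<close>

lemma pos_on_cauchy_schwarz:
  assumes "pos_on I 0 A"
  shows "(cmod (inner_on I (app_on I A x) y))\<^sup>2 \<le> Re (form_on I A x) * Re (form_on I A y)"
proof -
  define \<beta> where "\<beta> = inner_on I (app_on I A x) y"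
  define a where "a = Re (form_on I A x)"
  define b where "b = Re (form_on I A y)"
  define B where "B = (cmod \<beta>)\<^sup>2"
  have h: "hermitian_on I A" using assms by (rule pos_on_hermitian)
  have ab: "form_on I A x = of_real a" "form_on I A y = of_real b"
    unfolding a_def b_def by (rule form_on_real[OF h])+
  have nn: "0 \<le> a" "0 \<le> b" "0 \<le> B"
    using pos_onD[OF assms, of x] pos_onD[OF assms, of y] by (auto simp: a_def b_def B_def)
  have BB: "complex_of_real B = \<beta> * cnj \<beta>" unfolding B_def by (rule complex_norm_square)
  have key: "0 \<le> a - 2 * t * B + t\<^sup>2 * B * b" for t :: real
  proof -
    define z where "z = - (of_real t * \<beta>)"
    have yx: "inner_on I (app_on I A y) x = cnj \<beta>"
      unfolding \<beta>_def by (simp add: cnj_inner_on inner_on_hermitian[OF h])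
    have "form_on I A (\<lambda>i. x i + z * y i) =
        form_on I A x + cnj z * \<beta> + z * cnj \<beta> + z * cnj z * form_on I A y"
      unfolding form_on_def app_on_add app_on_scale inner_on_add_left inner_on_add_right
        inner_on_scale_left inner_on_scale_right yx \<beta>_def[symmetric]
      by (simp add: algebra_simps)
    also have "\<dots> = of_real (a - 2 * t * B + t\<^sup>2 * B * b)"
      unfolding ab z_def by (simp add: BB power2_eq_square algebra_simps)
    finally show ?thesis
      using pos_onD[OF assms, of "\<lambda>i. x i + z * y i"] by simp
  qed
  have "B \<le> a * b"
  proof (cases "b = 0")
    case True
    have "B = 0"
    proof (rule ccontr)
      assume "B \<noteq> 0"
      then have "B > 0" using nn by simp
      \<comment> \<open>At this t the right-hand side of \<open>key\<close> equals -1.\<close>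
      then show False using key[of "(a + 1) / (2 * B)"] nn True by (simp add: field_simps)
    qed
    then show ?thesis using True by simp
  next
    case False
    then have "b > 0" using nn by simp
    \<comment> \<open>The minimizing t; it leaves a - B / b.\<close>
    then show ?thesis using key[of "1 / b"] by (simp add: field_simps power2_eq_square)
  qed
  then show ?thesis by (simp add: B_def \<beta>_def a_def b_def)
qed

lemma pos_on_kdelta: "finite I \<Longrightarrow> pos_on I 1 kdelta"
  by (simp add: pos_on_def hermitian_on_kdelta form_on_kdelta)

lemma cauchy_schwarz_on:
  assumes "finite I"
  shows "(cmod (inner_on I x y))\<^sup>2 \<le> norm2_on I x * norm2_on I y"
proof -
  have "inner_on I (app_on I kdelta x) y = inner_on I x y"
    by (rule inner_on_cong) (simp_all add: app_on_kdelta assms)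
  then show ?thesis
    using pos_on_cauchy_schwarz[OF pos_on_mono[OF pos_on_kdelta[OF assms]], of x y]
    by (simp add: form_on_kdelta assms)
qed

text \<open>Cauchy-Schwarz for the form, paired with A x itself. This is how vanishing of a
  quadratic expression becomes invariance of a kernel in the irreducibility arguments.\<close>

lemma pos_on_kernel:
  assumes "finite I" "pos_on I 0 A" "Re (form_on I A x) = 0" "i \<in> I"
  shows "app_on I A x i = 0"
proof -
  have "norm2_on I (app_on I A x) = 0"
    using pos_on_cauchy_schwarz[OF assms(2), of x "app_on I A x"] assms(3)
    by (simp add: inner_on_self)
  then show ?thesis using assms by (simp add: norm2_on_eq_0)
qed

text \<open>For a semidefinite matrix a bound on the form is a bound on the norm. Cauchy-Schwarz
  between x and A x, followed by cancelling one factor, stands in for diagonalization.\<close>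

lemma pos_on_app_bound:
  assumes "finite I" "pos_on I 0 A" "\<And>x. Re (form_on I A x) \<le> q * norm2_on I x" "0 \<le> q"
  shows "norm2_on I (app_on I A x) \<le> q\<^sup>2 * norm2_on I x"
proof -
  let ?n = "norm2_on I (app_on I A x)"
  have "?n\<^sup>2 \<le> Re (form_on I A x) * Re (form_on I A (app_on I A x))"
    using pos_on_cauchy_schwarz[OF assms(2), of x "app_on I A x"] by (simp add: inner_on_self)
  also have "\<dots> \<le> (q * norm2_on I x) * (q * ?n)"
    using assms pos_onD[OF assms(2)] by (intro mult_mono) auto
  finally have le: "?n * ?n \<le> (q\<^sup>2 * norm2_on I x) * ?n" by (simp add: power2_eq_square mult_ac)
  show ?thesis
  proof (cases "?n = 0")
    case False
    then have "?n > 0" using norm2_on_nonneg[of I "app_on I A x"] by linarith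
    then show ?thesis using le by simp
  qed simp
qed

text \<open>A matrix and its adjoint have the same norm: with z = A^* y, the squared norm of z is
  the pairing of A z with y, and one factor cancels after Cauchy-Schwarz.\<close>

lemma app_on_adj_bound:
  assumes "finite I" "\<And>x. norm2_on I (app_on J A x) \<le> c * norm2_on J x" "0 \<le> c"
  shows "norm2_on J (app_on I (adj A) y) \<le> c * norm2_on I y"
proof -
  let ?z = "app_on I (adj A) y"
  let ?n = "norm2_on J ?z"
  have "inner_on I (app_on J A ?z) y = of_real ?n"
    by (simp add: inner_on_app_on inner_on_self)
  then have "?n\<^sup>2 \<le> norm2_on I (app_on J A ?z) * norm2_on I y"
    using cauchy_schwarz_on[OF assms(1), of "app_on J A ?z" y] by simp
  also have "\<dots> \<le> (c * ?n) * norm2_on I y" by (intro mult_right_mono assms) simp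
  finally have le: "?n * ?n \<le> (c * norm2_on I y) * ?n" by (simp add: power2_eq_square mult_ac)
  show ?thesis
  proof (cases "?n = 0")
    case True
    then show ?thesis using assms(3) by simp
  next
    case False
    then have "?n > 0" using norm2_on_nonneg[of J ?z] by linarith
    then show ?thesis using le by simp
  qed
qed

section \<open>Inverses, lower bounds and top eigenvectors\<close>

lemma finite_linear_inverse:
  assumes "finite I"
    and inj: "\<And>x. (\<And>i. i \<in> I \<Longrightarrow> app_on I A x i = 0) \<Longrightarrow> (\<And>i. i \<in> I \<Longrightarrow> x i = 0)"
  obtains R where "\<And>i j. i \<in> I \<Longrightarrow> j \<in> I \<Longrightarrow> mult_on I A R i j = kdelta i j"
    and "\<And>i j. i \<in> I \<Longrightarrow> j \<in> I \<Longrightarrow> mult_on I R A i j = kdelta i j"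
proof -
  define n where "n = card I"
  \<comment> \<open>Enumerating I makes determinants and adjugates of ordinary matrices
    available.\<close>
  obtain h where h: "bij_betw h {..<n} I"
    using ex_bij_betw_nat_finite[OF assms(1)] by (auto simp: n_def lessThan_atLeast0)
  define g where "g = inv_into {..<n} h"
  have g: "bij_betw g I {..<n}" unfolding g_def by (rule bij_betw_inv_into[OF h])
  have hg: "h (g i) = i" if "i \<in> I" for i
    using that h unfolding g_def by (rule bij_betw_inv_into_right[rotated])
  have gh: "g (h k) = k" if "k < n" for k
    using that h unfolding g_def by (simp add: bij_betw_inv_into_left)
  have gn: "g i < n" if "i \<in> I" for i using bij_betwE[OF g] that by auto
  have hI: "h k \<in> I" if "k < n" for k using bij_betwE[OF h] that by auto
  have reidx: "(\<Sum>i\<in>I. f i) = (\<Sum>k<n. f (h k))" for f :: "'a \<Rightarrow> complex"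
    by (rule sum.reindex_bij_betw[OF h, symmetric])
  define M where "M = mat n n (\<lambda>(a, b). A (h a) (h b))"
  have M: "M \<in> carrier_mat n n" by (simp add: M_def)
  have "det M \<noteq> 0"
  proof
    assume "det M = 0"
    then obtain v where v: "v \<in> carrier_vec n" "v \<noteq> 0\<^sub>v n" "M *\<^sub>v v = 0\<^sub>v n"
      using det_0_iff_vec_prod_zero[OF M] by auto
    have "app_on I A (\<lambda>i. v $ g i) i = 0" if "i \<in> I" for i
    proof -
      have "app_on I A (\<lambda>i. v $ g i) i = (\<Sum>k<n. A i (h k) * v $ k)"
        unfolding app_on_def reidx by (rule sum.cong) (auto simp: gh)
      also have "\<dots> = (M *\<^sub>v v) $ g i"
        using v(1) that by (simp add: M_def scalar_prod_def gn hg lessThan_atLeast0)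
      finally show ?thesis using v that by (simp add: gn)
    qed
    then have "v $ g i = 0" if "i \<in> I" for i using inj[of "\<lambda>i. v $ g i"] that by blast
    then have "v $ k = 0" if "k < n" for k using that hI gh by metis
    then have "v = 0\<^sub>v n" using v(1) by (intro eq_vecI) auto
    then show False using v(2) by simp
  qed
  define R' where "R' = (1 / det M) \<cdot>\<^sub>m adj_mat M"
  have R': "R' \<in> carrier_mat n n" "M * R' = 1\<^sub>m n" "R' * M = 1\<^sub>m n"
    using adj_mat[OF M] \<open>det M \<noteq> 0\<close> M
    by (auto simp: R'_def mult_smult_distrib[of _ n n _ n] mult_smult_assoc_mat[of _ n n _ n])
  define R where "R = (\<lambda>i j. R' $$ (g i, g j))"
  have one: "1\<^sub>m n $$ (g i, g j) = kdelta i j" if "i \<in> I" "j \<in> I" for i j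
    using that hg gn by (auto simp: kdelta_def) metis
  have A: "A i j = M $$ (g i, g j)" if "i \<in> I" "j \<in> I" for i j
    using that by (simp add: M_def gn hg)
  have "mult_on I A R i j = kdelta i j" if "i \<in> I" "j \<in> I" for i j
  proof -
    have "mult_on I A R i j = (\<Sum>k<n. M $$ (g i, k) * R' $$ (k, g j))"
      unfolding mult_on_def reidx by (rule sum.cong) (auto simp: gh hI R_def A that)
    also have "\<dots> = (M * R') $$ (g i, g j)"
      using that M R'(1) by (simp add: scalar_prod_def gn lessThan_atLeast0)
    finally show ?thesis using one[OF that] R' by simp
  qed
  moreover have "mult_on I R A i j = kdelta i j" if "i \<in> I" "j \<in> I" for i j
  proof -
    have "mult_on I R A i j = (\<Sum>k<n. R' $$ (g i, k) * M $$ (k, g j))"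
      unfolding mult_on_def reidx by (rule sum.cong) (auto simp: gh hI R_def A that)
    also have "\<dots> = (R' * M) $$ (g i, g j)"
      using that M R'(1) by (simp add: scalar_prod_def gn lessThan_atLeast0)
    finally show ?thesis using one[OF that] R' by simp
  qed
  ultimately show ?thesis using that by blast
qed

lemma app_on_mult_kdelta:
  assumes "finite I" "\<And>i j. i \<in> I \<Longrightarrow> j \<in> I \<Longrightarrow> mult_on J A R i j = kdelta i j" "i \<in> I"
  shows "app_on J A (app_on I R x) i = x i"
proof -
  have "app_on I (mult_on J A R) x i = app_on I kdelta x i"
    by (simp add: app_on_def assms)
  then show ?thesis using assms by (simp add: app_on_mult app_on_kdelta)
qed

lemma norm_form_on_le:
  assumes "finite I"
  shows "cmod (form_on I A x) \<le> (\<Sum>i\<in>I. \<Sum>j\<in>I. cmod (A i j)) * norm2_on I x"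
proof -
  have le: "cmod (x i) * cmod (x j) \<le> norm2_on I x" if "i \<in> I" "j \<in> I" for i j
  proof -
    have sq: "(cmod (x k))\<^sup>2 \<le> norm2_on I x" if "k \<in> I" for k
      unfolding norm2_on_def by (rule member_le_sum) (use that assms in auto)
    have "0 \<le> (cmod (x i) - cmod (x j))\<^sup>2" by simp
    then have "2 * (cmod (x i) * cmod (x j)) \<le> (cmod (x i))\<^sup>2 + (cmod (x j))\<^sup>2"
      by (simp add: power2_diff)
    then show ?thesis using sq[OF that(1)] sq[OF that(2)] by linarith
  qed
  have "cmod (form_on I A x) \<le> (\<Sum>i\<in>I. \<Sum>j\<in>I. cmod (cnj (x i) * A i j * x j))"
    unfolding form_on_eq by (intro order.trans[OF norm_sum] sum_mono order.refl)
  also have "\<dots> \<le> (\<Sum>i\<in>I. \<Sum>j\<in>I. cmod (A i j) * norm2_on I x)"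
  proof (intro sum_mono)
    fix i j assume "i \<in> I" "j \<in> I"
    from mult_left_mono[OF le[OF this], of "cmod (A i j)"]
    show "cmod (cnj (x i) * A i j * x j) \<le> cmod (A i j) * norm2_on I x"
      by (simp add: norm_mult mult_ac)
  qed
  finally show ?thesis by (simp add: sum_distrib_right)
qed

text \<open>Replaces compactness of the unit sphere. If R is the inverse, then <v, v> = <A v, R v>,
  and Cauchy-Schwarz for the form of A bounds its square by <A v, v> times |<R v, v>|. The constant
  is 1 / M, where M dominates the form of R; the summand 1 in M keeps it positive.\<close>

lemma pos_on_bounded_below:
  assumes "finite I" "pos_on I 0 A"
    and inj: "\<And>x. (\<And>i. i \<in> I \<Longrightarrow> app_on I A x i = 0) \<Longrightarrow> (\<And>i. i \<in> I \<Longrightarrow> x i = 0)"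
  obtains c where "0 < c" "pos_on I c A"
proof -
  obtain R where R: "\<And>i j. i \<in> I \<Longrightarrow> j \<in> I \<Longrightarrow> mult_on I A R i j = kdelta i j"
    using finite_linear_inverse[OF assms(1), of A] inj by metis
  define M where "M = (\<Sum>i\<in>I. \<Sum>j\<in>I. cmod (R i j)) + 1"
  have "M > 0" unfolding M_def by (intro add_nonneg_pos sum_nonneg) auto
  have h: "hermitian_on I A" using assms(2) by (rule pos_on_hermitian)
  have main: "norm2_on I v \<le> M * Re (form_on I A v)" for v
  proof -
    let ?w = "app_on I R v"
    have w: "app_on I A ?w i = v i" if "i \<in> I" for i
      by (rule app_on_mult_kdelta) (use assms R that in auto)
    have "inner_on I (app_on I A v) ?w = inner_on I v (app_on I A ?w)"
      by (rule inner_on_hermitian[OF h])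
    also have "\<dots> = of_real (norm2_on I v)"
      by (subst inner_on_cong[where x' = v and y' = v]) (simp_all add: w inner_on_self)
    finally have 1: "(norm2_on I v)\<^sup>2 \<le> Re (form_on I A v) * Re (form_on I A ?w)"
      using pos_on_cauchy_schwarz[OF assms(2), of v ?w] by simp
    have "form_on I A ?w = inner_on I v ?w"
      unfolding form_on_def by (rule inner_on_cong) (simp_all add: w)
    also have "\<dots> = cnj (form_on I R v)" by (simp add: form_on_def cnj_inner_on)
    finally have "Re (form_on I A ?w) \<le> cmod (form_on I R v)"
      using complex_Re_le_cmod[of "form_on I A ?w"] by simp
    also have "\<dots> \<le> M * norm2_on I v"
      using norm_form_on_le[OF assms(1), of R v] norm2_on_nonneg[of I v]
      unfolding M_def distrib_right by linarith
    finally have "norm2_on I v * norm2_on I v \<le> Re (form_on I A v) * (M * norm2_on I v)"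
      using order.trans[OF 1 mult_left_mono] pos_onD[OF assms(2), of v]
      by (simp add: power2_eq_square)
    then have le: "norm2_on I v * norm2_on I v \<le> (M * Re (form_on I A v)) * norm2_on I v"
      by (simp add: mult_ac)
    show ?thesis
    proof (cases "norm2_on I v = 0")
      case True
      then show ?thesis using pos_onD[OF assms(2), of v] \<open>M > 0\<close> by simp
    next
      case False
      then have "norm2_on I v > 0" using norm2_on_nonneg[of I v] by linarith
      then show ?thesis using le by simp
    qed
  qed
  have "pos_on I (1 / M) A"
    unfolding pos_on_def using h main \<open>M > 0\<close> by (simp add: field_simps)
  then show ?thesis using that[of "1 / M"] \<open>M > 0\<close> by simp
qed

text \<open>\<mu> is the least l with l - A >= 0. If \<mu> - A were injective, it would be bounded
  below by some c > 0, and \<mu> - c would be a smaller such l.\<close>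

lemma hermitian_top_eigenvector:
  assumes "finite I" "I \<noteq> {}" "hermitian_on I A"
  obtains \<mu> :: real and v where "pos_on I 0 (\<lambda>i j. of_real \<mu> * kdelta i j - A i j)"
    and "norm2_on I v \<noteq> 0"
    and "\<And>i. i \<in> I \<Longrightarrow> app_on I (\<lambda>i j. of_real \<mu> * kdelta i j - A i j) v i = 0"
proof -
  define B where "B l = (\<lambda>i j. of_real l * kdelta i j - A i j)" for l :: real
  have herm: "hermitian_on I (B l)" for l
    unfolding B_def by (intro hermitian_on_diff hermitian_on_scale hermitian_on_kdelta assms)
  have form: "Re (form_on I (B l) x) = l * norm2_on I x - Re (form_on I A x)" for l x
    unfolding B_def form_on_diff form_on_scale by (simp add: form_on_kdelta assms(1))
  have pos_iff: "pos_on I c (B l) \<longleftrightarrow> (\<forall>x. Re (form_on I A x) \<le> (l - c) * norm2_on I x)" for l c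
    by (simp add: pos_on_def herm form algebra_simps)
  define S where "S = {l. pos_on I 0 (B l)}"
  have "(\<Sum>i\<in>I. \<Sum>j\<in>I. cmod (A i j)) \<in> S"
    using norm_form_on_le[OF assms(1), of A] complex_Re_le_cmod order.trans
    by (fastforce simp: S_def pos_iff)
  then have ne: "S \<noteq> {}" by blast
  have lower: "Re (form_on I A x) / norm2_on I x \<le> l" if "l \<in> S" "norm2_on I x \<noteq> 0" for l x
    using that norm2_on_nonneg[of I x] by (simp add: S_def pos_iff pos_divide_le_eq order_less_le)
  obtain i0 where i0: "i0 \<in> I" using assms by blast
  \<comment> \<open>A single Rayleigh quotient bounds S from below, so that its infimum is
    meaningful.\<close>
  have "norm2_on I (kdelta i0) \<noteq> 0"
    using i0 by (auto simp: norm2_on_eq_0 assms(1) kdelta_def)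
  then have bdd: "bdd_below S" using lower by (intro bdd_belowI) blast
  define \<mu> where "\<mu> = Inf S"
  have pos: "pos_on I 0 (B \<mu>)"
    unfolding pos_iff
  proof
    fix x
    show "Re (form_on I A x) \<le> (\<mu> - 0) * norm2_on I x"
    proof (cases "norm2_on I x = 0")
      case True
      then have "form_on I A x = 0" using assms(1) by (simp add: norm2_on_eq_0 form_on_eq)
      then show ?thesis using True by simp
    next
      case False
      then have "Re (form_on I A x) / norm2_on I x \<le> \<mu>"
        unfolding \<mu>_def using lower ne by (intro cInf_greatest) auto
      then show ?thesis using False norm2_on_nonneg[of I x] by (simp add: field_simps)
    qed
  qed
  have "\<exists>v. (\<forall>i\<in>I. app_on I (B \<mu>) v i = 0) \<and> norm2_on I v \<noteq> 0"
  proof (rule ccontr)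
    assume "\<not> ?thesis"
    then have "\<And>x. (\<And>i. i \<in> I \<Longrightarrow> app_on I (B \<mu>) x i = 0) \<Longrightarrow> (\<And>i. i \<in> I \<Longrightarrow> x i = 0)"
      using norm2_on_eq_0[OF assms(1)] by blast
    then obtain c where c: "0 < c" "pos_on I c (B \<mu>)"
      using pos_on_bounded_below[OF assms(1) pos] by metis
    then have "\<mu> - c \<in> S" by (simp add: S_def pos_iff)
    then have "\<mu> \<le> \<mu> - c" unfolding \<mu>_def using bdd by (rule cInf_lower)
    then show False using c by simp
  qed
  then show ?thesis using that pos by (auto simp: B_def)
qed

text \<open>The form is controlled by the sum of the moduli of the entries, so entrywise convergence
  is uniform on the forms. Half of the constant is spent on the error.\<close>

lemma pos_on_perturb:
  assumes "finite I" "pos_on I c L" "0 < c"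
    and lim: "\<And>i j. i \<in> I \<Longrightarrow> j \<in> I \<Longrightarrow> ((\<lambda>r. A r i j) \<longlongrightarrow> L i j) F"
    and herm: "\<forall>\<^sub>F r in F. hermitian_on I (A r)"
  shows "\<forall>\<^sub>F r in F. pos_on I (c / 2) (A r)"
proof -
  have "((\<lambda>r. \<Sum>i\<in>I. \<Sum>j\<in>I. cmod (L i j - A r i j)) \<longlongrightarrow> (\<Sum>i\<in>I. \<Sum>j\<in>I. cmod (L i j - L i j))) F"
    by (intro tendsto_sum tendsto_norm tendsto_diff tendsto_const lim)
  then have "\<forall>\<^sub>F r in F. (\<Sum>i\<in>I. \<Sum>j\<in>I. cmod (L i j - A r i j)) < c / 2"
    using assms(3) by (intro order_tendstoD) auto
  with herm show ?thesis
  proof eventually_elim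
    case (elim r)
    show ?case unfolding pos_on_def
    proof (intro conjI allI)
      fix x
      have "cmod (form_on I (\<lambda>i j. L i j - A r i j) x) \<le> c / 2 * norm2_on I x"
        using norm_form_on_le[OF assms(1), of "\<lambda>i j. L i j - A r i j" x] elim(2)
        by (meson less_imp_le mult_right_mono norm2_on_nonneg order.trans)
      then have "Re (form_on I L x) - Re (form_on I (A r) x) \<le> c / 2 * norm2_on I x"
        using complex_Re_le_cmod[of "form_on I (\<lambda>i j. L i j - A r i j) x"]
        by (simp add: form_on_diff)
      then show "c / 2 * norm2_on I x \<le> Re (form_on I (A r) x)"
        using pos_onD[OF assms(2), of x] by linarith
    qed (rule elim)
  qed
qed

section \<open>Square roots\<close>

definition frob2_on :: "'i set \<Rightarrow> ('i \<Rightarrow> 'i \<Rightarrow> complex) \<Rightarrow> real" where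
  "frob2_on I A = (\<Sum>i\<in>I. \<Sum>j\<in>I. (cmod (A i j))\<^sup>2)"

text \<open>With \<open>S = B - C\<close>, \<open>Re tr (S (B\<^sup>2 - C\<^sup>2)) = Re tr (S B S) + Re tr (S C S)\<close>; the first summand is
  nonnegative and the second one is at least \<open>c\<close> times the squared Frobenius norm of \<open>S\<close>.\<close>

lemma square_root_perturb:
  assumes "finite I" "pos_on I 0 B" "pos_on I c C" "0 < c"
  shows "c\<^sup>2 * frob2_on I (\<lambda>i j. B i j - C i j) \<le>
    frob2_on I (\<lambda>i j. mult_on I B B i j - mult_on I C C i j)"
proof -
  define S where "S = (\<lambda>i j. B i j - C i j)"
  define D where "D = (\<lambda>i j. mult_on I B B i j - mult_on I C C i j)"
  have hB: "hermitian_on I B" and hC: "hermitian_on I C"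
    using assms by (auto dest: pos_on_hermitian)
  have hS: "hermitian_on I S" unfolding S_def by (rule hermitian_on_diff[OF hB hC])
  \<comment> \<open>B^2 - C^2 = B S + S C without any commutation; pairing with S gives the two
    trace terms.\<close>
  have D: "D i j = mult_on I B S i j + mult_on I S C i j" for i j
    by (simp add: D_def S_def mult_on_def right_diff_distrib left_diff_distrib
        flip: sum_subtractf sum.distrib)
  have frob: "frob2_on I A = norm2_on (I \<times> I) (\<lambda>(i, j). A i j)" for A :: "'a \<Rightarrow> 'a \<Rightarrow> complex"
    by (simp add: frob2_on_def norm2_on_def sum.cartesian_product case_prod_unfold)
  have frobS: "frob2_on I S = (\<Sum>j\<in>I. norm2_on I (\<lambda>i. S i j))"
    unfolding frob2_on_def norm2_on_def by (rule sum.swap)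
  define t1 where "t1 = (\<Sum>j\<in>I. form_on I B (\<lambda>i. S i j))"
  define t2 where "t2 = (\<Sum>i\<in>I. form_on I C (\<lambda>j. S j i))"
  have "(\<Sum>i\<in>I. \<Sum>j\<in>I. mult_on I B S i j * cnj (S i j)) = t1"
    unfolding t1_def form_on_def inner_on_def app_on_def mult_on_def by (rule sum.swap)
  moreover have "(\<Sum>i\<in>I. \<Sum>j\<in>I. mult_on I S C i j * cnj (S i j)) = t2"
    unfolding t2_def
  proof (rule sum.cong[OF refl])
    fix i assume i: "i \<in> I"
    have S: "S i k = cnj (S k i)" "cnj (S i k) = S k i" if "k \<in> I" for k
      using hS i that by (auto simp: hermitian_on_def)
    have "(\<Sum>j\<in>I. mult_on I S C i j * cnj (S i j)) =
        (\<Sum>j\<in>I. \<Sum>k\<in>I. cnj (S k i) * C k j * S j i)"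
      unfolding mult_on_def sum_distrib_right by (intro sum.cong) (auto simp: S)
    also have "\<dots> = (\<Sum>k\<in>I. \<Sum>j\<in>I. cnj (S k i) * C k j * S j i)" by (rule sum.swap)
    finally show "(\<Sum>j\<in>I. mult_on I S C i j * cnj (S i j)) = form_on I C (\<lambda>j. S j i)"
      by (simp add: form_on_eq)
  qed
  ultimately have tr: "inner_on (I \<times> I) (\<lambda>(i, j). D i j) (\<lambda>(i, j). S i j) = t1 + t2"
    unfolding inner_on_def
    using sum.cartesian_product[of "\<lambda>i j. D i j * cnj (S i j)" I I]
    by (simp add: case_prod_unfold sum.distrib distrib_right D)
  have "0 \<le> Re t1"
    unfolding t1_def Re_sum using pos_onD[OF assms(2)] by (intro sum_nonneg) simp
  moreover have "c * frob2_on I S \<le> Re t2"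
    unfolding t2_def Re_sum frobS sum_distrib_left by (intro sum_mono pos_onD assms)
  ultimately have "c * frob2_on I S \<le> cmod (t1 + t2)"
    using complex_Re_le_cmod[of "t1 + t2"] by simp
  moreover have nn: "0 \<le> frob2_on I S" by (simp add: frob2_on_def sum_nonneg)
  ultimately have "(c * frob2_on I S)\<^sup>2 \<le> (cmod (t1 + t2))\<^sup>2"
    using assms(4) by (intro power_mono) auto
  also have "\<dots> \<le> frob2_on I D * frob2_on I S"
    unfolding tr[symmetric] frob using assms(1) by (intro cauchy_schwarz_on) simp
  finally have le: "(c\<^sup>2 * frob2_on I S) * frob2_on I S \<le> frob2_on I D * frob2_on I S"
    by (simp add: power2_eq_square mult_ac)
  have "c\<^sup>2 * frob2_on I S \<le> frob2_on I D"
  proof (cases "frob2_on I S = 0")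
    case True
    then show ?thesis by (simp add: frob2_on_def sum_nonneg)
  next
    case False
    then show ?thesis using le nn by simp
  qed
  then show ?thesis by (simp add: S_def D_def)
qed

lemma frob2_on_entry: "finite I \<Longrightarrow> i \<in> I \<Longrightarrow> j \<in> I \<Longrightarrow> (cmod (A i j))\<^sup>2 \<le> frob2_on I A"
  unfolding frob2_on_def
  using member_le_sum[of j I "\<lambda>j. (cmod (A i j))\<^sup>2"]
    member_le_sum[of i I "\<lambda>i. \<Sum>j\<in>I. (cmod (A i j))\<^sup>2"]
  by (simp add: sum_nonneg)

text \<open>Only one of the roots has to be bounded below. The other may be any semidefinite root,
  as in the definite description behind \<open>mat_sqrt\<close>.\<close>

lemma square_root_unique:
  assumes "finite I" "pos_on I 0 B" "pos_on I c C" "0 < c"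
    and "\<And>i j. i \<in> I \<Longrightarrow> j \<in> I \<Longrightarrow> mult_on I B B i j = mult_on I C C i j"
    and "i \<in> I" "j \<in> I"
  shows "B i j = C i j"
proof -
  have "frob2_on I (\<lambda>i j. mult_on I B B i j - mult_on I C C i j) = 0"
    using assms(5) by (simp add: frob2_on_def)
  then have "frob2_on I (\<lambda>i j. B i j - C i j) \<le> 0"
    using square_root_perturb[OF assms(1-4)] assms(4) by (simp add: mult_le_0_iff)
  then have "(cmod (B i j - C i j))\<^sup>2 \<le> 0"
    using frob2_on_entry[OF assms(1,6,7), of "\<lambda>i j. B i j - C i j"] by linarith
  then show ?thesis by simp
qed

text \<open>\<open>square_root_perturb\<close> is a Lipschitz estimate at C whose constant depends
  on the lower bound of C alone, so the approximating roots \<open>B r\<close> need no uniform lower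
  bound.\<close>

lemma square_root_tendsto:
  assumes "finite I" "pos_on I c C" "0 < c" "\<forall>\<^sub>F r in F. pos_on I 0 (B r)"
    and lim: "\<And>i j. i \<in> I \<Longrightarrow> j \<in> I \<Longrightarrow> ((\<lambda>r. mult_on I (B r) (B r) i j) \<longlongrightarrow> mult_on I C C i j) F"
    and "i \<in> I" "j \<in> I"
  shows "((\<lambda>r. B r i j) \<longlongrightarrow> C i j) F"
proof -
  define e where "e r = frob2_on I (\<lambda>i j. mult_on I (B r) (B r) i j - mult_on I C C i j)" for r
  have "(e \<longlongrightarrow> (\<Sum>i\<in>I. \<Sum>j\<in>I. (cmod (mult_on I C C i j - mult_on I C C i j))\<^sup>2)) F"
    unfolding e_def frob2_on_def
    by (intro tendsto_sum tendsto_power tendsto_norm tendsto_diff tendsto_const lim)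
  then have "(e \<longlongrightarrow> 0) F" by simp
  then have e0: "((\<lambda>r. e r / c\<^sup>2) \<longlongrightarrow> 0) F" by (rule tendsto_divide_zero)
  have le: "\<forall>\<^sub>F r in F. (cmod (B r i j - C i j))\<^sup>2 \<le> e r / c\<^sup>2"
    using assms(4)
  proof eventually_elim
    case (elim r)
    have "c\<^sup>2 * (cmod (B r i j - C i j))\<^sup>2 \<le> c\<^sup>2 * frob2_on I (\<lambda>i j. B r i j - C i j)"
      using frob2_on_entry[OF assms(1,6,7), of "\<lambda>i j. B r i j - C i j"]
      by (intro mult_left_mono) auto
    also have "\<dots> \<le> e r" unfolding e_def by (rule square_root_perturb[OF assms(1) elim assms(2,3)])
    finally show ?case using assms(3) by (simp add: field_simps)
  qed
  have "((\<lambda>r. (cmod (B r i j - C i j))\<^sup>2) \<longlongrightarrow> 0) F"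
    by (rule tendsto_sandwich[OF _ le tendsto_const e0]) simp
  then have "((\<lambda>r. sqrt ((cmod (B r i j - C i j))\<^sup>2)) \<longlongrightarrow> sqrt 0) F"
    by (rule tendsto_real_sqrt)
  then have "((\<lambda>r. cmod (B r i j - C i j)) \<longlongrightarrow> 0) F" by simp
  then show ?thesis by (simp add: tendsto_norm_zero_iff LIM_zero_iff)
qed

section \<open>Operator bounds and existence of square roots\<close>

definition norm_on :: "'i set \<Rightarrow> ('i \<Rightarrow> complex) \<Rightarrow> real" where
  "norm_on I x = sqrt (norm2_on I x)"

definition opbound_on :: "'i set \<Rightarrow> real \<Rightarrow> ('i \<Rightarrow> 'i \<Rightarrow> complex) \<Rightarrow> bool" where
  "opbound_on I a A \<longleftrightarrow> (\<forall>x. norm_on I (app_on I A x) \<le> a * norm_on I x)"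

lemma norm_on_nonneg [simp]: "0 \<le> norm_on I x"
  by (simp add: norm_on_def)

lemma norm_on_triangle: "norm_on I (\<lambda>i. x i + y i) \<le> norm_on I x + norm_on I y"
proof -
  have L2: "norm_on I x = L2_set (\<lambda>i. cmod (x i)) I" for x
    by (simp add: norm_on_def norm2_on_def L2_set_def)
  have "norm_on I (\<lambda>i. x i + y i) \<le> L2_set (\<lambda>i. cmod (x i) + cmod (y i)) I"
    unfolding L2 by (intro L2_set_mono norm_triangle_ineq) auto
  also have "\<dots> \<le> norm_on I x + norm_on I y" unfolding L2 by (rule L2_set_triangle_ineq)
  finally show ?thesis .
qed

lemma norm_on_scale: "norm_on I (\<lambda>i. a * x i) = cmod a * norm_on I x"
  by (simp add: norm_on_def norm2_on_def norm_mult power_mult_distrib real_sqrt_mult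
      flip: sum_distrib_left)

lemma opbound_on_add:
  assumes "opbound_on I a A" "opbound_on I b B"
  shows "opbound_on I (a + b) (\<lambda>i j. A i j + B i j)"
  unfolding opbound_on_def
proof
  fix x
  have "app_on I (\<lambda>i j. A i j + B i j) x = (\<lambda>i. app_on I A x i + app_on I B x i)"
    by (simp add: app_on_def distrib_right sum.distrib)
  then show "norm_on I (app_on I (\<lambda>i j. A i j + B i j) x) \<le> (a + b) * norm_on I x"
    using norm_on_triangle[of I "app_on I A x" "app_on I B x"] assms[unfolded opbound_on_def, rule_format, of x]
    by (simp add: distrib_right)
qed

lemma opbound_on_scale:
  assumes "opbound_on I a A"
  shows "opbound_on I (cmod z * a) (\<lambda>i j. z * A i j)"
proof -
  have "app_on I (\<lambda>i j. z * A i j) x = (\<lambda>i. z * app_on I A x i)" for x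
    by (simp add: app_on_def sum_distrib_left mult.assoc)
  then show ?thesis using assms
    by (auto simp: opbound_on_def norm_on_scale mult.assoc intro: mult_left_mono)
qed

lemma opbound_on_mult:
  assumes "opbound_on I a A" "opbound_on I b B" "0 \<le> a"
  shows "opbound_on I (a * b) (mult_on I A B)"
  unfolding opbound_on_def
proof
  fix x
  have "norm_on I (app_on I A (app_on I B x)) \<le> a * norm_on I (app_on I B x)"
    using assms(1) by (simp add: opbound_on_def)
  also have "\<dots> \<le> a * (b * norm_on I x)"
    using assms by (intro mult_left_mono) (auto simp: opbound_on_def)
  finally show "norm_on I (app_on I (mult_on I A B) x) \<le> a * b * norm_on I x"
    by (simp add: app_on_mult mult.assoc)
qed

lemma opbound_on_entry:
  assumes "finite I" "opbound_on I a A" "i \<in> I" "j \<in> I"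
  shows "cmod (A i j) \<le> a"
proof -
  have "app_on I A (kdelta j) k = A k j" for k
    using assms by (simp add: app_on_def kdelta_def if_distrib[of "\<lambda>z. _ * z"] cong: if_cong)
  then have "app_on I A (kdelta j) = (\<lambda>k. A k j)" by (rule ext)
  then have "norm_on I (\<lambda>k. A k j) \<le> a * norm_on I (kdelta j)"
    using assms(2)[unfolded opbound_on_def, rule_format, of "kdelta j"] by simp
  moreover have "(\<Sum>k\<in>I. (cmod (kdelta j k))\<^sup>2) = (\<Sum>k\<in>I. if j = k then 1 else 0)"
    by (rule sum.cong) (auto simp: kdelta_def)
  then have "norm_on I (kdelta j) = 1"
    using assms by (simp add: norm_on_def norm2_on_def)
  moreover have "cmod (A i j) \<le> norm_on I (\<lambda>k. A k j)"
    unfolding norm_on_def norm2_on_def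
    by (rule real_le_rsqrt, rule member_le_sum[of i I "\<lambda>i. (cmod (A i j))\<^sup>2"]) (use assms in auto)
  ultimately show ?thesis by simp
qed

lemma form_on_opbound:
  assumes "finite I" "opbound_on I a A"
  shows "cmod (form_on I A x) \<le> a * norm2_on I x"
proof -
  have "cmod (form_on I A x) \<le> sqrt (norm2_on I (app_on I A x) * norm2_on I x)"
    unfolding form_on_def using cauchy_schwarz_on[OF assms(1)] by (rule real_le_rsqrt)
  also have "\<dots> = norm_on I (app_on I A x) * norm_on I x"
    by (simp add: norm_on_def real_sqrt_mult)
  also have "\<dots> \<le> (a * norm_on I x) * norm_on I x"
    using assms(2) by (intro mult_right_mono) (auto simp: opbound_on_def)
  finally show ?thesis by (simp add: norm_on_def mult.assoc)
qed

text \<open>\<open>1 - Z\<close> is a square root of \<open>1 - H\<close> if \<open>Z = (H + Z\<^sup>2) / 2\<close>, and iterating this equation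
  converges because \<open>\<parallel>H\<parallel> < 1\<close>.\<close>

lemma square_root_exists_contraction:
  assumes fin: "finite I" and herm: "hermitian_on I H" and H: "opbound_on I q H"
    and q: "0 \<le> q" "q < 1"
  obtains c B where "0 < c" "pos_on I c B"
    and "\<And>i j. i \<in> I \<Longrightarrow> j \<in> I \<Longrightarrow> mult_on I B B i j = kdelta i j - H i j"
proof -
  \<comment> \<open>The smaller solution of z = (q + z^2) / 2, the scalar form of the fixed point
    equation; hence the bound z on the iterates reproduces itself.\<close>
  define z where "z = 1 - sqrt (1 - q)"
  have z: "0 \<le> z" "z < 1" using q by (auto simp: z_def)
  have zq: "q + z * z = 2 * z"
    using q by (simp add: z_def algebra_simps)
  define Z where "Z = rec_nat (\<lambda>i j. 0) (\<lambda>_ Y i j. (1 / 2) * (H i j + mult_on I Y Y i j))"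
  have Z0: "Z 0 = (\<lambda>i j. 0)" and ZS: "Z (Suc k) = (\<lambda>i j. (1 / 2) * (H i j + mult_on I (Z k) (Z k) i j))" for k
    by (simp_all add: Z_def)
  have bZ: "opbound_on I z (Z k)" for k
  proof (induction k)
    case 0
    show ?case using z by (simp add: Z0 opbound_on_def app_on_def norm_on_def norm2_on_def sum_nonneg)
  next
    case (Suc k)
    have "opbound_on I (cmod (1 / 2) * (q + z * z)) (Z (Suc k))"
      unfolding ZS by (intro opbound_on_scale opbound_on_add opbound_on_mult H Suc z)
    then show ?case by (simp add: zq)
  qed
  have hZ: "hermitian_on I (Z k)" for k
  proof (induction k)
    case (Suc k)
    then show ?case using herm
      by (auto simp: hermitian_on_def ZS mult_on_def mult.commute intro!: sum.cong)
  qed (simp add: Z0 hermitian_on_def)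
  define D where "D k = (\<lambda>i j. Z (Suc k) i j - Z k i j)" for k
  have DS: "D (Suc k) = (\<lambda>i j. (1 / 2) * (mult_on I (Z (Suc k)) (D k) i j + mult_on I (D k) (Z k) i j))" for k
  proof (intro ext)
    fix i j
    have "mult_on I (Z (Suc k)) (D k) i j + mult_on I (D k) (Z k) i j =
        mult_on I (Z (Suc k)) (Z (Suc k)) i j - mult_on I (Z k) (Z k) i j"
      by (simp add: D_def mult_on_def right_diff_distrib left_diff_distrib
          flip: sum_subtractf sum.distrib)
    then show "D (Suc k) i j = (1 / 2) * (mult_on I (Z (Suc k)) (D k) i j + mult_on I (D k) (Z k) i j)"
      by (subst (asm) ZS) (simp add: D_def ZS[of k] ZS[of "Suc k"] algebra_simps)
  qed
  \<comment> \<open>Successive differences shrink by the factor z, because each of the two products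
    in \<open>DS\<close> has an iterate of norm at most z as a factor and the sum is halved.\<close>
  have bD: "opbound_on I (z ^ k) (D k)" for k
  proof (induction k)
    case 0
    have "opbound_on I z (D 0)" using bZ[of 1] by (simp add: D_def Z0)
    then have "norm_on I (app_on I (D 0) x) \<le> 1 * norm_on I x" for x
      unfolding opbound_on_def using z mult_right_mono[of z 1 "norm_on I x"]
      by (metis less_imp_le norm_on_nonneg order.trans)
    then show ?case by (simp add: opbound_on_def)
  next
    case (Suc k)
    have "opbound_on I (cmod (1 / 2) * (z * z ^ k + z ^ k * z)) (D (Suc k))"
      unfolding DS by (intro opbound_on_scale opbound_on_add opbound_on_mult Suc bZ z zero_le_power)
    then show ?case by (simp add: mult_ac)
  qed
  define W where "W = (\<lambda>i j. lim (\<lambda>k. Z k i j))"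
  have "convergent (\<lambda>k. Z k i j)" if "i \<in> I" "j \<in> I" for i j
  proof -
    have "summable (\<lambda>k. D k i j)"
      using opbound_on_entry[OF fin bD that] z
      by (intro summable_comparison_test[OF _ summable_geometric[of z]]) auto
    then have "summable (\<lambda>k. Z (Suc k) i j - Z k i j)" by (simp add: D_def)
    then have "convergent (\<lambda>n. \<Sum>k<n. Z (Suc k) i j - Z k i j)" by (simp only: summable_iff_convergent)
    moreover have "(\<lambda>n. \<Sum>k<n. Z (Suc k) i j - Z k i j) = (\<lambda>n. Z n i j)"
      using sum_lessThan_telescope[of "\<lambda>k. Z k i j"] by (simp add: Z0)
    ultimately show ?thesis by simp
  qed
  then have W: "(\<lambda>k. Z k i j) \<longlonglongrightarrow> W i j" if "i \<in> I" "j \<in> I" for i j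
    using that by (simp add: W_def convergent_LIMSEQ_iff)
  have fixpoint: "W i j = (1 / 2) * (H i j + mult_on I W W i j)" if "i \<in> I" "j \<in> I" for i j
  proof (rule LIMSEQ_unique)
    show "(\<lambda>k. Z (Suc k) i j) \<longlonglongrightarrow> W i j" using W[OF that] by (rule LIMSEQ_Suc)
    show "(\<lambda>k. Z (Suc k) i j) \<longlonglongrightarrow> (1 / 2) * (H i j + mult_on I W W i j)"
      unfolding ZS mult_on_def by (intro tendsto_intros W that)
  qed
  define B where "B = (\<lambda>i j. kdelta i j - W i j)"
  have "hermitian_on I W"
    unfolding hermitian_on_def
  proof (intro ballI)
    fix i j assume ij: "i \<in> I" "j \<in> I"
    have "(\<lambda>k. Z k j i) \<longlonglongrightarrow> cnj (W i j)"
      using tendsto_cnj[OF W[OF ij]] hZ ij by (simp add: hermitian_on_def)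
    then show "cnj (W i j) = W j i" using W[OF ij(2,1)] by (rule LIMSEQ_unique)
  qed
  then have hB: "hermitian_on I B"
    unfolding B_def by (rule hermitian_on_diff[OF hermitian_on_kdelta])
  have "Re (form_on I W x) \<le> z * norm2_on I x" for x
  proof (rule LIMSEQ_le_const2)
    show "(\<lambda>k. Re (form_on I (Z k) x)) \<longlonglongrightarrow> Re (form_on I W x)"
      unfolding form_on_eq by (intro tendsto_intros W)
    show "\<exists>N. \<forall>k\<ge>N. Re (form_on I (Z k) x) \<le> z * norm2_on I x"
      by (intro exI allI impI order.trans[OF complex_Re_le_cmod] form_on_opbound[OF fin bZ])
  qed
  then have "pos_on I (1 - z) B"
    unfolding pos_on_def B_def form_on_diff
    using hB by (simp add: form_on_kdelta fin B_def left_diff_distrib)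
  moreover have "mult_on I B B i j = kdelta i j - H i j" if "i \<in> I" "j \<in> I" for i j
  proof -
    have d: "(\<Sum>k\<in>I. kdelta i k * kdelta k j) = kdelta i j" "(\<Sum>k\<in>I. kdelta i k * W k j) = W i j"
      "(\<Sum>k\<in>I. W i k * kdelta k j) = W i j"
      using that fin
      by (simp_all add: kdelta_def if_distrib[of "\<lambda>z. _ * z"] if_distrib[of "\<lambda>z. z * _"] cong: if_cong)
    have "mult_on I B B i j = kdelta i j - 2 * W i j + mult_on I W W i j"
      unfolding mult_on_def B_def left_diff_distrib right_diff_distrib sum_subtractf d by simp
    moreover have "2 * W i j = H i j + mult_on I W W i j" by (subst fixpoint[OF that]) simp
    ultimately show ?thesis by (simp add: algebra_simps)
  qed
  ultimately show ?thesis using that[of "1 - z" B] z by simp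
qed

text \<open>Rescaling reduces this to the contractive case: H = 1 - A / M satisfies 0 <= H <= 1 - c
  / M, and the root is multiplied by sqrt M at the end. Adding c to the entry sum ensures M > 0 and
  c <= M, so that q lies in [0, 1).\<close>

lemma square_root_exists:
  assumes fin: "finite I" and A: "pos_on I c A" and c: "0 < c"
  obtains c' B where "0 < c'" "pos_on I c' B"
    and "\<And>i j. i \<in> I \<Longrightarrow> j \<in> I \<Longrightarrow> mult_on I B B i j = A i j"
proof -
  define M where "M = (\<Sum>i\<in>I. \<Sum>j\<in>I. cmod (A i j)) + c"
  have "0 \<le> (\<Sum>i\<in>I. \<Sum>j\<in>I. cmod (A i j))" by (intro sum_nonneg) auto
  then have M: "c \<le> M" "0 < M" using c by (auto simp: M_def)
  define H where "H = (\<lambda>i j. kdelta i j - of_real (1 / M) * A i j)"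
  define q where "q = 1 - c / M"
  have q: "0 \<le> q" "q < 1" using M c by (auto simp: q_def field_simps)
  have hH: "hermitian_on I H"
    unfolding H_def using A
    by (intro hermitian_on_diff hermitian_on_scale hermitian_on_kdelta pos_on_hermitian)
  have fH: "Re (form_on I H x) = norm2_on I x - Re (form_on I A x) / M" for x
    unfolding H_def form_on_diff form_on_scale using fin by (simp add: form_on_kdelta del: of_real_divide)
  have "pos_on I 0 H"
    unfolding pos_on_def
  proof (intro conjI allI hH)
    fix x
    have "Re (form_on I A x) \<le> cmod (form_on I A x)" by (rule complex_Re_le_cmod)
    also have "\<dots> \<le> (M - c) * norm2_on I x" using norm_form_on_le[OF fin] by (simp add: M_def)
    also have "\<dots> \<le> M * norm2_on I x" using c by (intro mult_right_mono) auto
    finally show "0 * norm2_on I x \<le> Re (form_on I H x)" using M by (simp add: fH field_simps)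
  qed
  moreover have fHq: "Re (form_on I H x) \<le> q * norm2_on I x" for x
  proof -
    have "c * norm2_on I x / M \<le> Re (form_on I A x) / M"
      using pos_onD[OF A, of x] M by (intro divide_right_mono) auto
    then show ?thesis by (simp add: fH q_def left_diff_distrib)
  qed
  ultimately have "norm2_on I (app_on I H x) \<le> q\<^sup>2 * norm2_on I x" for x
    using q by (intro pos_on_app_bound[OF fin])
  then have "opbound_on I q H"
    using q by (auto simp: opbound_on_def norm_on_def real_sqrt_mult intro!: real_le_lsqrt simp: power_mult_distrib)
  from square_root_exists_contraction[OF fin hH this q] obtain c' B
    where B: "0 < c'" "pos_on I c' B"
      and BB: "\<And>i j. i \<in> I \<Longrightarrow> j \<in> I \<Longrightarrow> mult_on I B B i j = kdelta i j - H i j" by blast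
  define E where "E = (\<lambda>i j. of_real (sqrt M) * B i j)"
  have "pos_on I (sqrt M * c') E"
    unfolding pos_on_def E_def form_on_scale
    using pos_onD[OF B(2)] M pos_on_hermitian[OF B(2)]
    by (auto intro!: hermitian_on_scale mult_left_mono simp: mult.assoc)
  moreover have "mult_on I E E i j = A i j" if "i \<in> I" "j \<in> I" for i j
  proof -
    have "mult_on I E E i j = of_real (sqrt M * sqrt M) * mult_on I B B i j"
      by (simp add: mult_on_def E_def sum_distrib_left mult_ac del: real_sqrt_mult_self)
    also have "\<dots> = A i j" using M by (simp add: BB[OF that] H_def)
    finally show ?thesis .
  qed
  ultimately show ?thesis using that[of "sqrt M * c'" E] B M by simp
qed

section \<open>Kronecker products and limits of matrices\<close>

lemma sum_lessThan_mult:
  fixes f :: "nat \<Rightarrow> 'a::comm_monoid_add"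
  shows "(\<Sum>k<a * b. f k) = (\<Sum>i<a. \<Sum>j<b. f (i * b + j))"
proof (induction a)
  case (Suc a)
  have "{..<Suc a * b} = {..<a * b} \<union> {a * b..<a * b + b}" by auto
  then have "(\<Sum>k<Suc a * b. f k) = (\<Sum>k<a * b. f k) + (\<Sum>k=a * b..<a * b + b. f k)"
    by (simp add: sum.union_disjoint ivl_disj_int)
  also have "(\<Sum>k=a * b..<a * b + b. f k) = (\<Sum>j<b. f (a * b + j))"
    using sum.shift_bounds_nat_ivl[of f 0 "a * b" b] by (simp add: add.commute lessThan_atLeast0)
  finally show ?case by (simp add: Suc)
qed simp

lemma mult_add_less: "i < a \<Longrightarrow> j < b \<Longrightarrow> i * b + j < a * (b::nat)"
proof -
  assume "i < a" "j < b"
  then have "i * b + j < Suc i * b" by simp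
  also have "\<dots> \<le> a * b" using \<open>i < a\<close> by (intro mult_right_mono) auto
  finally show ?thesis .
qed

lemma ex_mult_add: "k < a * b \<Longrightarrow> \<exists>i j. i < a \<and> j < b \<and> k = i * b + (j::nat)"
  by (metis div_mult_mod_eq less_mult_imp_div_less mod_less_divisor mult_0_right not_gr_zero not_less0)

text \<open>\<open>mat_inv\<close> is the result of an elimination algorithm. It is accessed only
  through this characterization by a one-sided inverse and through
  \<open>mat_inv_invertible\<close>, which is derived from it.\<close>

lemma mat_inv_eqI:
  assumes "A \<in> carrier_mat n n" "B \<in> carrier_mat n n" "A * B = 1\<^sub>m n"
  shows "mat_inv A = B"
proof -
  have BA: "B * A = 1\<^sub>m n" by (rule mat_mult_left_right_inverse[OF assms])
  then have "A \<in> Units (ring_mat TYPE(complex) n ())"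
    using assms by (auto simp: Units_def ring_mat_def)
  then obtain C where C: "mat_inverse A = Some C"
    using mat_inverse(1)[OF assms(1), where b = "()"] by (cases "mat_inverse A") auto
  from mat_inverse(2)[OF assms(1) this]
  have *: "A * C = 1\<^sub>m n" "C * A = 1\<^sub>m n" "C \<in> carrier_mat n n" by auto
  have "C = C * (A * B)" using assms(3) *(3) by simp
  also have "\<dots> = (C * A) * B" by (rule assoc_mult_mat[symmetric, OF *(3) assms(1,2)])
  also have "\<dots> = B" using *(2) assms(2) by simp
  finally have "C = B" .
  then show ?thesis by (simp add: mat_inv_def C)
qed

lemma mat_inv_invertible:
  assumes "A \<in> carrier_mat n n" "det A \<noteq> 0"
  shows "mat_inv A \<in> carrier_mat n n" "A * mat_inv A = 1\<^sub>m n" "mat_inv A * A = 1\<^sub>m n"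
    and "mat_inv A = (1 / det A) \<cdot>\<^sub>m adj_mat A"
proof -
  let ?B = "(1 / det A) \<cdot>\<^sub>m adj_mat A"
  have B: "?B \<in> carrier_mat n n" "A * ?B = 1\<^sub>m n" "?B * A = 1\<^sub>m n"
    using adj_mat[OF assms(1)] assms
    by (auto simp: mult_smult_distrib[of _ n n _ n] mult_smult_assoc_mat[of _ n n _ n])
  have *: "mat_inv A = ?B" by (rule mat_inv_eqI[OF assms(1) B(1,2)])
  show "mat_inv A = ?B" by (rule *)
  show "mat_inv A \<in> carrier_mat n n" "A * mat_inv A = 1\<^sub>m n" "mat_inv A * A = 1\<^sub>m n"
    unfolding * by (fact B)+
qed

lemma index_kron:
  assumes "i < dim_row A" "p < dim_row B" "j < dim_col A" "q < dim_col B"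
  shows "kron A B $$ (i * dim_row B + p, j * dim_col B + q) = A $$ (i, j) * B $$ (p, q)"
proof -
  have "(i * dim_row B + p) div dim_row B = i" "(i * dim_row B + p) mod dim_row B = p"
    "(j * dim_col B + q) div dim_col B = j" "(j * dim_col B + q) mod dim_col B = q"
    using assms by auto
  then show ?thesis
    unfolding kron_def index_mat(1)[OF mult_add_less[OF assms(1,2)] mult_add_less[OF assms(3,4)]]
    by simp
qed

lemma dim_kron [simp]: "dim_row (kron A B) = dim_row A * dim_row B" "dim_col (kron A B) = dim_col A * dim_col B"
  by (simp_all add: kron_def)

lemma kron_carrier: "A \<in> carrier_mat a b \<Longrightarrow> B \<in> carrier_mat c d \<Longrightarrow> kron A B \<in> carrier_mat (a * c) (b * d)"
  by auto

lemma kron_mult: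
  assumes "A \<in> carrier_mat a b" "C \<in> carrier_mat b e" "B \<in> carrier_mat c d" "D \<in> carrier_mat d f"
  shows "kron A B * kron C D = kron (A * C) (B * D)"
proof (rule eq_matI)
  fix k l
  assume "k < dim_row (kron (A * C) (B * D))" "l < dim_col (kron (A * C) (B * D))"
  then obtain i p j q where
    kl: "i < a" "p < c" "k = i * c + p" "j < e" "q < f" "l = j * f + q"
    using assms ex_mult_add[of k a c] ex_mult_add[of l e f] by auto
  have "(kron A B * kron C D) $$ (k, l) = (\<Sum>m<b * d. kron A B $$ (k, m) * kron C D $$ (m, l))"
    using assms kl by (simp add: scalar_prod_def mult_add_less lessThan_atLeast0)
  also have "\<dots> = (\<Sum>x<b. \<Sum>y<d. kron A B $$ (i * c + p, x * d + y) * kron C D $$ (x * d + y, j * f + q))"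
    by (simp only: sum_lessThan_mult kl)
  also have "\<dots> = (\<Sum>x<b. \<Sum>y<d. (A $$ (i, x) * C $$ (x, j)) * (B $$ (p, y) * D $$ (y, q)))"
    using kl assms index_kron[of i A p B] index_kron[of _ C _ D j q]
    by (intro sum.cong) (auto simp: mult_ac)
  also have "\<dots> = (A * C) $$ (i, j) * (B * D) $$ (p, q)"
    using kl assms by (simp add: scalar_prod_def lessThan_atLeast0 sum_product)
  also have "\<dots> = kron (A * C) (B * D) $$ (k, l)"
    using kl assms index_kron[of i "A * C" p "B * D" j q] by simp
  finally show "(kron A B * kron C D) $$ (k, l) = kron (A * C) (B * D) $$ (k, l)" .
qed (use assms in auto)

lemma kron_one: "kron (1\<^sub>m a) (1\<^sub>m b) = 1\<^sub>m (a * b)"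
proof (rule eq_matI)
  fix k l
  assume "k < dim_row (1\<^sub>m (a * b))" "l < dim_col (1\<^sub>m (a * b))"
  then obtain i p j q where
    kl: "i < a" "p < b" "k = i * b + p" "j < a" "q < b" "l = j * b + q"
    using ex_mult_add[of k a b] ex_mult_add[of l a b] by auto
  moreover have "i * b + p = j * b + q \<longleftrightarrow> i = j \<and> p = q"
  proof
    assume eq: "i * b + p = j * b + q"
    have "i = (i * b + p) div b" "j = (j * b + q) div b" "p = (i * b + p) mod b" "q = (j * b + q) mod b"
      using kl by auto
    then show "i = j \<and> p = q" using eq by metis
  qed simp
  ultimately show "kron (1\<^sub>m a) (1\<^sub>m b) $$ (k, l) = 1\<^sub>m (a * b) $$ (k, l)"
    using index_kron[of i "1\<^sub>m a" p "1\<^sub>m b" j q] by (auto simp: mult_add_less)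
qed auto

lemma kron_assoc: "kron (kron A B) C = kron A (kron B C)"
proof (rule eq_matI)
  fix k l
  assume "k < dim_row (kron A (kron B C))" "l < dim_col (kron A (kron B C))"
  then obtain i p j q where
    kl: "i < dim_row A" "p < dim_row B * dim_row C" "k = i * (dim_row B * dim_row C) + p"
      "j < dim_col A" "q < dim_col B * dim_col C" "l = j * (dim_col B * dim_col C) + q"
    using ex_mult_add[of k "dim_row A" "dim_row B * dim_row C"]
      ex_mult_add[of l "dim_col A" "dim_col B * dim_col C"] by auto
  obtain p1 p2 q1 q2 where
    pq: "p1 < dim_row B" "p2 < dim_row C" "p = p1 * dim_row C + p2"
      "q1 < dim_col B" "q2 < dim_col C" "q = q1 * dim_col C + q2"
    using kl ex_mult_add[of p "dim_row B" "dim_row C"] ex_mult_add[of q "dim_col B" "dim_col C"] by auto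
  have k: "k = (i * dim_row B + p1) * dim_row C + p2" "l = (j * dim_col B + q1) * dim_col C + q2"
    using kl pq by (auto simp: algebra_simps)
  have "kron (kron A B) C $$ (k, l) =
      kron A B $$ (i * dim_row B + p1, j * dim_col B + q1) * C $$ (p2, q2)"
    unfolding k using mult_add_less[OF kl(1) pq(1)] mult_add_less[OF kl(4) pq(4)] pq
    by (intro index_kron) simp_all
  also have "\<dots> = A $$ (i, j) * (B $$ (p1, q1) * C $$ (p2, q2))"
    by (simp only: index_kron kl pq mult.assoc)
  also have "\<dots> = A $$ (i, j) * kron B C $$ (p, q)"
    by (simp only: index_kron pq)
  also have "\<dots> = kron A (kron B C) $$ (k, l)"
    using index_kron[of i A p "kron B C" j q] kl by simp
  finally show "kron (kron A B) C $$ (k, l) = kron A (kron B C) $$ (k, l)" .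
qed (auto simp: mult_ac)

section \<open>Entrywise limits of matrices\<close>

lemma mat_tendsto_carrier: "mat_tendsto A L F \<Longrightarrow> L \<in> carrier_mat a b \<Longrightarrow> \<forall>\<^sub>F r in F. A r \<in> carrier_mat a b"
  by (auto simp: mat_tendsto_def)

lemma mat_tendsto_index:
  "mat_tendsto A L F \<Longrightarrow> p < dim_row L \<Longrightarrow> q < dim_col L \<Longrightarrow> ((\<lambda>r. A r $$ (p, q)) \<longlongrightarrow> L $$ (p, q)) F"
  by (auto simp: mat_tendsto_def)

lemma mat_tendsto_const [intro]: "mat_tendsto (\<lambda>_. L) L F"
  by (auto simp: mat_tendsto_def)

lemma mat_tendsto_mult:
  assumes "mat_tendsto A K F" "mat_tendsto B L F" "dim_col K = dim_row L"
  shows "mat_tendsto (\<lambda>r. A r * B r) (K * L) F"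
  unfolding mat_tendsto_def
proof (intro conjI allI impI)
  have A: "\<forall>\<^sub>F r in F. A r \<in> carrier_mat (dim_row K) (dim_row L)"
    and B: "\<forall>\<^sub>F r in F. B r \<in> carrier_mat (dim_row L) (dim_col L)"
    using assms by (auto simp: mat_tendsto_def)
  show "\<forall>\<^sub>F r in F. A r * B r \<in> carrier_mat (dim_row (K * L)) (dim_col (K * L))"
    using A B by eventually_elim auto
  fix p q assume pq: "p < dim_row (K * L)" "q < dim_col (K * L)"
  have "((\<lambda>r. \<Sum>k<dim_row L. A r $$ (p, k) * B r $$ (k, q)) \<longlongrightarrow>
      (\<Sum>k<dim_row L. K $$ (p, k) * L $$ (k, q))) F"
    by (intro tendsto_sum tendsto_mult mat_tendsto_index[OF assms(1)] mat_tendsto_index[OF assms(2)])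
       (use pq assms in auto)
  also have "(\<Sum>k<dim_row L. K $$ (p, k) * L $$ (k, q)) = (K * L) $$ (p, q)"
    using pq assms(3) by (simp add: scalar_prod_def lessThan_atLeast0)
  finally show "((\<lambda>r. (A r * B r) $$ (p, q)) \<longlongrightarrow> (K * L) $$ (p, q)) F"
  proof (rule Lim_transform_eventually)
    show "\<forall>\<^sub>F r in F. (\<Sum>k<dim_row L. A r $$ (p, k) * B r $$ (k, q)) = (A r * B r) $$ (p, q)"
      using A B by eventually_elim (use pq in \<open>auto simp: scalar_prod_def lessThan_atLeast0\<close>)
  qed
qed

lemma mat_tendsto_kron_left:
  assumes "mat_tendsto A L F"
  shows "mat_tendsto (\<lambda>r. kron (A r) B) (kron L B) F"
  unfolding mat_tendsto_def
proof (intro conjI allI impI)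
  have A: "\<forall>\<^sub>F r in F. A r \<in> carrier_mat (dim_row L) (dim_col L)"
    using assms by (auto simp: mat_tendsto_def)
  show "\<forall>\<^sub>F r in F. kron (A r) B \<in> carrier_mat (dim_row (kron L B)) (dim_col (kron L B))"
    using A by eventually_elim auto
  fix k l assume "k < dim_row (kron L B)" "l < dim_col (kron L B)"
  then obtain i p j q where
    kl: "i < dim_row L" "p < dim_row B" "k = i * dim_row B + p" "j < dim_col L" "q < dim_col B" "l = j * dim_col B + q"
    using ex_mult_add[of k "dim_row L" "dim_row B"] ex_mult_add[of l "dim_col L" "dim_col B"] by auto
  have "((\<lambda>r. A r $$ (i, j) * B $$ (p, q)) \<longlongrightarrow> L $$ (i, j) * B $$ (p, q)) F"
    by (intro tendsto_mult mat_tendsto_index[OF assms] tendsto_const kl)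
  also have "L $$ (i, j) * B $$ (p, q) = kron L B $$ (k, l)" using kl by (simp add: index_kron)
  finally show "((\<lambda>r. kron (A r) B $$ (k, l)) \<longlongrightarrow> kron L B $$ (k, l)) F"
  proof (rule Lim_transform_eventually)
    show "\<forall>\<^sub>F r in F. A r $$ (i, j) * B $$ (p, q) = kron (A r) B $$ (k, l)"
      using A by eventually_elim (use kl in \<open>auto simp: index_kron\<close>)
  qed
qed

lemma mat_tendsto_det:
  assumes "mat_tendsto A L F" "L \<in> carrier_mat n n"
  shows "((\<lambda>r. det (A r)) \<longlongrightarrow> det L) F"
proof -
  let ?d = "\<lambda>M. \<Sum>p\<in>{p. p permutes {0..<n}}. signof p * (\<Prod>i = 0..<n. M $$ (i, p i))"
  have "((\<lambda>r. ?d (A r)) \<longlongrightarrow> ?d L) F"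
    by (intro tendsto_sum tendsto_mult tendsto_const tendsto_prod mat_tendsto_index[OF assms(1)])
       (use assms(2) permutes_in_image[of _ "{0..<n}"] in fastforce)+
  also have "?d L = det L" by (rule det_def'[OF assms(2), symmetric])
  finally show ?thesis
  proof (rule Lim_transform_eventually)
    show "\<forall>\<^sub>F r in F. ?d (A r) = det (A r)"
      using mat_tendsto_carrier[OF assms] by eventually_elim (simp add: det_def')
  qed
qed

text \<open>Cramer's rule: the entries of the inverse are cofactors divided by the determinant, and
  both are polynomials in the entries.\<close>

lemma mat_tendsto_mat_inv:
  assumes "mat_tendsto A L F" "L \<in> carrier_mat n n" "det L \<noteq> 0"
  shows "mat_tendsto (\<lambda>r. mat_inv (A r)) (mat_inv L) F"
    and "\<forall>\<^sub>F r in F. A r \<in> carrier_mat n n \<and> det (A r) \<noteq> 0"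
proof -
  have "\<forall>\<^sub>F r in F. det (A r) \<noteq> 0"
    using mat_tendsto_det[OF assms(1,2)] assms(3) by (rule tendsto_imp_eventually_ne)
  with mat_tendsto_carrier[OF assms(1,2)]
  show ev: "\<forall>\<^sub>F r in F. A r \<in> carrier_mat n n \<and> det (A r) \<noteq> 0" by eventually_elim auto
  show "mat_tendsto (\<lambda>r. mat_inv (A r)) (mat_inv L) F"
    unfolding mat_tendsto_def
  proof (intro conjI allI impI)
    have L: "mat_inv L \<in> carrier_mat n n" by (rule mat_inv_invertible(1)[OF assms(2,3)])
    show "\<forall>\<^sub>F r in F. mat_inv (A r) \<in> carrier_mat (dim_row (mat_inv L)) (dim_col (mat_inv L))"
      using ev by eventually_elim (use L mat_inv_invertible(1) in auto)
    fix p q assume "p < dim_row (mat_inv L)" "q < dim_col (mat_inv L)"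
    then have pq: "p < n" "q < n" using L by auto
    have "mat_tendsto (\<lambda>r. mat_delete (A r) q p) (mat_delete L q p) F"
      unfolding mat_tendsto_def
    proof (intro conjI allI impI)
      show "\<forall>\<^sub>F r in F. mat_delete (A r) q p \<in> carrier_mat (dim_row (mat_delete L q p)) (dim_col (mat_delete L q p))"
        using ev by eventually_elim (use assms(2) in auto)
      fix i j assume ij: "i < dim_row (mat_delete L q p)" "j < dim_col (mat_delete L q p)"
      let ?i = "if i < q then i else Suc i" and ?j = "if j < p then j else Suc j"
      have "((\<lambda>r. A r $$ (?i, ?j)) \<longlongrightarrow> L $$ (?i, ?j)) F"
        by (rule mat_tendsto_index[OF assms(1)]) (use ij assms(2) in auto)
      also have "L $$ (?i, ?j) = mat_delete L q p $$ (i, j)" using ij by (simp add: mat_delete_def)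
      finally show "((\<lambda>r. mat_delete (A r) q p $$ (i, j)) \<longlongrightarrow> mat_delete L q p $$ (i, j)) F"
      proof (rule Lim_transform_eventually)
        show "\<forall>\<^sub>F r in F. A r $$ (?i, ?j) = mat_delete (A r) q p $$ (i, j)"
          using ev by eventually_elim (use ij assms(2) in \<open>auto simp: mat_delete_def\<close>)
      qed
    qed
    from mat_tendsto_det[OF this mat_delete_carrier[OF assms(2)]]
    have "((\<lambda>r. 1 / det (A r) * ((-1) ^ (q + p) * det (mat_delete (A r) q p))) \<longlongrightarrow>
        1 / det L * ((-1) ^ (q + p) * det (mat_delete L q p))) F"
      by (intro tendsto_intros mat_tendsto_det[OF assms(1,2)] assms(3))
    also have "1 / det L * ((-1) ^ (q + p) * det (mat_delete L q p)) = mat_inv L $$ (p, q)"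
      unfolding mat_inv_invertible(4)[OF assms(2,3)] using pq assms(2) by (simp add: adj_mat_def cofactor_def)
    finally show "((\<lambda>r. mat_inv (A r) $$ (p, q)) \<longlongrightarrow> mat_inv L $$ (p, q)) F"
    proof (rule Lim_transform_eventually)
      show "\<forall>\<^sub>F r in F. 1 / det (A r) * ((-1) ^ (q + p) * det (mat_delete (A r) q p)) = mat_inv (A r) $$ (p, q)"
        using ev
      proof eventually_elim
        case (elim r)
        then show ?case
          using mat_inv_invertible(4)[of "A r" n] pq by (auto simp: adj_mat_def cofactor_def)
      qed
    qed
  qed
qed

section \<open>Semidefinite matrices and their square roots\<close>

lemma dim_mat_adjoint [simp]: "dim_row (mat_adjoint A) = dim_col A" "dim_col (mat_adjoint A) = dim_row A"
  by (simp_all add: mat_adjoint_def)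

lemma index_mat_adjoint: "i < dim_col A \<Longrightarrow> j < dim_row A \<Longrightarrow> mat_adjoint (A::complex mat) $$ (i, j) = cnj (A $$ (j, i))"
  by (simp add: mat_adjoint_def mat_of_rows_def)

lemma psd_mat_iff:
  assumes "A \<in> carrier_mat n n"
  shows "psd_mat A \<longleftrightarrow> pos_on {..<n} 0 (\<lambda>i j. A $$ (i, j))"
proof -
  have "mat_adjoint A = A \<longleftrightarrow> hermitian_on {..<n} (\<lambda>i j. A $$ (i, j))"
    using assms by (auto simp: hermitian_on_def mat_eq_iff index_mat_adjoint)
  moreover have form: "(A *\<^sub>v v) \<bullet>c v = form_on {..<n} (\<lambda>i j. A $$ (i, j)) (\<lambda>i. v $ i)"
    if "v \<in> carrier_vec n" for v
    using assms that
    by (simp add: scalar_prod_def form_on_def inner_on_def app_on_def lessThan_atLeast0)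
  have "(\<forall>v\<in>carrier_vec (dim_row A). 0 \<le> Re ((A *\<^sub>v v) \<bullet>c v)) \<longleftrightarrow>
      (\<forall>x. 0 * norm2_on {..<n} x \<le> Re (form_on {..<n} (\<lambda>i j. A $$ (i, j)) x))" (is "?l \<longleftrightarrow> ?r")
  proof
    assume l: ?l
    show ?r
    proof
      fix x
      have "form_on {..<n} (\<lambda>i j. A $$ (i, j)) x = form_on {..<n} (\<lambda>i j. A $$ (i, j)) (\<lambda>i. vec n x $ i)"
        by (rule form_on_cong_vec) simp
      then show "0 * norm2_on {..<n} x \<le> Re (form_on {..<n} (\<lambda>i j. A $$ (i, j)) x)"
        using bspec[OF l, of "vec n x"] assms form[of "vec n x"] by simp
    qed
  qed (use assms form in auto)
  ultimately show ?thesis using assms by (auto simp: psd_mat_def pos_on_def)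
qed

text \<open>One root that is bounded below settles the definite description, since
  \<open>square_root_unique\<close> compares it with every other semidefinite root.\<close>

lemma mat_sqrt_eqI:
  assumes A: "A \<in> carrier_mat n n" and B: "B \<in> carrier_mat n n" "B * B = A"
    and pos: "pos_on {..<n} c (\<lambda>i j. B $$ (i, j))" "0 < c"
  shows "mat_sqrt A = B"
  unfolding mat_sqrt_def
proof (rule the_equality)
  show "psd_mat B \<and> B * B = A"
    using pos_on_mono[OF pos(1), of 0] pos(2) B by (simp add: psd_mat_iff)
  fix C assume C: "psd_mat C \<and> C * C = A"
  then have sq: "C * C = A" and "square_mat C" "psd_mat C" by (auto simp: psd_mat_def)
  have "dim_row C = n" using arg_cong[OF sq, of dim_row] A by simp
  moreover have "dim_col C = n"
    using \<open>square_mat C\<close> calculation by (simp only: square_mat.simps)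
  ultimately have Cc: "C \<in> carrier_mat n n" by (rule carrier_matI)
  have mult: "mult_on {..<n} (\<lambda>i j. M $$ (i, j)) (\<lambda>i j. M $$ (i, j)) i j = (M * M) $$ (i, j)"
    if "M \<in> carrier_mat n n" "i < n" "j < n" for M i j
    using that by (simp add: mult_on_def scalar_prod_def lessThan_atLeast0)
  show "C = B"
  proof (rule eq_matI)
    fix i j assume "i < dim_row B" "j < dim_col B"
    then have ij: "i < n" "j < n" using B by auto
    show "C $$ (i, j) = B $$ (i, j)"
    proof (rule square_root_unique[where I = "{..<n}" and c = c and B = "\<lambda>i j. C $$ (i, j)" and C = "\<lambda>i j. B $$ (i, j)"])
      show "pos_on {..<n} 0 (\<lambda>i j. C $$ (i, j))" using \<open>psd_mat C\<close> psd_mat_iff[OF Cc] by simp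
      show "mult_on {..<n} (\<lambda>i j. C $$ (i, j)) (\<lambda>i j. C $$ (i, j)) i j =
          mult_on {..<n} (\<lambda>i j. B $$ (i, j)) (\<lambda>i j. B $$ (i, j)) i j" if "i \<in> {..<n}" "j \<in> {..<n}" for i j
        using mult[OF B(1), of i j] mult[OF Cc, of i j] that sq B(2) by simp
    qed (use pos ij in auto)
  qed (use B Cc in auto)
qed

section \<open>The completely positive map of an irreducible row coisometry\<close>

lemma form_on_conj:
  "form_on I (mult_on J (mult_on J Y A) (adj Y)) v = form_on J A (app_on I (adj Y) v)"
  unfolding form_on_def app_on_mult[symmetric] by (rule inner_on_app_on)

lemma form_on_sum: "form_on I (\<lambda>i j. \<Sum>e\<in>E. A e i j) v = (\<Sum>e\<in>E. form_on I (A e) v)"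
proof -
  have "form_on I (\<lambda>i j. \<Sum>e\<in>E. A e i j) v = (\<Sum>i\<in>I. \<Sum>e\<in>E. \<Sum>j\<in>I. cnj (v i) * A e i j * v j)"
    unfolding form_on_eq sum_distrib_left sum_distrib_right by (intro sum.cong refl sum.swap)
  also have "\<dots> = (\<Sum>e\<in>E. form_on I (A e) v)" unfolding form_on_eq by (rule sum.swap)
  finally show ?thesis .
qed

lemma mult_on_kdelta_right: "finite I \<Longrightarrow> j \<in> I \<Longrightarrow> mult_on I A kdelta i j = A i j"
  by (simp add: mult_on_def kdelta_def if_distrib[of "\<lambda>a. _ * a"] cong: if_cong)

text \<open>Irreducibility is phrased for kernels: if the kernel of M is nonzero and invariant under
  all X_e, or under all their adjoints, then M = 0. Every subspace is such a kernel, and the kernels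
  that occur are those of semidefinite matrices.\<close>

locale row_coisometry =
  fixes n d :: nat and X :: "nat \<Rightarrow> nat \<Rightarrow> nat \<Rightarrow> complex"
  assumes n_pos: "0 < n"
    and coisometry: "\<And>p q. p < n \<Longrightarrow> q < n \<Longrightarrow>
      (\<Sum>e<d. mult_on {..<n} (X e) (adj (X e)) p q) = kdelta p q"
    and irreducible: "\<And>M v. (\<And>e w. e < d \<Longrightarrow> (\<And>i. i < n \<Longrightarrow> app_on {..<n} M w i = 0) \<Longrightarrow>
        (\<And>i. i < n \<Longrightarrow> app_on {..<n} M (app_on {..<n} (X e) w) i = 0)) \<Longrightarrow>
      (\<And>i. i < n \<Longrightarrow> app_on {..<n} M v i = 0) \<Longrightarrow> norm2_on {..<n} v \<noteq> 0 \<Longrightarrow>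
      (\<And>i j. i < n \<Longrightarrow> j < n \<Longrightarrow> M i j = 0)"
    and irreducible_adj: "\<And>M v. (\<And>e w. e < d \<Longrightarrow> (\<And>i. i < n \<Longrightarrow> app_on {..<n} M w i = 0) \<Longrightarrow>
        (\<And>i. i < n \<Longrightarrow> app_on {..<n} M (app_on {..<n} (adj (X e)) w) i = 0)) \<Longrightarrow>
      (\<And>i. i < n \<Longrightarrow> app_on {..<n} M v i = 0) \<Longrightarrow> norm2_on {..<n} v \<noteq> 0 \<Longrightarrow>
      (\<And>i j. i < n \<Longrightarrow> j < n \<Longrightarrow> M i j = 0)"
begin

definition \<Phi> :: "(nat \<Rightarrow> nat \<Rightarrow> complex) \<Rightarrow> nat \<Rightarrow> nat \<Rightarrow> complex" where
  "\<Phi> A = (\<lambda>p q. \<Sum>e<d. mult_on {..<n} (mult_on {..<n} (X e) A) (adj (X e)) p q)"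

lemma \<Phi>_cong: "(\<And>p q. p < n \<Longrightarrow> q < n \<Longrightarrow> A p q = B p q) \<Longrightarrow> \<Phi> A = \<Phi> B"
  by (simp add: \<Phi>_def mult_on_def)

lemma \<Phi>_add: "\<Phi> (\<lambda>p q. A p q + B p q) = (\<lambda>p q. \<Phi> A p q + \<Phi> B p q)"
  by (simp add: \<Phi>_def mult_on_def algebra_simps sum.distrib)

lemma \<Phi>_scale: "\<Phi> (\<lambda>p q. c * A p q) = (\<lambda>p q. c * \<Phi> A p q)"
  by (simp add: \<Phi>_def mult_on_def sum_distrib_left sum_distrib_right mult_ac)

lemma \<Phi>_adj: "\<Phi> (adj A) p q = cnj (\<Phi> A q p)"
proof -
  have "mult_on {..<n} (mult_on {..<n} (X e) (adj A)) (adj (X e)) p q =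
      cnj (mult_on {..<n} (mult_on {..<n} (X e) A) (adj (X e)) q p)" for e
  proof -
    have "mult_on {..<n} (mult_on {..<n} (X e) (adj A)) (adj (X e)) p q =
        (\<Sum>l<n. \<Sum>k<n. X e p k * cnj (A l k) * cnj (X e q l))"
      by (simp add: mult_on_def adj_def sum_distrib_right)
    also have "\<dots> = (\<Sum>k<n. \<Sum>l<n. X e p k * cnj (A l k) * cnj (X e q l))" by (rule sum.swap)
    also have "\<dots> = cnj (mult_on {..<n} (mult_on {..<n} (X e) A) (adj (X e)) q p)"
      by (simp add: mult_on_def adj_def sum_distrib_left sum_distrib_right mult_ac)
    finally show ?thesis .
  qed
  then show ?thesis by (simp add: \<Phi>_def)
qed

lemma \<Phi>_kdelta: "p < n \<Longrightarrow> q < n \<Longrightarrow> \<Phi> kdelta p q = kdelta p q"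
proof -
  have "mult_on {..<n} (mult_on {..<n} (X e) kdelta) (adj (X e)) p q = mult_on {..<n} (X e) (adj (X e)) p q"
    for e by (subst (1) mult_on_def) (simp add: mult_on_kdelta_right, simp add: mult_on_def)
  then show "p < n \<Longrightarrow> q < n \<Longrightarrow> \<Phi> kdelta p q = kdelta p q" by (simp add: \<Phi>_def coisometry)
qed

lemma form_on_\<Phi>: "form_on {..<n} (\<Phi> A) v = (\<Sum>e<d. form_on {..<n} A (app_on {..<n} (adj (X e)) v))"
  unfolding \<Phi>_def form_on_sum form_on_conj ..

text \<open>Pair \<open>\<Phi> (\<mu> - A) = (\<mu> - A) - \<beta>\<close> with a top eigenvector of \<open>A\<close>.\<close>

lemma \<Phi>_shift_hermitian_le:
  fixes \<beta> :: real
  assumes "hermitian_on {..<n} A"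
    and eq: "\<And>p q. p < n \<Longrightarrow> q < n \<Longrightarrow> \<Phi> A p q = A p q + of_real \<beta> * kdelta p q"
  shows "\<beta> \<le> 0" "\<beta> = 0 \<Longrightarrow> \<exists>c. \<forall>p<n. \<forall>q<n. A p q = c * kdelta p q"
proof -
  have "{..<n} \<noteq> {}" using n_pos by auto
  then obtain \<mu> v where
    pos: "pos_on {..<n} 0 (\<lambda>i j. of_real \<mu> * kdelta i j - A i j)" and v: "norm2_on {..<n} v \<noteq> 0"
    and ker: "\<And>i. i \<in> {..<n} \<Longrightarrow> app_on {..<n} (\<lambda>i j. of_real \<mu> * kdelta i j - A i j) v i = 0"
    by (rule hermitian_top_eigenvector[OF finite_lessThan _ assms(1)]) blast
  define B where "B = (\<lambda>i j. of_real \<mu> * kdelta i j - A i j)"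
  have \<Phi>B: "\<Phi> B p q = B p q - of_real \<beta> * kdelta p q" if "p < n" "q < n" for p q
  proof -
    have "\<Phi> B = (\<lambda>p q. of_real \<mu> * \<Phi> kdelta p q + (-1) * \<Phi> A p q)"
      using \<Phi>_add[of "\<lambda>p q. of_real \<mu> * kdelta p q" "\<lambda>p q. (-1) * A p q"]
      unfolding \<Phi>_scale by (simp add: B_def)
    then show ?thesis using that by (simp add: \<Phi>_kdelta eq B_def)
  qed
  have form: "(\<Sum>e<d. form_on {..<n} B (app_on {..<n} (adj (X e)) w)) =
      form_on {..<n} B w - of_real (\<beta> * norm2_on {..<n} w)" for w
  proof -
    have "form_on {..<n} (\<Phi> B) w = form_on {..<n} (\<lambda>i j. B i j - of_real \<beta> * kdelta i j) w"
      by (rule form_on_cong) (simp add: \<Phi>B)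
    then show ?thesis by (simp add: form_on_\<Phi> form_on_diff form_on_scale form_on_kdelta)
  qed
  have posB: "0 \<le> Re (form_on {..<n} B w)" for w using pos_onD[OF pos, of w] by (simp add: B_def)
  have ker0: "form_on {..<n} B w = 0" if "\<And>i. i < n \<Longrightarrow> app_on {..<n} B w i = 0" for w
    unfolding form_on_def inner_on_def using that by simp
  have "0 \<le> (\<Sum>e<d. Re (form_on {..<n} B (app_on {..<n} (adj (X e)) v)))"
    by (intro sum_nonneg posB)
  also have "\<dots> = - \<beta> * norm2_on {..<n} v"
    using arg_cong[OF form[of v], of Re] ker0[of v] ker by (simp add: B_def)
  finally show "\<beta> \<le> 0"
    using v norm2_on_nonneg[of "{..<n}" v] by (simp add: mult_le_0_iff)
  assume "\<beta> = 0"
  \<comment> \<open>For \<beta> = 0 the form of B at w is the sum of its forms at the vectors X_e^*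
    w. If w lies in the kernel, these nonnegative terms all vanish, so the kernel is invariant under
    the adjoints; it contains v.\<close>
  have "B i j = 0" if "i < n" "j < n" for i j
  proof (rule irreducible_adj[of B v])
    fix e w i assume "e < d" and w: "\<And>i. i < n \<Longrightarrow> app_on {..<n} B w i = 0" and "i < n"
    have "(\<Sum>e<d. Re (form_on {..<n} B (app_on {..<n} (adj (X e)) w))) = 0"
      using arg_cong[OF form[of w], of Re] ker0[OF w] \<open>\<beta> = 0\<close> by simp
    then have "Re (form_on {..<n} B (app_on {..<n} (adj (X e)) w)) = 0"
      using \<open>e < d\<close> by (simp add: sum_nonneg_eq_0_iff posB)
    then show "app_on {..<n} B (app_on {..<n} (adj (X e)) w) i = 0"
      using \<open>i < n\<close> pos by (intro pos_on_kernel) (auto simp: B_def)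
  qed (use ker v that in \<open>auto simp: B_def\<close>)
  then have "A i j = of_real \<mu> * kdelta i j" if "i < n" "j < n" for i j
    using that by (simp add: B_def)
  then show "\<exists>c. \<forall>p<n. \<forall>q<n. A p q = c * kdelta p q" by blast
qed

text \<open>The one-sided bound applied to A and to -A.\<close>

lemma \<Phi>_shift_hermitian:
  fixes \<beta> :: real
  assumes "hermitian_on {..<n} A"
    and eq: "\<And>p q. p < n \<Longrightarrow> q < n \<Longrightarrow> \<Phi> A p q = A p q + of_real \<beta> * kdelta p q"
  shows "\<beta> = 0" "\<exists>c. \<forall>p<n. \<forall>q<n. A p q = c * kdelta p q"
proof -
  have "- \<beta> \<le> 0"
  proof (rule \<Phi>_shift_hermitian_le(1))
    show "hermitian_on {..<n} (\<lambda>p q. (-1) * A p q)" using assms(1) by (simp add: hermitian_on_def)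
    show "\<Phi> (\<lambda>p q. (-1) * A p q) p q = (-1) * A p q + of_real (- \<beta>) * kdelta p q"
      if "p < n" "q < n" for p q
      unfolding \<Phi>_scale using eq[OF that] by simp
  qed
  then show "\<beta> = 0" using \<Phi>_shift_hermitian_le(1)[OF assms] by simp
  then show "\<exists>c. \<forall>p<n. \<forall>q<n. A p q = c * kdelta p q"
    using \<Phi>_shift_hermitian_le(2)[OF assms] by blast
qed

text \<open>Two facts in one: the fixed points of \<Phi> are scalar (the case \<alpha> = 0), and the
  identity is not in the range of \<Phi> - id, so the eigenvalue 1 has no Jordan block. Together
  they make the pole of the resolvent simple with scalar values.\<close>

lemma \<Phi>_shift:
  assumes eq: "\<And>p q. p < n \<Longrightarrow> q < n \<Longrightarrow> \<Phi> A p q = A p q + \<alpha> * kdelta p q"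
  shows "\<alpha> = 0" "\<exists>c. \<forall>p<n. \<forall>q<n. A p q = c * kdelta p q"
proof -
  \<comment> \<open>\<open>H 1\<close> and \<open>H \<i>\<close> are Hermitian and determine A by A
    = (H 1 - \<i> H \<i>) / 2.\<close>
  define H where "H z = (\<lambda>p q. z * A p q + cnj z * adj A p q)" for z
  have herm: "hermitian_on {..<n} (H z)" for z
    by (simp add: hermitian_on_def H_def adj_def)
  have \<Phi>H: "\<Phi> (H z) p q = H z p q + of_real (2 * Re (z * \<alpha>)) * kdelta p q" if "p < n" "q < n" for z p q
  proof -
    have "\<Phi> (H z) p q = z * \<Phi> A p q + cnj z * cnj (\<Phi> A q p)"
      unfolding H_def \<Phi>_add \<Phi>_scale \<Phi>_adj ..
    also have "\<dots> = H z p q + (z * \<alpha> + cnj (z * \<alpha>)) * kdelta p q"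
      using that by (simp add: eq H_def adj_def kdelta_def algebra_simps)
    also have "z * \<alpha> + cnj (z * \<alpha>) = of_real (2 * Re (z * \<alpha>))" by (rule complex_add_cnj)
    finally show ?thesis .
  qed
  have "2 * Re (1 * \<alpha>) = 0" "2 * Re (\<i> * \<alpha>) = 0"
    by (rule \<Phi>_shift_hermitian(1)[OF herm \<Phi>H]; assumption)+
  then show "\<alpha> = 0" by (simp add: complex_eq_iff)
  obtain c1 where c1: "\<And>p q. p < n \<Longrightarrow> q < n \<Longrightarrow> H 1 p q = c1 * kdelta p q"
    using \<Phi>_shift_hermitian(2)[OF herm[of 1] \<Phi>H] by blast
  obtain c2 where c2: "\<And>p q. p < n \<Longrightarrow> q < n \<Longrightarrow> H \<i> p q = c2 * kdelta p q"
    using \<Phi>_shift_hermitian(2)[OF herm[of \<i>] \<Phi>H] by blast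
  have "A p q = (c1 - \<i> * c2) / 2 * kdelta p q" if "p < n" "q < n" for p q
  proof -
    have "A p q = (H 1 p q - \<i> * H \<i> p q) / 2" by (simp add: H_def algebra_simps)
    then show ?thesis using c1[OF that] c2[OF that] by (simp add: algebra_simps)
  qed
  then show "\<exists>c. \<forall>p<n. \<forall>q<n. A p q = c * kdelta p q" by blast
qed

end

lemma sum_swap_pairs:
  "(\<Sum>a\<in>A. \<Sum>b\<in>B. \<Sum>k\<in>K. \<Sum>l\<in>L. f a b k l) = (\<Sum>k\<in>K. \<Sum>l\<in>L. \<Sum>a\<in>A. \<Sum>b\<in>B. f a b k l)"
proof -
  have "(\<Sum>a\<in>A. \<Sum>b\<in>B. \<Sum>k\<in>K. \<Sum>l\<in>L. f a b k l) = (\<Sum>a\<in>A. \<Sum>k\<in>K. \<Sum>l\<in>L. \<Sum>b\<in>B. f a b k l)"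
    by (subst sum.swap, intro sum.cong refl sum.swap)
  also have "\<dots> = (\<Sum>k\<in>K. \<Sum>l\<in>L. \<Sum>a\<in>A. \<Sum>b\<in>B. f a b k l)"
    by (subst sum.swap, intro sum.cong refl sum.swap)
  finally show ?thesis .
qed

lemma sum_kdelta_fst:
  assumes "a \<in> A" "finite A"
  shows "(\<Sum>x\<in>A \<times> B. kdelta a (fst x) * f x) = (\<Sum>k\<in>B. f (a, k))"
proof -
  have "(\<Sum>x\<in>A \<times> B. kdelta a (fst x) * f x) = (\<Sum>i\<in>A. \<Sum>k\<in>B. kdelta a i * f (i, k))"
    by (simp add: sum.cartesian_product case_prod_unfold)
  also have "\<dots> = (\<Sum>i\<in>A. if i = a then \<Sum>k\<in>B. f (i, k) else 0)"
    by (intro sum.cong) (auto simp: kdelta_def)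
  finally show ?thesis using assms by simp
qed

lemma cnj_kdelta [simp]: "cnj (kdelta i j) = kdelta i j"
  by (simp add: kdelta_def)

section \<open>The resolvent of the completely positive map and its Choi matrix\<close>

context row_coisometry
begin

text \<open>\<open>g a b p q\<close> is the entry (p, q) of the image of the matrix unit E_ab under
  the inverse of id - r^2 \<Phi>. The first family of equations says that g is a right inverse and
  drives the positivity proof; the second says that it is a left inverse and yields the invariance
  of \<phi> and the Stein identity.\<close>

definition resolvent :: "real \<Rightarrow> (nat \<Rightarrow> nat \<Rightarrow> nat \<Rightarrow> nat \<Rightarrow> complex) \<Rightarrow> bool" where
  "resolvent r g \<longleftrightarrow>
    (\<forall>a<n. \<forall>b<n. \<forall>p<n. \<forall>q<n.
      g a b p q - of_real (r\<^sup>2) * \<Phi> (g a b) p q = kdelta a p * kdelta b q) \<and>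
    (\<forall>a<n. \<forall>b<n. \<forall>p<n. \<forall>q<n.
      g a b p q - of_real (r\<^sup>2) * (\<Sum>e<d. \<Sum>k<n. \<Sum>l<n. X e k a * g k l p q * cnj (X e l b)) =
      kdelta a p * kdelta b q)"

lemma \<Phi>_eq: "\<Phi> A p q = (\<Sum>e<d. \<Sum>k<n. \<Sum>l<n. X e p k * A k l * cnj (X e q l))"
proof -
  have "(\<Sum>l<n. (\<Sum>k<n. X e p k * A k l) * cnj (X e q l)) = (\<Sum>k<n. \<Sum>l<n. X e p k * A k l * cnj (X e q l))" for e
    unfolding sum_distrib_right by (rule sum.swap)
  then show ?thesis by (simp add: \<Phi>_def mult_on_def adj_def)
qed

text \<open>Reordering the sums moves \<Phi> from D to its transpose acting on the first two indices
  of g, where the second family of equations applies.\<close>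

lemma resolvent_apply:
  assumes "resolvent r g" "p < n" "q < n"
  shows "(\<Sum>a<n. \<Sum>b<n. (D a b - of_real (r\<^sup>2) * \<Phi> D a b) * g a b p q) = D p q"
proof -
  let ?f = "\<lambda>e k l a b. X e k a * D a b * cnj (X e l b) * g k l p q"
  let ?h = "\<lambda>a b. \<Sum>e<d. \<Sum>k<n. \<Sum>l<n. X e k a * g k l p q * cnj (X e l b)"
  have "(\<Sum>k<n. \<Sum>l<n. \<Phi> D k l * g k l p q) =
      (\<Sum>k<n. \<Sum>l<n. \<Sum>e<d. \<Sum>a<n. \<Sum>b<n. ?f e k l a b)"
    by (simp add: \<Phi>_eq sum_distrib_right)
  also have "\<dots> = (\<Sum>k<n. \<Sum>e<d. \<Sum>l<n. \<Sum>a<n. \<Sum>b<n. ?f e k l a b)"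
    by (intro sum.cong refl sum.swap)
  also have "\<dots> = (\<Sum>e<d. \<Sum>k<n. \<Sum>l<n. \<Sum>a<n. \<Sum>b<n. ?f e k l a b)"
    by (rule sum.swap)
  also have "\<dots> = (\<Sum>e<d. \<Sum>a<n. \<Sum>b<n. \<Sum>k<n. \<Sum>l<n. ?f e k l a b)"
    by (intro sum.cong refl sum_swap_pairs)
  also have "\<dots> = (\<Sum>a<n. \<Sum>e<d. \<Sum>b<n. \<Sum>k<n. \<Sum>l<n. ?f e k l a b)"
    by (rule sum.swap)
  also have "\<dots> = (\<Sum>a<n. \<Sum>b<n. \<Sum>e<d. \<Sum>k<n. \<Sum>l<n. ?f e k l a b)"
    by (intro sum.cong refl sum.swap)
  also have "\<dots> = (\<Sum>a<n. \<Sum>b<n. D a b * ?h a b)"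
    by (simp add: sum_distrib_left mult_ac)
  finally have "(\<Sum>a<n. \<Sum>b<n. (D a b - of_real (r\<^sup>2) * \<Phi> D a b) * g a b p q) =
      (\<Sum>a<n. \<Sum>b<n. D a b * g a b p q) - of_real (r\<^sup>2) *
      (\<Sum>a<n. \<Sum>b<n. D a b * ?h a b)"
    by (simp add: left_diff_distrib sum_subtractf mult.assoc flip: sum_distrib_left)
  also have "\<dots> = (\<Sum>a<n. \<Sum>b<n. D a b * (g a b p q - of_real (r\<^sup>2) *
      ?h a b))"
    by (simp add: right_diff_distrib sum_subtractf sum_distrib_left mult_ac)
  also have "\<dots> = (\<Sum>a<n. \<Sum>b<n. D a b * (kdelta a p * kdelta b q))"
    using assms by (intro sum.cong refl arg_cong2[where f = "(*)"]) (auto simp: resolvent_def)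
  also have "\<dots> = (\<Sum>a<n. \<Sum>b<n. if b = q then (if a = p then D a b else 0) else 0)"
    by (intro sum.cong) (auto simp: kdelta_def)
  also have "\<dots> = D p q" using assms by simp
  finally show ?thesis .
qed

lemma resolvent_unique:
  assumes "resolvent r g" "\<And>a b. a < n \<Longrightarrow> b < n \<Longrightarrow> D a b = of_real (r\<^sup>2) * \<Phi> D a b" "p < n" "q < n"
  shows "D p q = 0"
  unfolding resolvent_apply[OF assms(1,3,4), of D, symmetric]
  using assms(2) by (intro sum.neutral ballI) simp

text \<open>\<Phi> commutes with taking adjoints. Hence the adjoint of \<open>g b a\<close> and
  \<open>g a b\<close> solve the same equation, and their difference solves the homogeneous
  one.\<close>

lemma resolvent_hermitian:
  assumes g: "resolvent r g" and "a < n" "b < n" "p < n" "q < n"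
  shows "cnj (g a b p q) = g b a q p"
proof -
  define D where "D = (\<lambda>p q. adj (g b a) p q + (-1) * g a b p q)"
  have "D p q = 0"
  proof (rule resolvent_unique[OF g])
    fix p q assume pq: "p < n" "q < n"
    have 1: "g a b p q - of_real (r\<^sup>2) * \<Phi> (g a b) p q = kdelta a p * kdelta b q"
      using g assms(2,3) pq unfolding resolvent_def by blast
    have "g b a q p - of_real (r\<^sup>2) * \<Phi> (g b a) q p = kdelta b q * kdelta a p"
      using g assms(2,3) pq unfolding resolvent_def by blast
    from arg_cong[OF this, of cnj]
    have 2: "adj (g b a) p q - of_real (r\<^sup>2) * \<Phi> (adj (g b a)) p q = kdelta a p * kdelta b q"
      unfolding \<Phi>_adj by (simp add: adj_def mult.commute)
    show "D p q = of_real (r\<^sup>2) * \<Phi> D p q"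
      unfolding D_def \<Phi>_add \<Phi>_scale using 1 2 by (simp add: algebra_simps)
  qed (use assms in auto)
  then show ?thesis by (simp add: D_def adj_def) (metis complex_cnj_cnj)
qed

text \<open>\<Phi> is unital, so the resolvent sends the identity to its multiple by 1 / (1 - r^2).
  In the limit this normalizes \<phi> to trace 1.\<close>

lemma resolvent_trace:
  assumes "resolvent r g" "p < n" "q < n"
  shows "of_real (1 - r\<^sup>2) * (\<Sum>a<n. g a a p q) = kdelta p q"
proof -
  have "kdelta p q = (\<Sum>a<n. \<Sum>b<n. (kdelta a b - of_real (r\<^sup>2) * \<Phi> kdelta a b) * g a b p q)"
    by (rule resolvent_apply[OF assms, symmetric])
  also have "\<dots> = (\<Sum>a<n. \<Sum>b<n. if b = a then of_real (1 - r\<^sup>2) * g a b p q else 0)"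
    by (intro sum.cong) (auto simp: \<Phi>_kdelta, auto simp: kdelta_def)
  also have "\<dots> = of_real (1 - r\<^sup>2) * (\<Sum>a<n. g a a p q)" by (simp add: sum_distrib_left)
  finally show ?thesis by simp
qed

definition choi :: "(nat \<Rightarrow> nat \<Rightarrow> nat \<Rightarrow> nat \<Rightarrow> complex) \<Rightarrow> nat \<times> nat \<Rightarrow> nat \<times> nat \<Rightarrow> complex" where
  "choi g = (\<lambda>x y. g (fst x) (fst y) (snd x) (snd y))"

text \<open>I \<otimes> X_e, a Kraus operator of id \<otimes> \<Phi>, in the index pairs of
  \<open>choi\<close>.\<close>

definition amp :: "nat \<Rightarrow> nat \<times> nat \<Rightarrow> nat \<times> nat \<Rightarrow> complex" where
  "amp e = (\<lambda>x y. kdelta (fst x) (fst y) * X e (snd x) (snd y))"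

abbreviation "sq \<equiv> {..<n} \<times> {..<n}"

lemma amp_conj:
  assumes "x \<in> sq" "y \<in> sq"
  shows "mult_on sq (mult_on sq (amp e) A) (adj (amp e)) x y =
    (\<Sum>l<n. \<Sum>k<n. X e (snd x) k * A (fst x, k) (fst y, l) * cnj (X e (snd y) l))"
proof -
  have 1: "mult_on sq (amp e) A x z = (\<Sum>k<n. X e (snd x) k * A (fst x, k) z)" for z
    using assms sum_kdelta_fst[of "fst x" "{..<n}" "\<lambda>u. X e (snd x) (snd u) * A u z" "{..<n}"]
    by (auto simp: mult_on_def amp_def mult.assoc)
  have "mult_on sq (mult_on sq (amp e) A) (adj (amp e)) x y =
      (\<Sum>z\<in>sq. kdelta (fst y) (fst z) * (mult_on sq (amp e) A x z * cnj (X e (snd y) (snd z))))"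
    unfolding mult_on_def[of sq "mult_on sq (amp e) A"]
    by (intro sum.cong) (auto simp: adj_def amp_def kdelta_def)
  also have "\<dots> = (\<Sum>l<n. mult_on sq (amp e) A x (fst y, l) * cnj (X e (snd y) l))"
    using assms by (subst sum_kdelta_fst) auto
  finally show ?thesis by (simp add: 1 sum_distrib_right)
qed

lemma amp_coisometry: "(\<Sum>e<d. norm2_on sq (app_on sq (adj (amp e)) V)) = norm2_on sq V"
proof -
  have "(\<Sum>e<d. form_on sq kdelta (app_on sq (adj (amp e)) V)) =
      form_on sq (\<lambda>x y. \<Sum>e<d. mult_on sq (mult_on sq (amp e) kdelta) (adj (amp e)) x y) V"
    by (simp add: form_on_sum form_on_conj)
  also have "\<dots> = form_on sq kdelta V"
  proof (rule form_on_cong)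
    fix x y assume xy: "x \<in> sq" "y \<in> sq"
    have "(\<Sum>e<d. mult_on sq (mult_on sq (amp e) kdelta) (adj (amp e)) x y) =
        (\<Sum>e<d. \<Sum>l<n. \<Sum>k<n. if k = l then kdelta (fst x) (fst y) * (X e (snd x) l * cnj (X e (snd y) l)) else 0)"
      by (intro sum.cong refl, subst amp_conj[OF xy], intro sum.cong) (auto simp: kdelta_def)
    also have "\<dots> = kdelta (fst x) (fst y) * (\<Sum>e<d. mult_on {..<n} (X e) (adj (X e)) (snd x) (snd y))"
      by (simp add: mult_on_def adj_def sum_distrib_left)
    also have "\<dots> = kdelta x y" using xy by (auto simp: coisometry) (auto simp: kdelta_def)
    finally show "(\<Sum>e<d. mult_on sq (mult_on sq (amp e) kdelta) (adj (amp e)) x y) = kdelta x y" .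
  qed
  finally have "complex_of_real (\<Sum>e<d. norm2_on sq (app_on sq (adj (amp e)) V)) = of_real (norm2_on sq V)"
    by (simp add: form_on_kdelta)
  then show ?thesis by (simp only: of_real_eq_iff)
qed

lemma resolvent_hermitian_on: "resolvent r g \<Longrightarrow> hermitian_on sq (choi g)"
  by (auto simp: hermitian_on_def choi_def resolvent_hermitian)

text \<open>\<open>P = \<xi>\<xi>\<^sup>* + r\<^sup>2 \<Sum> (I \<otimes> X\<^sub>e) P (I \<otimes> X\<^sub>e)\<^sup>*\<close> and the coisometry property force the smallest
  eigenvalue of \<open>P\<close> to be nonnegative.\<close>

lemma resolvent_pos:
  assumes g: "resolvent r g" and r: "r\<^sup>2 < 1"
  shows "pos_on sq 0 (choi g)"
proof -
  have h: "hermitian_on sq (choi g)" by (rule resolvent_hermitian_on[OF g])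
  \<comment> \<open>A top eigenvector of \<open>- choi g\<close> is a bottom eigenvector of
    \<open>choi g\<close>, with eigenvalue -\<mu>.\<close>
  then have h': "hermitian_on sq (\<lambda>x y. - choi g x y)" by (simp add: hermitian_on_def)
  have "finite sq" "sq \<noteq> {}" using n_pos by auto
  then obtain \<mu> V where
    pos: "pos_on sq 0 (\<lambda>x y. of_real \<mu> * kdelta x y - - choi g x y)" and V: "norm2_on sq V \<noteq> 0"
    and ker: "\<And>x. x \<in> sq \<Longrightarrow> app_on sq (\<lambda>x y. of_real \<mu> * kdelta x y - - choi g x y) V x = 0"
    by (rule hermitian_top_eigenvector[OF _ _ h']) blast
  have lower: "- \<mu> * norm2_on sq v \<le> Re (form_on sq (choi g) v)" for v
    using pos_onD[OF pos, of v] unfolding form_on_diff form_on_scale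
    using form_on_scale[of sq "-1" "choi g" v] by (simp add: form_on_kdelta)
  have "form_on sq (\<lambda>x y. of_real \<mu> * kdelta x y - - choi g x y) V = 0"
    unfolding form_on_def inner_on_def
  proof (intro sum.neutral ballI)
    fix x assume "x \<in> sq"
    show "app_on sq (\<lambda>x y. of_real \<mu> * kdelta x y - - choi g x y) V x * cnj (V x) = 0"
      unfolding ker[OF \<open>x \<in> sq\<close>] by simp
  qed
  then have eqV: "Re (form_on sq (choi g) V) = - \<mu> * norm2_on sq V"
    unfolding form_on_diff form_on_scale
    using form_on_scale[of sq "-1" "choi g" V] by (simp add: form_on_kdelta complex_eq_iff)
  \<comment> \<open>The vectorized identity as a one-column matrix, so that \<xi> \<xi>^* is a
    conjugation and \<open>form_on_conj\<close> applies.\<close>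
  define \<xi> :: "nat \<times> nat \<Rightarrow> unit \<Rightarrow> complex" where "\<xi> = (\<lambda>x _. kdelta (fst x) (snd x))"
  have "form_on sq (choi g) V = form_on sq (\<lambda>x y. mult_on {()} (mult_on {()} \<xi> kdelta) (adj \<xi>) x y +
      of_real (r\<^sup>2) * (\<Sum>e<d. mult_on sq (mult_on sq (amp e) (choi g)) (adj (amp e)) x y)) V"
  proof (rule form_on_cong)
    fix x y assume xy: "x \<in> sq" "y \<in> sq"
    then have "g (fst x) (fst y) (snd x) (snd y) - of_real (r\<^sup>2) * \<Phi> (g (fst x) (fst y)) (snd x) (snd y) =
        kdelta (fst x) (snd x) * kdelta (fst y) (snd y)"
      using g unfolding resolvent_def by auto
    moreover have "\<Phi> (g (fst x) (fst y)) (snd x) (snd y) =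
        (\<Sum>e<d. mult_on sq (mult_on sq (amp e) (choi g)) (adj (amp e)) x y)"
      using xy by (simp add: amp_conj \<Phi>_def) (simp add: mult_on_def adj_def choi_def sum_distrib_right)
    ultimately show "choi g x y = mult_on {()} (mult_on {()} \<xi> kdelta) (adj \<xi>) x y +
        of_real (r\<^sup>2) * (\<Sum>e<d. mult_on sq (mult_on sq (amp e) (choi g)) (adj (amp e)) x y)"
      by (simp add: choi_def mult_on_def adj_def \<xi>_def kdelta_def algebra_simps split: if_splits)
  qed
  also have "\<dots> = of_real (norm2_on {()} (app_on sq (adj \<xi>) V)) +
      of_real (r\<^sup>2) * (\<Sum>e<d. form_on sq (choi g) (app_on sq (adj (amp e)) V))"
    unfolding form_on_add form_on_scale form_on_sum form_on_conj by (simp add: form_on_kdelta)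
  finally have "Re (form_on sq (choi g) V) = norm2_on {()} (app_on sq (adj \<xi>) V) +
      r\<^sup>2 * (\<Sum>e<d. Re (form_on sq (choi g) (app_on sq (adj (amp e)) V)))"
    by (simp del: of_real_power)
  then have le: "r\<^sup>2 * (\<Sum>e<d. Re (form_on sq (choi g) (app_on sq (adj (amp e)) V))) \<le> - \<mu> * norm2_on sq V"
    unfolding eqV[symmetric] by simp
  have "r\<^sup>2 * (- \<mu> * norm2_on sq V) =
      r\<^sup>2 * (\<Sum>e<d. - \<mu> * norm2_on sq (app_on sq (adj (amp e)) V))"
    by (simp only: sum_distrib_left[symmetric] amp_coisometry)
  also have "\<dots> \<le> r\<^sup>2 * (\<Sum>e<d. Re (form_on sq (choi g) (app_on sq (adj (amp e)) V)))"
    by (intro mult_left_mono sum_mono lower) simp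
  also note le
  finally have "r\<^sup>2 * (- \<mu> * norm2_on sq V) \<le> - \<mu> * norm2_on sq V" .
  then have "((1 - r\<^sup>2) * norm2_on sq V) * \<mu> \<le> 0" by (simp add: algebra_simps)
  moreover have "0 < (1 - r\<^sup>2) * norm2_on sq V"
    using V norm2_on_nonneg[of sq V] r by (intro mult_pos_pos) linarith+
  ultimately have "\<mu> \<le> 0" using mult_pos_pos[of "(1 - r\<^sup>2) * norm2_on sq V" \<mu>] by linarith
  have "0 * norm2_on sq v \<le> Re (form_on sq (choi g) v)" for v
    using order.trans[OF _ lower[of v], of 0] \<open>\<mu> \<le> 0\<close> by (simp add: mult_le_0_iff)
  then show ?thesis using h by (simp add: pos_on_def)
qed

end

section \<open>Faithfulness of the invariant state\<close>

context row_coisometry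
begin

text \<open>The corner p = q = 0 is the compression of the Choi matrix by the isometry that sends a
  to (a, 0).\<close>

lemma choi_corner_form:
  "\<exists>V. form_on {..<n} (\<lambda>a b. g a b 0 0) v = form_on sq (choi g) V"
proof -
  define Y :: "nat \<Rightarrow> nat \<times> nat \<Rightarrow> complex" where "Y = (\<lambda>a x. kdelta (a, 0) x)"
  have 1: "mult_on sq Y A a z = A (a, 0) z" if "a < n" for a z and A :: "nat \<times> nat \<Rightarrow> 'x \<Rightarrow> complex"
    using that n_pos
    by (simp add: mult_on_def Y_def kdelta_def if_distrib[of "\<lambda>z. z * _"] cong: if_cong)
  have "mult_on sq (mult_on sq Y (choi g)) (adj Y) a b = g a b 0 0" if "a < n" "b < n" for a b
  proof -
    have "mult_on sq (mult_on sq Y (choi g)) (adj Y) a b = (\<Sum>z\<in>sq. choi g (a, 0) z * cnj (Y b z))"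
      by (simp add: mult_on_def[of sq "mult_on sq Y (choi g)"] 1 that adj_def)
    also have "\<dots> = (\<Sum>z\<in>sq. if z = (b, 0) then choi g (a, 0) z else 0)"
      by (intro sum.cong) (auto simp: Y_def kdelta_def)
    also have "\<dots> = g a b 0 0" using that n_pos by (simp add: choi_def)
    finally show ?thesis .
  qed
  then have "form_on {..<n} (\<lambda>a b. g a b 0 0) v = form_on {..<n} (mult_on sq (mult_on sq Y (choi g)) (adj Y)) v"
    by (intro form_on_cong) simp
  then show ?thesis unfolding form_on_conj by blast
qed

text \<open>At p = q = 0 the limit is \<phi> itself. It inherits symmetry and positivity from the
  Choi matrix, trace 1 from \<open>resolvent_trace\<close> and invariance from the left inverse
  equations. Its kernel is then an invariant subspace, which must be zero because \<phi> has trace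
  1.\<close>

lemma resolvent_limit_pos:
  assumes ev: "\<forall>\<^sub>F r in at_left 1. resolvent r (g r)"
    and lim: "\<And>a b p q. a < n \<Longrightarrow> b < n \<Longrightarrow> p < n \<Longrightarrow> q < n \<Longrightarrow>
      ((\<lambda>r. of_real (1 - r\<^sup>2) * g r a b p q) \<longlongrightarrow> kdelta p q * \<phi> a b) (at_left 1)"
  obtains c where "0 < c" "pos_on {..<n} c \<phi>"
proof -
  let ?F = "at_left (1::real)"
  have F: "?F \<noteq> bot" by simp
  have lim0: "((\<lambda>r. of_real (1 - r\<^sup>2) * g r a b 0 0) \<longlongrightarrow> \<phi> a b) ?F" if "a < n" "b < n" for a b
    using lim[OF that n_pos n_pos] by (simp add: kdelta_def)
  have r01: "\<forall>\<^sub>F r in ?F. r\<^sup>2 < 1"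
    by (rule eventually_at_leftI[of 0]) (auto simp: abs_square_less_1)
  have herm: "hermitian_on {..<n} \<phi>"
    unfolding hermitian_on_def
  proof (intro ballI)
    fix a b assume "a \<in> {..<n}" "b \<in> {..<n}"
    then have ab: "a < n" "b < n" by auto
    have "((\<lambda>r. cnj (of_real (1 - r\<^sup>2) * g r a b 0 0)) \<longlongrightarrow> cnj (\<phi> a b)) ?F"
      by (intro tendsto_cnj lim0 ab)
    moreover have "((\<lambda>r. cnj (of_real (1 - r\<^sup>2) * g r a b 0 0)) \<longlongrightarrow> \<phi> b a) ?F"
    proof (rule Lim_transform_eventually[OF lim0[OF ab(2,1)]])
      show "\<forall>\<^sub>F r in ?F. of_real (1 - r\<^sup>2) * g r b a 0 0 = cnj (of_real (1 - r\<^sup>2) * g r a b 0 0)"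
        using ev by eventually_elim (use ab n_pos resolvent_hermitian in auto)
    qed
    ultimately show "cnj (\<phi> a b) = \<phi> b a" using tendsto_unique[OF F] by blast
  qed
  have trace: "(\<Sum>a<n. \<phi> a a) = 1"
  proof (rule tendsto_unique[OF F])
    show "((\<lambda>r. \<Sum>a<n. of_real (1 - r\<^sup>2) * g r a a 0 0) \<longlongrightarrow> (\<Sum>a<n. \<phi> a a)) ?F"
      by (intro tendsto_sum lim0) auto
    have "\<forall>\<^sub>F r in ?F. 1 = (\<Sum>a<n. of_real (1 - r\<^sup>2) * g r a a 0 0)"
      using ev
    proof eventually_elim
      case (elim r)
      show ?case using resolvent_trace[OF elim n_pos n_pos] by (simp only: sum_distrib_left) (simp add: kdelta_def)
    qed
    then show "((\<lambda>r. \<Sum>a<n. of_real (1 - r\<^sup>2) * g r a a 0 0) \<longlongrightarrow> 1) ?F"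
      by (rule Lim_transform_eventually[OF tendsto_const])
  qed
  have pos: "pos_on {..<n} 0 \<phi>"
    unfolding pos_on_def
  proof (intro conjI herm allI)
    fix v
    have "((\<lambda>r. Re (form_on {..<n} (\<lambda>a b. of_real (1 - r\<^sup>2) * g r a b 0 0) v)) \<longlongrightarrow> Re (form_on {..<n} \<phi> v)) ?F"
      unfolding form_on_eq by (intro tendsto_Re tendsto_sum tendsto_mult tendsto_const lim0) auto
    moreover have "\<forall>\<^sub>F r in ?F. 0 \<le> Re (form_on {..<n} (\<lambda>a b. of_real (1 - r\<^sup>2) * g r a b 0 0) v)"
      using ev r01
    proof eventually_elim
      case (elim r)
      obtain V where "form_on {..<n} (\<lambda>a b. g r a b 0 0) v = form_on sq (choi (g r)) V"
        using choi_corner_form by blast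
      then show ?case
        using pos_onD[OF resolvent_pos[OF elim], of V] elim(2) by (simp add: form_on_scale del: of_real_diff)
    qed
    ultimately show "0 * norm2_on {..<n} v \<le> Re (form_on {..<n} \<phi> v)"
      using tendsto_lowerbound[OF _ _ F] by simp
  qed
  \<comment> \<open>After scaling, the inhomogeneous term carries the factor 1 - r^2 and disappears
    in the limit.\<close>
  have invariant: "\<phi> a b = (\<Sum>e<d. \<Sum>k<n. \<Sum>l<n. X e k a * \<phi> k l * cnj (X e l b))" if ab: "a < n" "b < n" for a b
  proof (rule tendsto_unique[OF F])
    let ?s = "\<lambda>\<psi>. \<Sum>e<d. \<Sum>k<n. \<Sum>l<n. X e k a * \<psi> k l * cnj (X e l b)"
    show "((\<lambda>r. of_real (1 - r\<^sup>2) * g r a b 0 0) \<longlongrightarrow> \<phi> a b) ?F" by (rule lim0[OF ab])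
    have sq: "((\<lambda>r. complex_of_real (r\<^sup>2)) \<longlongrightarrow> of_real (1\<^sup>2)) ?F"
      by (intro tendsto_of_real tendsto_power tendsto_ident_at)
    have "((\<lambda>r. of_real (1 - r\<^sup>2) * (kdelta a 0 * kdelta b 0) + of_real (r\<^sup>2) * ?s (\<lambda>k l. of_real (1 - r\<^sup>2) * g r k l 0 0))
        \<longlongrightarrow> of_real (1 - 1\<^sup>2) * (kdelta a 0 * kdelta b 0) + of_real (1\<^sup>2) * ?s \<phi>) ?F"
      by (intro tendsto_add tendsto_mult tendsto_sum tendsto_const lim0 sq tendsto_of_real
          tendsto_diff tendsto_power tendsto_ident_at) auto
    then have lim2: "((\<lambda>r. of_real (1 - r\<^sup>2) * (kdelta a 0 * kdelta b 0) + of_real (r\<^sup>2) * ?s (\<lambda>k l. of_real (1 - r\<^sup>2) * g r k l 0 0))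
        \<longlongrightarrow> ?s \<phi>) ?F" by simp
    show "((\<lambda>r. of_real (1 - r\<^sup>2) * g r a b 0 0) \<longlongrightarrow> ?s \<phi>) ?F"
    proof (rule Lim_transform_eventually[OF lim2])
      show "\<forall>\<^sub>F r in ?F. of_real (1 - r\<^sup>2) * (kdelta a 0 * kdelta b 0) +
          of_real (r\<^sup>2) * ?s (\<lambda>k l. of_real (1 - r\<^sup>2) * g r k l 0 0) = of_real (1 - r\<^sup>2) * g r a b 0 0"
        using ev
      proof eventually_elim
        case (elim r)
        have *: "g r a b 0 0 = kdelta a 0 * kdelta b 0 + of_real (r\<^sup>2) * ?s (\<lambda>k l. g r k l 0 0)"
        proof -
          have "g r a b 0 0 - of_real (r\<^sup>2) * ?s (\<lambda>k l. g r k l 0 0) = kdelta a 0 * kdelta b 0"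
            using elim ab n_pos unfolding resolvent_def by blast
          then show ?thesis by (simp only: diff_eq_eq)
        qed
        have "?s (\<lambda>k l. of_real (1 - r\<^sup>2) * g r k l 0 0) = of_real (1 - r\<^sup>2) * ?s (\<lambda>k l. g r k l 0 0)"
          by (simp add: sum_distrib_left mult_ac)
        then show ?case by (subst *) (simp only: algebra_simps)
      qed
    qed
  qed
  \<comment> \<open>Invariance reads \<phi> = sum of X_e^T \<phi> conj X_e, so the matrices that
    preserve the kernel of \<phi> are the entrywise conjugates of the X_e.\<close>
  define cX where "cX e = (\<lambda>k a. cnj (X e k a))" for e
  have inv_form: "form_on {..<n} \<phi> v = (\<Sum>e<d. form_on {..<n} \<phi> (app_on {..<n} (cX e) v))" for v
  proof -
    have "\<phi> a b = (\<Sum>e<d. mult_on {..<n} (mult_on {..<n} (adj (cX e)) \<phi>) (adj (adj (cX e))) a b)"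
      if "a < n" "b < n" for a b
    proof -
      have "(\<Sum>k<n. \<Sum>l<n. X e k a * \<phi> k l * cnj (X e l b)) =
          (\<Sum>l<n. \<Sum>k<n. X e k a * \<phi> k l * cnj (X e l b))" for e by (rule sum.swap)
      then show ?thesis using invariant[OF that]
        by (simp add: mult_on_def adj_def cX_def sum_distrib_right)
    qed
    then have "form_on {..<n} \<phi> v =
        form_on {..<n} (\<lambda>a b. \<Sum>e<d. mult_on {..<n} (mult_on {..<n} (adj (cX e)) \<phi>) (adj (adj (cX e))) a b) v"
      by (intro form_on_cong) auto
    then show ?thesis unfolding form_on_sum form_on_conj by simp
  qed
  \<comment> \<open>Conjugating \<phi> as well turns this into invariance under the X_e themselves,
    the form in which \<open>irreducible\<close> is stated.\<close>
  define M where "M = (\<lambda>i j. cnj (\<phi> i j))"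
  have cnj_app: "app_on {..<n} M w i = cnj (app_on {..<n} \<phi> (\<lambda>j. cnj (w j)) i)" for w i
    by (simp add: app_on_def M_def)
  have inj: "v i = 0" if ker: "\<And>i. i \<in> {..<n} \<Longrightarrow> app_on {..<n} \<phi> v i = 0" and "i \<in> {..<n}" for v i
  proof (rule ccontr)
    assume "v i \<noteq> 0"
    then have v: "norm2_on {..<n} (\<lambda>j. cnj (v j)) \<noteq> 0"
      using that(2) by (auto simp: norm2_on_eq_0)
    have "M i j = 0" if "i < n" "j < n" for i j
    proof (rule irreducible[of M "\<lambda>j. cnj (v j)"])
      fix e w i assume e: "e < d" and w: "\<And>i. i < n \<Longrightarrow> app_on {..<n} M w i = 0" and "i < n"
      have w': "app_on {..<n} \<phi> (\<lambda>j. cnj (w j)) i = 0" if "i < n" for i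
        using w[OF that] by (simp add: cnj_app)
      have "form_on {..<n} \<phi> (\<lambda>j. cnj (w j)) = 0"
        unfolding form_on_def inner_on_def using w' by simp
      then have "(\<Sum>e<d. Re (form_on {..<n} \<phi> (app_on {..<n} (cX e) (\<lambda>j. cnj (w j))))) = 0"
        unfolding inv_form[of "\<lambda>j. cnj (w j)"] by (simp flip: Re_sum)
      then have "Re (form_on {..<n} \<phi> (app_on {..<n} (cX e) (\<lambda>j. cnj (w j)))) = 0"
        using e pos_onD[OF pos] by (subst (asm) sum_nonneg_eq_0_iff) auto
      then have "app_on {..<n} \<phi> (app_on {..<n} (cX e) (\<lambda>j. cnj (w j))) i = 0"
        using \<open>i < n\<close> pos by (intro pos_on_kernel) auto
      moreover have "app_on {..<n} (cX e) (\<lambda>j. cnj (w j)) = (\<lambda>j. cnj (app_on {..<n} (X e) w j))"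
        by (simp add: app_on_def cX_def)
      ultimately show "app_on {..<n} M (app_on {..<n} (X e) w) i = 0" by (simp add: cnj_app)
    next
      show "app_on {..<n} M (\<lambda>j. cnj (v j)) i = 0" if "i < n" for i
        using ker that by (simp add: cnj_app)
    qed (use v that in auto)
    \<comment> \<open>Irreducibility gives \<phi> = 0, which contradicts trace 1.\<close>
    then have "\<phi> a a = 0" if "a < n" for a using that by (simp add: M_def)
    then show False using trace by simp
  qed
  show ?thesis
  proof (rule pos_on_bounded_below[of "{..<n}" \<phi>])
    show "x i = 0" if "\<And>i. i \<in> {..<n} \<Longrightarrow> app_on {..<n} \<phi> x i = 0" "i \<in> {..<n}" for x i
      using that by (rule inj)
  qed (use pos that in auto)
qed

end

section \<open>Row coisometries given by matrices\<close>

definition entries :: "complex mat \<Rightarrow> nat \<Rightarrow> nat \<Rightarrow> complex" where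
  "entries A = (\<lambda>i j. A $$ (i, j))"

text \<open>One induction over the generated algebra serves both the X_e and their adjoints. The map
  T is the identity or the adjoint, hence linear or conjugate linear and multiplicative or
  antimultiplicative; this is why the scalar is existentially quantified and the product rule is a
  disjunction.\<close>

lemma gen_algebra_irreducible:
  assumes G: "gen_algebra n G = carrier_mat n n" "G \<subseteq> carrier_mat n n"
    and T1: "\<And>w i. i < n \<Longrightarrow> app_on {..<n} (T (1\<^sub>m n)) w i = w i"
    and T_add: "\<And>A B w i. A \<in> carrier_mat n n \<Longrightarrow> B \<in> carrier_mat n n \<Longrightarrow> i < n \<Longrightarrow>
      app_on {..<n} (T (A + B)) w i = app_on {..<n} (T A) w i + app_on {..<n} (T B) w i"
    and T_smult: "\<And>A c. A \<in> carrier_mat n n \<Longrightarrow>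
      \<exists>c'. \<forall>w. \<forall>i<n. app_on {..<n} (T (c \<cdot>\<^sub>m A)) w i = c' * app_on {..<n} (T A) w i"
    and T_mult: "\<And>A B. A \<in> carrier_mat n n \<Longrightarrow> B \<in> carrier_mat n n \<Longrightarrow>
      (\<forall>w. \<forall>i<n. app_on {..<n} (T (A * B)) w i = app_on {..<n} (T A) (app_on {..<n} (T B) w) i) \<or>
      (\<forall>w. \<forall>i<n. app_on {..<n} (T (A * B)) w i = app_on {..<n} (T B) (app_on {..<n} (T A) w) i)"
    and T_unit: "\<And>j k z. j < n \<Longrightarrow> k < n \<Longrightarrow>
      \<exists>A\<in>carrier_mat n n. \<forall>w. \<forall>i<n. app_on {..<n} (T A) w i = kdelta i j * z * w k"
    and inv: "\<And>A w i. A \<in> G \<Longrightarrow> (\<And>i. i < n \<Longrightarrow> app_on {..<n} M w i = 0) \<Longrightarrow> i < n \<Longrightarrow>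
      app_on {..<n} M (app_on {..<n} (T A) w) i = 0"
    and v: "\<And>i. i < n \<Longrightarrow> app_on {..<n} M v i = 0" "norm2_on {..<n} v \<noteq> 0"
    and ij: "i < n" "j < n"
  shows "M i j = 0"
proof -
  have cong: "app_on {..<n} B w = app_on {..<n} B w'" if "\<And>i. i < n \<Longrightarrow> w i = w' i" for B w w'
    by (rule app_on_cong) (use that in auto)
  have all: "A \<in> carrier_mat n n \<and> (\<forall>w. (\<forall>i<n. app_on {..<n} M w i = 0) \<longrightarrow>
      (\<forall>i<n. app_on {..<n} M (app_on {..<n} (T A) w) i = 0))" if "A \<in> gen_algebra n G" for A
    using that
  proof induction
    case one
    have *: "app_on {..<n} M (app_on {..<n} (T (1\<^sub>m n)) w) = app_on {..<n} M w" for w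
      by (intro cong T1)
    show ?case unfolding * by simp
  next
    case (gen A)
    then show ?case using G(2) inv by blast
  next
    case (add A B)
    then have *: "app_on {..<n} M (app_on {..<n} (T (A + B)) w) =
        app_on {..<n} M (\<lambda>i. app_on {..<n} (T A) w i + app_on {..<n} (T B) w i)" for w
      by (intro cong T_add) auto
    show ?case using add unfolding * app_on_add by auto
  next
    case (smult A c)
    then obtain c' where "\<And>w i. i < n \<Longrightarrow> app_on {..<n} (T (c \<cdot>\<^sub>m A)) w i = c' * app_on {..<n} (T A) w i"
      using T_smult by blast
    then have *: "app_on {..<n} M (app_on {..<n} (T (c \<cdot>\<^sub>m A)) w) =
        app_on {..<n} M (\<lambda>i. c' * app_on {..<n} (T A) w i)" for w by (intro cong)
    show ?case using smult unfolding * app_on_scale by auto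
  next
    case (mult A B)
    then have AB: "A \<in> carrier_mat n n" "B \<in> carrier_mat n n" by auto
    from T_mult[OF this] show ?case
    proof
      assume "\<forall>w. \<forall>i<n. app_on {..<n} (T (A * B)) w i = app_on {..<n} (T A) (app_on {..<n} (T B) w) i"
      then have *: "app_on {..<n} M (app_on {..<n} (T (A * B)) w) =
          app_on {..<n} M (app_on {..<n} (T A) (app_on {..<n} (T B) w))" for w by (intro cong) blast
      show ?thesis unfolding * using mult by auto
    next
      assume "\<forall>w. \<forall>i<n. app_on {..<n} (T (A * B)) w i = app_on {..<n} (T B) (app_on {..<n} (T A) w) i"
      then have *: "app_on {..<n} M (app_on {..<n} (T (A * B)) w) =
          app_on {..<n} M (app_on {..<n} (T B) (app_on {..<n} (T A) w))" for w by (intro cong) blast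
      show ?thesis unfolding * using mult by auto
    qed
  qed
  \<comment> \<open>T A is the rank one matrix that sends v to the basis vector e_j. As v lies in
    the invariant kernel, M e_j = 0, which is column j of M.\<close>
  obtain k where k: "k < n" "v k \<noteq> 0" using v(2) by (auto simp: norm2_on_eq_0)
  obtain A where A: "A \<in> carrier_mat n n"
    "\<And>w i. i < n \<Longrightarrow> app_on {..<n} (T A) w i = kdelta i j * (1 / v k) * w k"
    using T_unit[OF ij(2) k(1), of "1 / v k"] by blast
  have "app_on {..<n} M (app_on {..<n} (T A) v) i = 0"
    using all[of A] A(1) G(1) v(1) ij(1) by blast
  also have "app_on {..<n} M (app_on {..<n} (T A) v) = app_on {..<n} M (\<lambda>i. kdelta i j)"
    by (rule cong) (use A(2) k in auto)
  also have "app_on {..<n} M (\<lambda>i. kdelta i j) i = M i j"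
    using ij by (simp add: app_on_def kdelta_def if_distrib[of "\<lambda>z. _ * z"] cong: if_cong)
  finally show ?thesis .
qed

lemma app_on_entries_mult:
  assumes "A \<in> carrier_mat n n" "B \<in> carrier_mat n n" "i < n"
  shows "app_on {..<n} (entries (A * B)) w i = app_on {..<n} (entries A) (app_on {..<n} (entries B) w) i"
  unfolding app_on_mult
  using assms by (auto simp: app_on_def mult_on_def entries_def scalar_prod_def lessThan_atLeast0 intro!: sum.cong)

lemma app_on_adj_entries_mult:
  assumes "A \<in> carrier_mat n n" "B \<in> carrier_mat n n" "i < n"
  shows "app_on {..<n} (adj (entries (A * B))) w i =
    app_on {..<n} (adj (entries B)) (app_on {..<n} (adj (entries A)) w) i"
  unfolding app_on_mult
  using assms
  by (auto simp: app_on_def mult_on_def entries_def adj_def scalar_prod_def lessThan_atLeast0 mult.commute intro!: sum.cong)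

lemma row_coisometryI:
  assumes n: "n \<ge> 1" and X: "X \<in> mat_tuples d n" and row: "row_square n X = 1\<^sub>m n"
    and gen: "gen_algebra n (set X) = carrier_mat n n"
  shows "row_coisometry n d (\<lambda>e. entries (X ! e))"
proof
  have len: "length X = d" and XC: "set X \<subseteq> carrier_mat n n" using X by (auto simp: mat_tuples_def)
  have Xe: "X ! e \<in> carrier_mat n n" if "e < d" for e using that len XC by auto
  show "0 < n" using n by simp
  fix p q assume pq: "p < n" "q < n"
  have "(X ! e * mat_adjoint (X ! e)) $$ (p, q) = mult_on {..<n} (entries (X ! e)) (adj (entries (X ! e))) p q"
    if "e < d" for e
    using Xe[OF that] pq
    by (simp add: scalar_prod_def mult_on_def entries_def adj_def lessThan_atLeast0 index_mat_adjoint)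
  then have "(\<Sum>e<d. mult_on {..<n} (entries (X ! e)) (adj (entries (X ! e))) p q) = row_square n X $$ (p, q)"
    using pq by (simp add: row_square_def mat_sum_def len)
  then show "(\<Sum>e<d. mult_on {..<n} (entries (X ! e)) (adj (entries (X ! e))) p q) = kdelta p q"
    using pq by (simp add: row kdelta_def)
next
  have len: "length X = d" and XC: "set X \<subseteq> carrier_mat n n" using X by (auto simp: mat_tuples_def)
  have idx: "\<exists>e<d. A = X ! e" if "A \<in> set X" for A using that len by (auto simp: in_set_conv_nth)
  {
    fix M v i j
    assume inv: "\<And>e w i. e < d \<Longrightarrow> (\<And>i. i < n \<Longrightarrow> app_on {..<n} M w i = 0) \<Longrightarrow> i < n \<Longrightarrow>
        app_on {..<n} M (app_on {..<n} (entries (X ! e)) w) i = 0"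
      and v: "\<And>i. i < n \<Longrightarrow> app_on {..<n} M v i = 0" "norm2_on {..<n} v \<noteq> 0" and ij: "i < n" "j < n"
    show "M i j = 0"
    proof (rule gen_algebra_irreducible[OF gen XC, where T = entries])
      show "app_on {..<n} (entries (1\<^sub>m n)) w i = w i" if "i < n" for w i
        using that by (simp add: app_on_def entries_def if_distrib[of "\<lambda>z. z * _"] cong: if_cong)
      show "\<exists>c'. \<forall>w. \<forall>i<n. app_on {..<n} (entries (c \<cdot>\<^sub>m A)) w i = c' * app_on {..<n} (entries A) w i"
        if "A \<in> carrier_mat n n" for A c
        using that by (intro exI[of _ c]) (auto simp: app_on_def entries_def sum_distrib_left mult.assoc)
      show "\<exists>A\<in>carrier_mat n n. \<forall>w. \<forall>i<n. app_on {..<n} (entries A) w i = kdelta i j * z * w k"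
        if "j < n" "k < n" for j k z
      proof (intro bexI allI impI)
        fix w i assume "i < n"
        have "app_on {..<n} (entries (mat n n (\<lambda>(a, b). kdelta a j * z * kdelta b k))) w i =
            (\<Sum>b<n. if b = k then kdelta i j * z * w b else 0)"
          unfolding app_on_def using \<open>i < n\<close> by (intro sum.cong) (auto simp: entries_def kdelta_def)
        then show "app_on {..<n} (entries (mat n n (\<lambda>(a, b). kdelta a j * z * kdelta b k))) w i =
            kdelta i j * z * w k" using that by simp
      qed simp
      show "app_on {..<n} (entries (A + B)) w i = app_on {..<n} (entries (A)) w i + app_on {..<n} (entries (B)) w i"
        if "A \<in> carrier_mat n n" "B \<in> carrier_mat n n" "i < n" for A B w i
        using that by (simp add: app_on_def entries_def distrib_right sum.distrib)
      show "(\<forall>w. \<forall>i<n. app_on {..<n} (entries (A * B)) w i = app_on {..<n} (entries (A)) (app_on {..<n} (entries (B)) w) i) \<or>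
          (\<forall>w. \<forall>i<n. app_on {..<n} (entries (A * B)) w i = app_on {..<n} (entries (B)) (app_on {..<n} (entries (A)) w) i)"
        if "A \<in> carrier_mat n n" "B \<in> carrier_mat n n" for A B
        using app_on_entries_mult[OF that] by blast
      show "app_on {..<n} M (app_on {..<n} (entries (A)) w) i = 0"
        if "A \<in> set X" "\<And>i. i < n \<Longrightarrow> app_on {..<n} M w i = 0" "i < n" for A w i
      proof -
        obtain e where "e < d" "A = X ! e" using idx[OF \<open>A \<in> set X\<close>] by blast
        then show ?thesis using inv[of e w i] that by blast
      qed
      show "app_on {..<n} M v i = 0" if "i < n" for i by (rule v(1)[OF that])
    qed (fact v(2) ij)+
  next
    fix M v i j
    assume inv: "\<And>e w i. e < d \<Longrightarrow> (\<And>i. i < n \<Longrightarrow> app_on {..<n} M w i = 0) \<Longrightarrow> i < n \<Longrightarrow>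
        app_on {..<n} M (app_on {..<n} (adj (entries (X ! e))) w) i = 0"
      and v: "\<And>i. i < n \<Longrightarrow> app_on {..<n} M v i = 0" "norm2_on {..<n} v \<noteq> 0" and ij: "i < n" "j < n"
    show "M i j = 0"
    proof (rule gen_algebra_irreducible[OF gen XC, where T = "\<lambda>A. adj (entries A)"])
      show "app_on {..<n} (adj (entries (1\<^sub>m n))) w i = w i" if "i < n" for w i
      proof -
        have "app_on {..<n} (adj (entries (1\<^sub>m n))) w i = (\<Sum>j<n. if j = i then w j else 0)"
          unfolding app_on_def using that by (intro sum.cong) (auto simp: entries_def adj_def)
        then show ?thesis using that by simp
      qed
      show "\<exists>c'. \<forall>w. \<forall>i<n. app_on {..<n} (adj (entries (c \<cdot>\<^sub>m A))) w i = c' * app_on {..<n} (adj (entries A)) w i"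
        if "A \<in> carrier_mat n n" for A c
        using that by (intro exI[of _ "cnj c"]) (auto simp: app_on_def entries_def adj_def sum_distrib_left mult.assoc)
      show "\<exists>A\<in>carrier_mat n n. \<forall>w. \<forall>i<n. app_on {..<n} (adj (entries A)) w i = kdelta i j * z * w k"
        if "j < n" "k < n" for j k z
      proof (intro bexI allI impI)
        fix w i assume "i < n"
        \<comment> \<open>The conjugated scalar and the exchanged indices are undone by
          \<open>adj\<close>.\<close>
        have "app_on {..<n} (adj (entries (mat n n (\<lambda>(b, a). kdelta a j * cnj z * kdelta b k)))) w i =
            (\<Sum>b<n. if b = k then kdelta i j * z * w b else 0)"
          unfolding app_on_def using \<open>i < n\<close> by (intro sum.cong) (auto simp: entries_def adj_def kdelta_def)
        then show "app_on {..<n} (adj (entries (mat n n (\<lambda>(b, a). kdelta a j * cnj z * kdelta b k)))) w i =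
            kdelta i j * z * w k" using that by simp
      qed simp
      show "app_on {..<n} (adj (entries (A + B))) w i = app_on {..<n} (adj (entries (A))) w i + app_on {..<n} (adj (entries (B))) w i"
        if "A \<in> carrier_mat n n" "B \<in> carrier_mat n n" "i < n" for A B w i
        using that by (simp add: app_on_def entries_def adj_def distrib_right sum.distrib)
      show "(\<forall>w. \<forall>i<n. app_on {..<n} (adj (entries (A * B))) w i = app_on {..<n} (adj (entries (A))) (app_on {..<n} (adj (entries (B))) w) i) \<or>
          (\<forall>w. \<forall>i<n. app_on {..<n} (adj (entries (A * B))) w i = app_on {..<n} (adj (entries (B))) (app_on {..<n} (adj (entries (A))) w) i)"
        if "A \<in> carrier_mat n n" "B \<in> carrier_mat n n" for A B
        using app_on_adj_entries_mult[OF that] by blast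
      show "app_on {..<n} M (app_on {..<n} (adj (entries (A))) w) i = 0"
        if "A \<in> set X" "\<And>i. i < n \<Longrightarrow> app_on {..<n} M w i = 0" "i < n" for A w i
      proof -
        obtain e where "e < d" "A = X ! e" using idx[OF \<open>A \<in> set X\<close>] by blast
        then show ?thesis using inv[of e w i] that by blast
      qed
      show "app_on {..<n} M v i = 0" if "i < n" for i by (rule v(1)[OF that])
    qed (fact v(2) ij)+
  }
qed

definition shift_mat :: "nat \<Rightarrow> mat_tuple \<Rightarrow> complex mat" where
  "shift_mat n X = kron (1\<^sub>m n) (1\<^sub>m n) -
     mat_sum (n * n) (n * n) (\<lambda>i. kron (map_mat cnj (X ! i)) (X ! i)) {..<length X}"

lemma P_mat_shift: "P_mat n X = psi n (mat_inv (shift_mat n X))"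
  by (simp add: P_mat_def shift_mat_def)

lemma shift_mat_carrier: "shift_mat n X \<in> carrier_mat (n * n) (n * n)"
  by (intro carrier_matI) (simp_all add: shift_mat_def mat_sum_def)

lemma index_shift_mat:
  assumes X: "X \<in> mat_tuples d n" and "q < n" "p < n" "l < n" "k < n"
  shows "shift_mat n (scale_tuple r X) $$ (q * n + p, l * n + k) =
    kdelta q l * kdelta p k - of_real (r\<^sup>2) * (\<Sum>e<d. cnj (entries (X ! e) q l) * entries (X ! e) p k)"
proof -
  have len: "length X = d" and Xe: "\<And>e. e < d \<Longrightarrow> X ! e \<in> carrier_mat n n"
    using X by (auto simp: mat_tuples_def)
  have bnd: "q * n + p < n * n" "l * n + k < n * n" using assms by (auto intro: mult_add_less)
  have "kron (map_mat cnj (scale_tuple r X ! e)) (scale_tuple r X ! e) $$ (q * n + p, l * n + k) =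
      of_real (r\<^sup>2) * (cnj (entries (X ! e) q l) * entries (X ! e) p k)" if "e < d" for e
    using index_kron[of q "map_mat cnj (scale_tuple r X ! e)" p "scale_tuple r X ! e" l k] Xe[OF that] assms that len
    by (simp add: scale_tuple_def entries_def power2_eq_square)
  moreover have "kron (1\<^sub>m n) (1\<^sub>m n) $$ (q * n + p, l * n + k) = kdelta q l * kdelta p k"
    using index_kron[of q "1\<^sub>m n" p "1\<^sub>m n" l k] assms by (simp add: kdelta_def)
  ultimately show ?thesis
    using bnd by (simp add: shift_mat_def mat_sum_def scale_tuple_def len sum_distrib_left)
qed

lemma sum_pair_delta:
  fixes f :: "nat \<Rightarrow> nat \<Rightarrow> complex"
  assumes "b < n" "a < m"
  shows "(\<Sum>l<n. \<Sum>k<m. if l = b then if k = a then f l k else 0 else 0) = f b a"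
proof -
  have "(\<Sum>l<n. \<Sum>k<m. if l = b then if k = a then f l k else 0 else 0) = (\<Sum>l<n. if l = b then f l a else 0)"
    using assms by (intro sum.cong) auto
  then show ?thesis using assms by simp
qed

section \<open>The pole of the resolvent at r = 1\<close>

locale row_coisometry_mat = row_coisometry n d "\<lambda>e. entries (X ! e)" for n d and X :: mat_tuple +
  assumes X: "X \<in> mat_tuples d n"
begin

abbreviation "S r \<equiv> shift_mat n (scale_tuple r X)"

text \<open>The Kronecker product of conj X and X acts on a column-stacked matrix A as X A X^*.
  Position q * n + p is row p of column q, so \<open>S r\<close> is the matrix of id - r^2
  \<Phi>.\<close>

lemma S_apply:
  assumes "p < n" "q < n"
  shows "(\<Sum>j<n * n. S r $$ (q * n + p, j) * v j) =
    v (q * n + p) - of_real (r\<^sup>2) * \<Phi> (\<lambda>k l. v (l * n + k)) p q"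
proof -
  let ?f = "\<lambda>e k l. entries (X ! e) p k * v (l * n + k) * cnj (entries (X ! e) q l)"
  have "(\<Sum>j<n * n. S r $$ (q * n + p, j) * v j) =
      (\<Sum>l<n. \<Sum>k<n. (if l = q then if k = p then v (l * n + k) else 0 else 0) -
        of_real (r\<^sup>2) * (\<Sum>e<d. ?f e k l))"
    unfolding sum_lessThan_mult
  proof (intro sum.cong refl)
    fix l k assume "l \<in> {..<n}" "k \<in> {..<n}"
    then have S: "S r $$ (q * n + p, l * n + k) = kdelta q l * kdelta p k -
        of_real (r\<^sup>2) * (\<Sum>e<d. cnj (entries (X ! e) q l) * entries (X ! e) p k)"
      by (intro index_shift_mat[OF X]) (use assms in auto)
    show "S r $$ (q * n + p, l * n + k) * v (l * n + k) =
        (if l = q then if k = p then v (l * n + k) else 0 else 0) -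
        of_real (r\<^sup>2) * (\<Sum>e<d. ?f e k l)"
      unfolding S by (auto simp: kdelta_def algebra_simps sum_distrib_left)
  qed
  also have "\<dots> = v (q * n + p) - of_real (r\<^sup>2) *
      (\<Sum>l<n. \<Sum>k<n. \<Sum>e<d. ?f e k l)"
    using assms sum_pair_delta[of q n p n "\<lambda>l k. v (l * n + k)"] by (simp add: sum_subtractf sum_distrib_left)
  also have "(\<Sum>l<n. \<Sum>k<n. \<Sum>e<d. ?f e k l) =
      (\<Sum>l<n. \<Sum>e<d. \<Sum>k<n. ?f e k l)"
    by (intro sum.cong refl sum.swap)
  also have "\<dots> = (\<Sum>e<d. \<Sum>l<n. \<Sum>k<n. ?f e k l)"
    by (rule sum.swap)
  also have "\<dots> = \<Phi> (\<lambda>k l. v (l * n + k)) p q"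
    unfolding \<Phi>_eq by (intro sum.cong refl sum.swap)
  finally show ?thesis .
qed

text \<open>\<open>T r\<close> is \<open>id - r\<^sup>2 \<Phi>\<close> perturbed by the rank one map \<open>A \<mapsto> A\<^sub>0\<^sub>0 I\<close>. Unlike \<open>S r\<close> it stays
  invertible at \<open>r = 1\<close>, and \<open>S r\<close> is inverted from it by the Sherman-Morrison formula.\<close>

definition T :: "real \<Rightarrow> complex mat" where
  "T r = mat (n * n) (n * n) (\<lambda>(i, j). S r $$ (i, j) + (if j = 0 then kdelta (i mod n) (i div n) else 0))"

lemma T_carrier: "T r \<in> carrier_mat (n * n) (n * n)"
  by (simp add: T_def)

lemma T_apply:
  assumes "p < n" "q < n"
  shows "(\<Sum>j<n * n. T r $$ (q * n + p, j) * v j) =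
    v (q * n + p) - of_real (r\<^sup>2) * \<Phi> (\<lambda>k l. v (l * n + k)) p q + kdelta p q * v 0"
proof -
  have "(\<Sum>j<n * n. T r $$ (q * n + p, j) * v j) =
      (\<Sum>j<n * n. S r $$ (q * n + p, j) * v j + (if j = 0 then kdelta p q * v j else 0))"
    using assms mult_add_less[of q n p n]
    by (intro sum.cong refl) (auto simp: T_def distrib_right)
  also have "\<dots> = (\<Sum>j<n * n. S r $$ (q * n + p, j) * v j) + kdelta p q * v 0"
    using n_pos by (simp add: sum.distrib)
  finally show ?thesis by (simp only: S_apply[OF assms])
qed

text \<open>A kernel element A satisfies \<Phi> A = A + A_00 I. By \<open>\<Phi>_shift\<close> first
  A_00 = 0 and then A is a scalar matrix c I, so that c = A_00 = 0. Both halves of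
  \<open>\<Phi>_shift\<close> are consumed here.\<close>

lemma det_T_1: "det (T 1) \<noteq> 0"
proof
  assume "det (T 1) = 0"
  then obtain v where v: "v \<in> carrier_vec (n * n)" "v \<noteq> 0\<^sub>v (n * n)" "T 1 *\<^sub>v v = 0\<^sub>v (n * n)"
    using det_0_iff_vec_prod_zero[OF T_carrier] by auto
  define A where "A = (\<lambda>k l. v $ (l * n + k))"
  have 0: "\<Phi> A p q = A p q + A 0 0 * kdelta p q" if "p < n" "q < n" for p q
  proof -
    have lt: "q * n + p < n * n" using that by (simp add: mult_add_less)
    have "0 = (T 1 *\<^sub>v v) $ (q * n + p)" using v lt by simp
    also have "\<dots> = (\<Sum>j<n * n. T 1 $$ (q * n + p, j) * v $ j)"
      using v(1) lt T_carrier[of 1] by (simp add: scalar_prod_def lessThan_atLeast0)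
    finally have "v $ (q * n + p) - \<Phi> A p q + kdelta p q * v $ 0 = 0"
      using T_apply[OF that, of 1 "\<lambda>j. v $ j"] by (simp add: A_def)
    moreover have "y = x + w * z" if "x - y + z * w = 0" for x y z w :: complex
    proof -
      have "(x + w * z) - y = 0" using that by (simp add: algebra_simps)
      then show ?thesis by simp
    qed
    ultimately show ?thesis by (simp add: A_def)
  qed
  have "A 0 0 = 0" by (rule \<Phi>_shift(1)[OF 0])
  moreover obtain c where c: "\<And>p q. p < n \<Longrightarrow> q < n \<Longrightarrow> A p q = c * kdelta p q"
    using \<Phi>_shift(2)[OF 0] by blast
  ultimately have "c = 0" using n_pos by (simp add: kdelta_def)
  have "v $ j = 0" if "j < n * n" for j
    using ex_mult_add[OF that] c \<open>c = 0\<close> by (auto simp: A_def)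
  then show False using v(1,2) by (auto intro: eq_vecI)
qed

lemma T_tendsto: "mat_tendsto T (T 1) (at_left 1)"
  unfolding mat_tendsto_def
proof (intro conjI allI impI)
  show "\<forall>\<^sub>F r in at_left 1. T r \<in> carrier_mat (dim_row (T 1)) (dim_col (T 1))"
    using T_carrier by (auto simp: T_def)
  fix i j assume "i < dim_row (T 1)" "j < dim_col (T 1)"
  then have ij: "i < n * n" "j < n * n" using T_carrier[of 1] by auto
  then obtain q p l k where qp: "q < n" "p < n" "i = q * n + p" "l < n" "k < n" "j = l * n + k"
    using ex_mult_add[of i n n] ex_mult_add[of j n n] by auto
  have "T r $$ (i, j) = kdelta q l * kdelta p k -
      of_real (r\<^sup>2) * (\<Sum>e<d. cnj (entries (X ! e) q l) * entries (X ! e) p k) +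
      (if j = 0 then kdelta (i mod n) (i div n) else 0)" for r
    using ij index_shift_mat[OF X qp(1,2,4,5), of r] unfolding T_def by (simp add: qp(3,6))
  then show "((\<lambda>r. T r $$ (i, j)) \<longlongrightarrow> T 1 $$ (i, j)) (at_left 1)"
    by (simp only:) (intro tendsto_intros)
qed

text \<open>\<open>S r\<close> is \<open>T r\<close> minus the rank one map A \<mapsto> A_00 I, and
  it multiplies the identity by 1 - r^2. Hence the correction to the inverse of \<open>T r\<close>
  is I / (1 - r^2) times row 0 of that inverse, and the pole becomes an explicit factor.\<close>

definition G :: "real \<Rightarrow> complex mat" where
  "G r = mat (n * n) (n * n) (\<lambda>(i, j). mat_inv (T r) $$ (i, j) +
     of_real (1 / (1 - r\<^sup>2)) * kdelta (i mod n) (i div n) * mat_inv (T r) $$ (0, j))"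

lemma S_mult_G:
  assumes "det (T r) \<noteq> 0" "r\<^sup>2 \<noteq> 1"
  shows "S r * G r = 1\<^sub>m (n * n)"
proof (rule eq_matI)
  fix i j assume "i < dim_row (1\<^sub>m (n * n))" "j < dim_col (1\<^sub>m (n * n))"
  then have ij: "i < n * n" "j < n * n" by auto
  then obtain q p where qp: "q < n" "p < n" "i = q * n + p" using ex_mult_add[of i n n] by auto
  let ?L = "mat_inv (T r)"
  have L: "?L \<in> carrier_mat (n * n) (n * n)" "T r * ?L = 1\<^sub>m (n * n)"
    using mat_inv_invertible[OF T_carrier assms(1)] by auto
  have Gc: "G r \<in> carrier_mat (n * n) (n * n)" by (simp add: G_def)
  have TL: "(\<Sum>m<n * n. T r $$ (i, m) * ?L $$ (m, j)) = 1\<^sub>m (n * n) $$ (i, j)"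
    unfolding L(2)[symmetric] using L(1) ij T_carrier[of r] by (simp add: scalar_prod_def lessThan_atLeast0)
  have SL: "(\<Sum>m<n * n. S r $$ (i, m) * ?L $$ (m, j)) = 1\<^sub>m (n * n) $$ (i, j) - kdelta p q * ?L $$ (0, j)"
    unfolding TL[symmetric] unfolding qp(3) S_apply[OF qp(2,1), of r "\<lambda>m. ?L $$ (m, j)"]
      T_apply[OF qp(2,1), of r "\<lambda>m. ?L $$ (m, j)"] by simp
  have SU: "(\<Sum>m<n * n. S r $$ (i, m) * kdelta (m mod n) (m div n)) = of_real (1 - r\<^sup>2) * kdelta p q"
  proof -
    have "\<Phi> (\<lambda>k l. kdelta ((l * n + k) mod n) ((l * n + k) div n)) p q = \<Phi> kdelta p q"
      by (subst \<Phi>_cong[where B = kdelta]) auto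
    then show ?thesis
      using S_apply[OF qp(2,1), of r "\<lambda>m. kdelta (m mod n) (m div n)"] qp
      by (simp add: \<Phi>_kdelta left_diff_distrib)
  qed
  have "(S r * G r) $$ (i, j) = (\<Sum>m<n * n. S r $$ (i, m) * G r $$ (m, j))"
    using shift_mat_carrier[of n "scale_tuple r X"] Gc ij by (simp add: scalar_prod_def lessThan_atLeast0)
  also have "\<dots> = (\<Sum>m<n * n. S r $$ (i, m) * ?L $$ (m, j)) +
      of_real (1 / (1 - r\<^sup>2)) * (\<Sum>m<n * n. S r $$ (i, m) * kdelta (m mod n) (m div n)) * ?L $$ (0, j)"
    using ij by (simp add: G_def distrib_left sum.distrib sum_distrib_left sum_distrib_right mult_ac)
  also have "\<dots> = 1\<^sub>m (n * n) $$ (i, j) - kdelta p q * ?L $$ (0, j) +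
      (of_real (1 / (1 - r\<^sup>2)) * of_real (1 - r\<^sup>2)) * (kdelta p q * ?L $$ (0, j))"
    unfolding SL SU by (simp only: mult.assoc)
  also have "complex_of_real (1 / (1 - r\<^sup>2)) * of_real (1 - r\<^sup>2) = 1"
    using assms(2) by (simp only: of_real_mult[symmetric]) simp
  also have "1\<^sub>m (n * n) $$ (i, j) - kdelta p q * ?L $$ (0, j) + 1 * (kdelta p q * ?L $$ (0, j)) =
      1\<^sub>m (n * n) $$ (i, j)" by simp
  finally show "(S r * G r) $$ (i, j) = 1\<^sub>m (n * n) $$ (i, j)" .
qed (simp_all add: G_def shift_mat_def mat_sum_def)

definition g :: "real \<Rightarrow> nat \<Rightarrow> nat \<Rightarrow> nat \<Rightarrow> nat \<Rightarrow> complex" where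
  "g r = (\<lambda>a b p q. G r $$ (q * n + p, b * n + a))"

lemma resolvent_g:
  assumes "det (T r) \<noteq> 0" "r\<^sup>2 \<noteq> 1"
  shows "resolvent r (g r)"
proof -
  have Gc: "G r \<in> carrier_mat (n * n) (n * n)" by (simp add: G_def)
  have Sc: "S r \<in> carrier_mat (n * n) (n * n)" by (rule shift_mat_carrier)
  have SG: "S r * G r = 1\<^sub>m (n * n)" by (rule S_mult_G[OF assms])
  have GS: "G r * S r = 1\<^sub>m (n * n)" by (rule mat_mult_left_right_inverse[OF Sc Gc SG])
  have one: "1\<^sub>m (n * n) $$ (q * n + p, b * n + a) = kdelta a p * kdelta b q"
    if "a < n" "b < n" "p < n" "q < n" for a b p q
    using that index_kron[of q "1\<^sub>m n" p "1\<^sub>m n" b a] unfolding kron_one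
    by (auto simp: kdelta_def)
  show ?thesis
    unfolding resolvent_def
  proof (intro conjI allI impI)
    fix a b p q assume abpq: "a < n" "b < n" "p < n" "q < n"
    let ?f = "\<lambda>e k l. entries (X ! e) k a * g r k l p q * cnj (entries (X ! e) l b)"
    from abpq have lt: "q * n + p < n * n" "b * n + a < n * n" by (simp_all add: mult_add_less)
    have "kdelta a p * kdelta b q = (S r * G r) $$ (q * n + p, b * n + a)"
      unfolding SG one[OF abpq] ..
    also have "\<dots> = (\<Sum>j<n * n. S r $$ (q * n + p, j) * G r $$ (j, b * n + a))"
      using Gc Sc lt by (simp add: scalar_prod_def lessThan_atLeast0)
    also have "\<dots> = g r a b p q - of_real (r\<^sup>2) * \<Phi> (g r a b) p q"
      unfolding S_apply[OF abpq(3,4)] g_def ..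
    finally show "g r a b p q - of_real (r\<^sup>2) * \<Phi> (g r a b) p q = kdelta a p * kdelta b q" ..
    have "kdelta a p * kdelta b q = (G r * S r) $$ (q * n + p, b * n + a)"
      unfolding GS one[OF abpq] ..
    also have "\<dots> = (\<Sum>j<n * n. G r $$ (q * n + p, j) * S r $$ (j, b * n + a))"
      using Gc Sc lt by (simp add: scalar_prod_def lessThan_atLeast0)
    also have "\<dots> = (\<Sum>l<n. \<Sum>k<n. (if l = b then if k = a then g r k l p q else 0 else 0) -
        of_real (r\<^sup>2) * (\<Sum>e<d. ?f e k l))"
      unfolding sum_lessThan_mult
    proof (intro sum.cong refl)
      fix l k assume "l \<in> {..<n}" "k \<in> {..<n}"
      then have S: "S r $$ (l * n + k, b * n + a) = kdelta l b * kdelta k a -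
          of_real (r\<^sup>2) * (\<Sum>e<d. cnj (entries (X ! e) l b) * entries (X ! e) k a)"
        by (intro index_shift_mat[OF X]) (use abpq in auto)
      show "G r $$ (q * n + p, l * n + k) * S r $$ (l * n + k, b * n + a) =
          (if l = b then if k = a then g r k l p q else 0 else 0) -
          of_real (r\<^sup>2) * (\<Sum>e<d. ?f e k l)"
        unfolding S by (auto simp: g_def kdelta_def algebra_simps sum_distrib_left)
    qed
    also have "\<dots> = g r a b p q - of_real (r\<^sup>2) *
        (\<Sum>l<n. \<Sum>k<n. \<Sum>e<d. ?f e k l)"
      using abpq by (simp only: sum_subtractf sum_distrib_left sum_pair_delta)
    also have "(\<Sum>l<n. \<Sum>k<n. \<Sum>e<d. ?f e k l) =
        (\<Sum>l<n. \<Sum>e<d. \<Sum>k<n. ?f e k l)"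
      by (intro sum.cong refl sum.swap)
    also have "\<dots> = (\<Sum>e<d. \<Sum>l<n. \<Sum>k<n. ?f e k l)"
      by (rule sum.swap)
    also have "\<dots> = (\<Sum>e<d. \<Sum>k<n. \<Sum>l<n. ?f e k l)"
      by (intro sum.cong refl sum.swap)
    finally show "g r a b p q - of_real (r\<^sup>2) *
        (\<Sum>e<d. \<Sum>k<n. \<Sum>l<n. ?f e k l) =
        kdelta a p * kdelta b q" ..
  qed
qed

text \<open>\<open>psi\<close> reshuffles the matrix of a linear map on matrices into its Choi
  matrix.\<close>

lemma P_mat_index:
  assumes "det (T r) \<noteq> 0" "r\<^sup>2 \<noteq> 1" "a < n" "b < n" "p < n" "q < n"
  shows "P_mat n (scale_tuple r X) $$ (a * n + p, b * n + q) = g r a b p q"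
proof -
  have "mat_inv (S r) = G r"
    by (rule mat_inv_eqI[OF shift_mat_carrier _ S_mult_G[OF assms(1,2)]]) (simp add: G_def)
  then show ?thesis using assms mult_add_less[of a n p n] mult_add_less[of b n q n]
    by (simp add: P_mat_shift psi_def g_def)
qed

text \<open>The residue of \<open>G\<close>: the summand \<open>mat_inv (T r)\<close> stays bounded
  near r = 1, so after scaling by 1 - r^2 only I times row 0 survives.\<close>

definition \<phi> :: "nat \<Rightarrow> nat \<Rightarrow> complex" where
  "\<phi> a b = mat_inv (T 1) $$ (0, b * n + a)"

lemma eventually_T: "\<forall>\<^sub>F r in at_left 1. det (T r) \<noteq> 0 \<and> r\<^sup>2 \<noteq> 1 \<and> r\<^sup>2 < 1 \<and> 0 < r \<and> r < 1"
proof -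
  have "\<forall>\<^sub>F r in at_left (1::real). r\<^sup>2 \<noteq> 1 \<and> r\<^sup>2 < 1 \<and> 0 < r \<and> r < 1"
    by (rule eventually_at_leftI[of 0]) (auto simp: abs_square_less_1 abs_square_eq_1 power2_eq_1_iff)
  with mat_tendsto_mat_inv(2)[OF T_tendsto T_carrier det_T_1] show ?thesis
    by eventually_elim auto
qed

lemma g_tendsto:
  assumes "a < n" "b < n" "p < n" "q < n"
  shows "((\<lambda>r. of_real (1 - r\<^sup>2) * g r a b p q) \<longlongrightarrow> kdelta p q * \<phi> a b) (at_left 1)"
proof -
  have lt: "q * n + p < n * n" "b * n + a < n * n" "0 < n * n"
    using assms by (simp_all add: mult_add_less)
  have Lc: "mat_inv (T 1) \<in> carrier_mat (n * n) (n * n)"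
    by (rule mat_inv_invertible(1)[OF T_carrier det_T_1])
  have lim: "((\<lambda>r. mat_inv (T r) $$ (i, j)) \<longlongrightarrow> mat_inv (T 1) $$ (i, j)) (at_left 1)"
    if "i < n * n" "j < n * n" for i j
    using mat_tendsto_index[OF mat_tendsto_mat_inv(1)[OF T_tendsto T_carrier det_T_1]] that Lc by simp
  have "((\<lambda>r. of_real (1 - r\<^sup>2) * mat_inv (T r) $$ (q * n + p, b * n + a) +
      kdelta p q * mat_inv (T r) $$ (0, b * n + a)) \<longlongrightarrow>
      of_real (1 - 1\<^sup>2) * mat_inv (T 1) $$ (q * n + p, b * n + a) +
      kdelta p q * mat_inv (T 1) $$ (0, b * n + a)) (at_left 1)"
    by (intro tendsto_intros lim lt)
  then have "((\<lambda>r. of_real (1 - r\<^sup>2) * mat_inv (T r) $$ (q * n + p, b * n + a) +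
      kdelta p q * mat_inv (T r) $$ (0, b * n + a)) \<longlongrightarrow> kdelta p q * \<phi> a b) (at_left 1)"
    by (simp add: \<phi>_def)
  then show ?thesis
  proof (rule Lim_transform_eventually)
    show "\<forall>\<^sub>F r in at_left 1. of_real (1 - r\<^sup>2) * mat_inv (T r) $$ (q * n + p, b * n + a) +
        kdelta p q * mat_inv (T r) $$ (0, b * n + a) = of_real (1 - r\<^sup>2) * g r a b p q"
      using eventually_T
    proof eventually_elim
      case (elim r)
      have "complex_of_real (1 - r\<^sup>2) * of_real (1 / (1 - r\<^sup>2)) = 1"
        using elim by (simp only: of_real_mult[symmetric]) simp
      then have "of_real (1 - r\<^sup>2) * (of_real (1 / (1 - r\<^sup>2)) * kdelta p q * z) = kdelta p q * z" for z
        by (simp only: mult.assoc[symmetric]) simp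
      then show ?case
        unfolding g_def G_def using assms lt by (simp only: index_mat(1) prod.case distrib_left) simp
    qed
  qed
qed

lemma \<phi>_pos:
  obtains c where "0 < c" "pos_on {..<n} c \<phi>"
proof (rule resolvent_limit_pos[of g \<phi>])
  show "\<forall>\<^sub>F r in at_left 1. resolvent r (g r)"
    using eventually_T by eventually_elim (simp add: resolvent_g)
qed (use g_tendsto that in auto)

end

section \<open>Transfer functions on the row ball\<close>

text \<open>The squared norm of the row operator (W_1, ..., W_d) is at most q. The gap q < 1 is what
  makes the state equation below uniquely solvable.\<close>

definition row_contraction :: "nat \<Rightarrow> nat \<Rightarrow> mat_tuple \<Rightarrow> bool" where
  "row_contraction d m W \<longleftrightarrow> W \<in> mat_tuples d m \<and> (\<exists>q. 0 \<le> q \<and> q < 1 \<and>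
    (\<forall>g. (\<Sum>p<m. (cmod (\<Sum>e<d. \<Sum>r<m. W ! e $$ (p, r) * g e r))\<^sup>2) \<le>
      q * (\<Sum>e<d. \<Sum>r<m. (cmod (g e r))\<^sup>2)))"

text \<open>W_e \<Gamma> = \<Gamma> Z_e for all e. Direct sums and similarities are both of this
  kind, so that a single intertwining lemma yields both nc axioms.\<close>

definition intertwines ::
    "nat \<Rightarrow> nat \<Rightarrow> nat \<Rightarrow> mat_tuple \<Rightarrow> mat_tuple \<Rightarrow> (nat \<Rightarrow> nat \<Rightarrow> complex) \<Rightarrow> bool" where
  "intertwines d m m' W Z \<Gamma> \<longleftrightarrow> (\<forall>e<d. \<forall>p<m. \<forall>q<m'.
    (\<Sum>r<m. W ! e $$ (p, r) * \<Gamma> r q) = (\<Sum>r<m'. \<Gamma> p r * Z ! e $$ (r, q)))"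

text \<open>The block operator with rows (D, C) and (B, A) is a contraction from inputs and states
  to outputs and d copies of the state space.\<close>

locale contractive_realization =
  fixes s t d :: nat and K :: "'k set"
    and D :: "nat \<Rightarrow> nat \<Rightarrow> complex" and C :: "nat \<Rightarrow> 'k \<Rightarrow> complex"
    and B :: "'k \<Rightarrow> nat \<Rightarrow> nat \<Rightarrow> complex" and A :: "'k \<Rightarrow> nat \<Rightarrow> 'k \<Rightarrow> complex"
  assumes fin: "finite K" and d_pos: "0 < d"
    and contraction: "\<And>u h.
      (\<Sum>i<s. (cmod ((\<Sum>l<t. D i l * u l) + (\<Sum>k\<in>K. C i k * h k)))\<^sup>2) +
      (\<Sum>k\<in>K. \<Sum>e<d. (cmod ((\<Sum>l<t. B k e l * u l) + (\<Sum>k'\<in>K. A k e k' * h k')))\<^sup>2) \<le>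
      (\<Sum>l<t. (cmod (u l))\<^sup>2) + (\<Sum>k\<in>K. (cmod (h k))\<^sup>2)"
begin

definition drive :: "(nat \<Rightarrow> nat \<Rightarrow> complex) \<Rightarrow> ('k \<Rightarrow> nat \<Rightarrow> complex) \<Rightarrow> 'k \<Rightarrow> nat \<Rightarrow> nat \<Rightarrow> complex" where
  "drive u h k e p = (\<Sum>l<t. B k e l * u l p) + (\<Sum>k'\<in>K. A k e k' * h k' p)"

definition response :: "(nat \<Rightarrow> nat \<Rightarrow> complex) \<Rightarrow> ('k \<Rightarrow> nat \<Rightarrow> complex) \<Rightarrow> nat \<Rightarrow> nat \<Rightarrow> complex" where
  "response u h i p = (\<Sum>l<t. D i l * u l p) + (\<Sum>k\<in>K. C i k * h k p)"

text \<open>The solution is h = (1 - Z A)^(-1) Z B u. Working with the equation instead of the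
  inverse makes linearity and intertwining direct manipulations of sums.\<close>

definition state :: "nat \<Rightarrow> mat_tuple \<Rightarrow> (nat \<Rightarrow> nat \<Rightarrow> complex) \<Rightarrow> ('k \<Rightarrow> nat \<Rightarrow> complex) \<Rightarrow> bool" where
  "state m W u h \<longleftrightarrow> (\<forall>k\<in>K. \<forall>p<m. h k p = (\<Sum>e<d. \<Sum>r<m. W ! e $$ (p, r) * drive u h k e r))"

lemma drive_combination:
  "drive (\<lambda>l p. \<Sum>j\<in>J. c j * u j l p) (\<lambda>k p. \<Sum>j\<in>J. c j * h j k p) k e p =
    (\<Sum>j\<in>J. c j * drive (u j) (h j) k e p)"
proof -
  have "(\<Sum>l<t. B k e l * (\<Sum>j\<in>J. c j * u j l p)) = (\<Sum>j\<in>J. \<Sum>l<t. c j * (B k e l * u j l p))"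
    unfolding sum_distrib_left by (subst sum.swap) (simp add: mult_ac)
  moreover have "(\<Sum>k'\<in>K. A k e k' * (\<Sum>j\<in>J. c j * h j k' p)) = (\<Sum>j\<in>J. \<Sum>k'\<in>K. c j * (A k e k' * h j k' p))"
    unfolding sum_distrib_left by (subst sum.swap) (simp add: mult_ac)
  ultimately show ?thesis
    by (simp add: drive_def distrib_left sum.distrib sum_distrib_left)
qed

lemma response_combination:
  "response (\<lambda>l p. \<Sum>j\<in>J. c j * u j l p) (\<lambda>k p. \<Sum>j\<in>J. c j * h j k p) i p =
    (\<Sum>j\<in>J. c j * response (u j) (h j) i p)"
proof -
  have "(\<Sum>l<t. D i l * (\<Sum>j\<in>J. c j * u j l p)) = (\<Sum>j\<in>J. \<Sum>l<t. c j * (D i l * u j l p))"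
    unfolding sum_distrib_left by (subst sum.swap) (simp add: mult_ac)
  moreover have "(\<Sum>k\<in>K. C i k * (\<Sum>j\<in>J. c j * h j k p)) = (\<Sum>j\<in>J. \<Sum>k\<in>K. c j * (C i k * h j k p))"
    unfolding sum_distrib_left by (subst sum.swap) (simp add: mult_ac)
  ultimately show ?thesis
    by (simp add: response_def distrib_left sum.distrib sum_distrib_left)
qed

lemma state_combination:
  assumes "\<And>j. j \<in> J \<Longrightarrow> state m W (u j) (h j)"
  shows "state m W (\<lambda>l p. \<Sum>j\<in>J. c j * u j l p) (\<lambda>k p. \<Sum>j\<in>J. c j * h j k p)"
  unfolding state_def
proof (intro ballI allI impI)
  fix k p assume "k \<in> K" "p < m"
  let ?f = "\<lambda>e r j. W ! e $$ (p, r) * (c j * drive (u j) (h j) k e r)"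
  have "(\<Sum>j\<in>J. c j * h j k p) = (\<Sum>j\<in>J. \<Sum>e<d. \<Sum>r<m. ?f e r j)"
    using assms \<open>k \<in> K\<close> \<open>p < m\<close> by (intro sum.cong) (auto simp: state_def sum_distrib_left mult_ac)
  also have "\<dots> = (\<Sum>e<d. \<Sum>j\<in>J. \<Sum>r<m. ?f e r j)"
    by (rule sum.swap)
  also have "\<dots> = (\<Sum>e<d. \<Sum>r<m. \<Sum>j\<in>J. ?f e r j)"
    by (intro sum.cong refl sum.swap)
  finally show "(\<Sum>j\<in>J. c j * h j k p) = (\<Sum>e<d. \<Sum>r<m. W ! e $$ (p, r) *
      drive (\<lambda>l p. \<Sum>j\<in>J. c j * u j l p) (\<lambda>k p. \<Sum>j\<in>J. c j * h j k p) k e r)"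
    by (simp add: drive_combination sum_distrib_left)
qed

text \<open>The coefficients of the realization act on other indices than \<Gamma> and commute with
  it; only the multiplication by the tuple has to be exchanged, and this is the intertwining
  relation.\<close>

lemma state_intertwine:
  assumes "intertwines d m m' W Z \<Gamma>" "state m' Z u h"
  shows "state m W (\<lambda>l p. \<Sum>q<m'. \<Gamma> p q * u l q) (\<lambda>k p. \<Sum>q<m'. \<Gamma> p q * h k q)"
  unfolding state_def
proof (intro ballI allI impI)
  fix k p assume "k \<in> K" "p < m"
  have drive: "drive (\<lambda>l p. \<Sum>q<m'. \<Gamma> p q * u l q) (\<lambda>k p. \<Sum>q<m'. \<Gamma> p q * h k q) k e r =
      (\<Sum>q<m'. \<Gamma> r q * drive u h k e q)" for e r
  proof -
    have "(\<Sum>l<t. B k e l * (\<Sum>q<m'. \<Gamma> r q * u l q)) = (\<Sum>q<m'. \<Sum>l<t. \<Gamma> r q * (B k e l * u l q))"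
      unfolding sum_distrib_left by (subst sum.swap) (simp add: mult_ac)
    moreover have "(\<Sum>k'\<in>K. A k e k' * (\<Sum>q<m'. \<Gamma> r q * h k' q)) = (\<Sum>q<m'. \<Sum>k'\<in>K. \<Gamma> r q * (A k e k' * h k' q))"
      unfolding sum_distrib_left by (subst sum.swap) (simp add: mult_ac)
    ultimately show ?thesis
      by (simp add: drive_def distrib_left sum.distrib sum_distrib_left)
  qed
  have "(\<Sum>q<m'. \<Gamma> p q * h k q) = (\<Sum>q<m'. \<Sum>e<d. \<Sum>r<m'. \<Gamma> p q * Z ! e $$ (q, r) * drive u h k e r)"
    using assms(2) \<open>k \<in> K\<close> by (intro sum.cong) (auto simp: state_def sum_distrib_left mult_ac)
  also have "\<dots> = (\<Sum>e<d. \<Sum>q<m'. \<Sum>r<m'. \<Gamma> p q * Z ! e $$ (q, r) * drive u h k e r)"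
    by (rule sum.swap)
  also have "\<dots> = (\<Sum>e<d. \<Sum>r<m'. \<Sum>q<m'. \<Gamma> p q * Z ! e $$ (q, r) * drive u h k e r)"
    by (intro sum.cong refl sum.swap)
  also have "\<dots> = (\<Sum>e<d. \<Sum>r<m'. \<Sum>q<m. W ! e $$ (p, q) * \<Gamma> q r * drive u h k e r)"
    using assms(1) \<open>p < m\<close> by (simp add: intertwines_def flip: sum_distrib_right)
  also have "\<dots> = (\<Sum>e<d. \<Sum>q<m. \<Sum>r<m'. W ! e $$ (p, q) * \<Gamma> q r * drive u h k e r)"
    by (intro sum.cong refl sum.swap)
  finally show "(\<Sum>q<m'. \<Gamma> p q * h k q) = (\<Sum>e<d. \<Sum>r<m. W ! e $$ (p, r) *
      drive (\<lambda>l p. \<Sum>q<m'. \<Gamma> p q * u l q) (\<lambda>k p. \<Sum>q<m'. \<Gamma> p q * h k q) k e r)"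
    by (simp add: drive sum_distrib_left mult.assoc)
qed

text \<open>Energy balance: the state has at most the energy of the drive \<open>g\<close>, and output and drive together
  have at most the energy of input and state.\<close>

lemma state_energy:
  assumes W: "row_contraction d m W" and st: "state m W u h"
  shows "(\<Sum>i<s. \<Sum>p<m. (cmod (response u h i p))\<^sup>2) \<le> (\<Sum>l<t. \<Sum>p<m. (cmod (u l p))\<^sup>2)"
    and "(\<And>l p. l < t \<Longrightarrow> p < m \<Longrightarrow> u l p = 0) \<Longrightarrow> k \<in> K \<Longrightarrow> p < m \<Longrightarrow> h k p = 0"
proof -
  obtain q where q: "0 \<le> q" "q < 1" and
    row: "\<And>g. (\<Sum>p<m. (cmod (\<Sum>e<d. \<Sum>r<m. W ! e $$ (p, r) * g e r))\<^sup>2) \<le>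
      q * (\<Sum>e<d. \<Sum>r<m. (cmod (g e r))\<^sup>2)"
    using W unfolding row_contraction_def by blast
  define Eh where "Eh = (\<Sum>k\<in>K. \<Sum>p<m. (cmod (h k p))\<^sup>2)"
  define Eg where "Eg = (\<Sum>k\<in>K. \<Sum>e<d. \<Sum>p<m. (cmod (drive u h k e p))\<^sup>2)"
  define Eu where "Eu = (\<Sum>l<t. \<Sum>p<m. (cmod (u l p))\<^sup>2)"
  define Ey where "Ey = (\<Sum>i<s. \<Sum>p<m. (cmod (response u h i p))\<^sup>2)"
  have "Eh \<le> (\<Sum>k\<in>K. q * (\<Sum>e<d. \<Sum>p<m. (cmod (drive u h k e p))\<^sup>2))"
    unfolding Eh_def
  proof (rule sum_mono)
    fix k assume "k \<in> K"
    then have "(\<Sum>p<m. (cmod (h k p))\<^sup>2) =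
        (\<Sum>p<m. (cmod (\<Sum>e<d. \<Sum>r<m. W ! e $$ (p, r) * drive u h k e r))\<^sup>2)"
      using st by (intro sum.cong) (auto simp: state_def)
    then show "(\<Sum>p<m. (cmod (h k p))\<^sup>2) \<le> q * (\<Sum>e<d. \<Sum>p<m. (cmod (drive u h k e p))\<^sup>2)"
      using row[of "drive u h k"] by simp
  qed
  then have h_g: "Eh \<le> q * Eg" by (simp add: Eg_def sum_distrib_left)
  have nn: "0 \<le> Eg" "0 \<le> Eh" "0 \<le> Ey" unfolding Eg_def Eh_def Ey_def by (intro sum_nonneg; simp)+
  have "(\<Sum>p<m. (\<Sum>i<s. (cmod (response u h i p))\<^sup>2) + (\<Sum>k\<in>K. \<Sum>e<d. (cmod (drive u h k e p))\<^sup>2)) \<le>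
      (\<Sum>p<m. (\<Sum>l<t. (cmod (u l p))\<^sup>2) + (\<Sum>k\<in>K. (cmod (h k p))\<^sup>2))"
    unfolding response_def drive_def by (intro sum_mono contraction)
  also have "(\<Sum>p<m. (\<Sum>i<s. (cmod (response u h i p))\<^sup>2) + (\<Sum>k\<in>K. \<Sum>e<d. (cmod (drive u h k e p))\<^sup>2)) = Ey + Eg"
  proof -
    have "(\<Sum>p<m. \<Sum>i<s. (cmod (response u h i p))\<^sup>2) = Ey" unfolding Ey_def by (rule sum.swap)
    moreover have "(\<Sum>p<m. \<Sum>k\<in>K. \<Sum>e<d. (cmod (drive u h k e p))\<^sup>2) = Eg"
      unfolding Eg_def by (subst sum.swap, intro sum.cong refl sum.swap)
    ultimately show ?thesis by (simp add: sum.distrib)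
  qed
  also have "(\<Sum>p<m. (\<Sum>l<t. (cmod (u l p))\<^sup>2) + (\<Sum>k\<in>K. (cmod (h k p))\<^sup>2)) = Eu + Eh"
  proof -
    have "(\<Sum>p<m. \<Sum>l<t. (cmod (u l p))\<^sup>2) = Eu" unfolding Eu_def by (rule sum.swap)
    moreover have "(\<Sum>p<m. \<Sum>k\<in>K. (cmod (h k p))\<^sup>2) = Eh" unfolding Eh_def by (rule sum.swap)
    ultimately show ?thesis by (simp add: sum.distrib)
  qed
  finally have bal: "Ey + Eg \<le> Eu + Eh" .
  have "q * Eg \<le> 1 * Eg" using q nn by (intro mult_right_mono) auto
  then have "Ey \<le> Eu" using bal h_g by linarith
  then show "(\<Sum>i<s. \<Sum>p<m. (cmod (response u h i p))\<^sup>2) \<le> (\<Sum>l<t. \<Sum>p<m. (cmod (u l p))\<^sup>2)"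
    by (simp add: Ey_def Eu_def)
  assume u: "\<And>l p. l < t \<Longrightarrow> p < m \<Longrightarrow> u l p = 0" and kp: "k \<in> K" "p < m"
  have "Eu = 0" using u by (simp add: Eu_def)
  \<comment> \<open>Without input the drive has at most the energy of the state, which has at most q
    times the energy of the drive; q < 1 leaves only zero.\<close>
  then have "Eg \<le> q * Eg" using bal h_g nn by linarith
  then have "(1 - q) * Eg \<le> 0" by (simp add: algebra_simps)
  then have "Eg \<le> 0" using q by (simp add: mult_le_0_iff)
  then have "Eh \<le> 0" using h_g nn by simp
  then have "Eh = 0" using nn by simp
  then have "(\<Sum>p<m. (cmod (h k p))\<^sup>2) = 0"
    unfolding Eh_def using fin kp by (subst (asm) sum_nonneg_eq_0_iff) (auto intro: sum_nonneg)
  then have "(cmod (h k p))\<^sup>2 = 0" using kp by (subst (asm) sum_nonneg_eq_0_iff) auto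
  then show "h k p = 0" by simp
qed

lemma state_unique:
  assumes W: "row_contraction d m W" and "state m W u h" "state m W u' h'"
    and eq: "\<And>l p. l < t \<Longrightarrow> p < m \<Longrightarrow> u l p = u' l p" and kp: "k \<in> K" "p < m"
  shows "h k p = h' k p"
proof -
  define c where "c b = (if b then 1 else -1 :: complex)" for b
  define uu where "uu b = (if b then u else u')" for b
  define hh where "hh b = (if b then h else h')" for b
  have "state m W (\<lambda>l p. \<Sum>b\<in>UNIV. c b * uu b l p) (\<lambda>k p. \<Sum>b\<in>UNIV. c b * hh b k p)"
    by (rule state_combination) (use assms in \<open>auto simp: uu_def hh_def\<close>)
  then have "(\<Sum>b\<in>UNIV. c b * hh b k p) = 0"
    by (rule state_energy(2)[OF W]) (use eq kp in \<open>auto simp: UNIV_bool c_def uu_def\<close>)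
  then show ?thesis by (simp add: UNIV_bool c_def hh_def)
qed

text \<open>The energy estimate for zero input says that 1 - Z A is injective; in finite dimension
  it is then invertible.\<close>

lemma state_exists:
  assumes W: "row_contraction d m W"
  shows "\<exists>h. state m W u h"
proof -
  let ?I = "K \<times> {..<m}"
  define M where "M = (\<lambda>x y. kdelta x y - (\<Sum>e<d. W ! e $$ (snd x, snd y) * A (fst x) e (fst y)))"
  have finI: "finite ?I" using fin by simp
  have M: "app_on ?I M v (k, p) = v (k, p) -
      (\<Sum>e<d. \<Sum>r<m. W ! e $$ (p, r) * (\<Sum>k'\<in>K. A k e k' * v (k', r)))" if "k \<in> K" "p < m" for v k p
  proof -
    have "app_on ?I M v (k, p) = app_on ?I kdelta v (k, p) -
        (\<Sum>y\<in>?I. \<Sum>e<d. W ! e $$ (p, snd y) * A k e (fst y) * v y)"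
      by (simp add: app_on_def M_def left_diff_distrib sum_subtractf sum_distrib_right)
    also have "app_on ?I kdelta v (k, p) = v (k, p)" using that finI by (intro app_on_kdelta) auto
    also have "(\<Sum>y\<in>?I. \<Sum>e<d. W ! e $$ (p, snd y) * A k e (fst y) * v y) =
        (\<Sum>e<d. \<Sum>y\<in>?I. W ! e $$ (p, snd y) * A k e (fst y) * v y)" by (rule sum.swap)
    also have "\<dots> = (\<Sum>e<d. \<Sum>k'\<in>K. \<Sum>r<m. W ! e $$ (p, r) * A k e k' * v (k', r))"
      by (simp add: sum.cartesian_product case_prod_unfold)
    also have "\<dots> = (\<Sum>e<d. \<Sum>r<m. \<Sum>k'\<in>K. W ! e $$ (p, r) * A k e k' * v (k', r))"
      by (intro sum.cong refl sum.swap)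
    finally show ?thesis by (simp add: sum_distrib_left mult.assoc)
  qed
  have inj: "v x = 0" if z: "\<And>x. x \<in> ?I \<Longrightarrow> app_on ?I M v x = 0" and x: "x \<in> ?I" for v x
  proof -
    have "state m W (\<lambda>_ _. 0) (\<lambda>k p. v (k, p))"
      unfolding state_def
    proof (intro ballI allI impI)
      fix k p assume kp: "k \<in> K" "p < m"
      have "app_on ?I M v (k, p) = 0" by (rule z) (use kp in auto)
      then show "v (k, p) = (\<Sum>e<d. \<Sum>r<m. W ! e $$ (p, r) * drive (\<lambda>_ _. 0) (\<lambda>k p. v (k, p)) k e r)"
        unfolding M[OF kp] drive_def by simp
    qed
    from state_energy(2)[OF W this, of "fst x" "snd x"] show ?thesis using x by auto
  qed
  obtain R where R: "\<And>x y. x \<in> ?I \<Longrightarrow> y \<in> ?I \<Longrightarrow> mult_on ?I M R x y = kdelta x y"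
    by (rule finite_linear_inverse[OF finI, of M]) (use inj in blast)+
  define b where "b x = (\<Sum>e<d. \<Sum>r<m. W ! e $$ (snd x, r) * (\<Sum>l<t. B (fst x) e l * u l r))" for x
  define v where "v = app_on ?I R b"
  have "state m W u (\<lambda>k p. v (k, p))"
    unfolding state_def
  proof (intro ballI allI impI)
    fix k p assume kp: "k \<in> K" "p < m"
    have "app_on ?I M v (k, p) = b (k, p)"
      unfolding v_def by (rule app_on_mult_kdelta[OF finI R]) (use kp in auto)
    then show "v (k, p) = (\<Sum>e<d. \<Sum>r<m. W ! e $$ (p, r) * drive u (\<lambda>k p. v (k, p)) k e r)"
      unfolding M[OF kp] b_def drive_def
      by (simp add: distrib_left sum.distrib) (simp add: algebra_simps)
  qed
  then show ?thesis by blast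
qed

definition unit_state :: "nat \<Rightarrow> mat_tuple \<Rightarrow> nat \<Rightarrow> nat \<Rightarrow> 'k \<Rightarrow> nat \<Rightarrow> complex" where
  "unit_state m W l q = (SOME h. state m W (\<lambda>l' p. kdelta l' l * kdelta p q) h)"

text \<open>Column q of the block (i, l) is the output i for the unit input at (l, q). The level m
  is not an argument and is read off the first matrix of the tuple, which exists because d >
  0.\<close>

definition transfer :: "complex \<Rightarrow> nat \<Rightarrow> nat \<Rightarrow> mat_tuple \<Rightarrow> complex mat" where
  "transfer c i l W = (let m = dim_row (W ! 0) in mat m m
    (\<lambda>(p, q). c * response (\<lambda>l' p. kdelta l' l * kdelta p q) (unit_state m W l q) i p))"

lemma unit_state: "row_contraction d m W \<Longrightarrow> state m W (\<lambda>l' p. kdelta l' l * kdelta p q) (unit_state m W l q)"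
  unfolding unit_state_def by (rule someI_ex[OF state_exists])

lemma row_contraction_dim: "row_contraction d m W \<Longrightarrow> e < d \<Longrightarrow> W ! e \<in> carrier_mat m m"
  by (auto simp: row_contraction_def mat_tuples_def)

lemma transfer_carrier: "row_contraction d m W \<Longrightarrow> transfer c i l W \<in> carrier_mat m m"
  using row_contraction_dim[of m W 0] d_pos by (auto simp: transfer_def Let_def)

lemma response_cong:
  "(\<And>l. l < t \<Longrightarrow> u l p = u' l p) \<Longrightarrow> (\<And>k. k \<in> K \<Longrightarrow> h k p = h' k p) \<Longrightarrow> response u h i p = response u' h' i p"
  by (simp add: response_def)

text \<open>Superposing the unit states gives a state for the input u, and uniqueness identifies it
  with the given h.\<close>

lemma transfer_apply:
  assumes W: "row_contraction d m W" and "state m W u h" "p < m"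
  shows "(\<Sum>l<t. \<Sum>q<m. transfer c i l W $$ (p, q) * u l q) = c * response u h i p"
proof -
  have dim: "dim_row (W ! 0) = m" using row_contraction_dim[OF W d_pos] by simp
  let ?J = "{..<t} \<times> {..<m}"
  define uu where "uu j = (\<lambda>l' p. kdelta l' (fst j) * kdelta p (snd j) :: complex)" for j :: "nat \<times> nat"
  define hh where "hh j = unit_state m W (fst j) (snd j)" for j
  define w where "w j = u (fst j) (snd j)" for j
  have st: "state m W (\<lambda>l p. \<Sum>j\<in>?J. w j * uu j l p) (\<lambda>k p. \<Sum>j\<in>?J. w j * hh j k p)"
    unfolding uu_def hh_def by (intro state_combination unit_state W)
  have u: "(\<Sum>j\<in>?J. w j * uu j l p) = u l p" if "l < t" "p < m" for l p
  proof -
    have "(\<Sum>j\<in>?J. w j * uu j l p) = (\<Sum>j\<in>?J. if j = (l, p) then w j else 0)"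
      by (intro sum.cong) (auto simp: uu_def kdelta_def)
    then show ?thesis using that by (simp add: w_def)
  qed
  have h: "(\<Sum>j\<in>?J. w j * hh j k p) = h k p" if "k \<in> K" "p < m" for k p
    by (rule state_unique[OF W st assms(2) u that])
  have "(\<Sum>l<t. \<Sum>q<m. transfer c i l W $$ (p, q) * u l q) =
      (\<Sum>j\<in>?J. c * (w j * response (uu j) (hh j) i p))"
    unfolding sum.cartesian_product
    using assms(3) by (intro sum.cong) (auto simp: transfer_def Let_def dim w_def uu_def hh_def)
  also have "\<dots> = c * response (\<lambda>l p. \<Sum>j\<in>?J. w j * uu j l p) (\<lambda>k p. \<Sum>j\<in>?J. w j * hh j k p) i p"
    by (simp only: response_combination sum_distrib_left)
  also have "\<dots> = c * response u h i p"
    using u h assms(3) by (subst response_cong) auto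
  finally show ?thesis .
qed

lemma transfer_bound:
  assumes W: "row_contraction d m W"
  shows "(\<Sum>i<s. \<Sum>p<m. (cmod (\<Sum>l<t. \<Sum>q<m. transfer c i l W $$ (p, q) * u l q))\<^sup>2) \<le>
    (cmod c)\<^sup>2 * (\<Sum>l<t. \<Sum>q<m. (cmod (u l q))\<^sup>2)"
proof -
  obtain h where h: "state m W u h" using state_exists[OF W] by blast
  have "(\<Sum>i<s. \<Sum>p<m. (cmod (\<Sum>l<t. \<Sum>q<m. transfer c i l W $$ (p, q) * u l q))\<^sup>2) =
      (\<Sum>i<s. \<Sum>p<m. (cmod c)\<^sup>2 * (cmod (response u h i p))\<^sup>2)"
    by (intro sum.cong) (auto simp: transfer_apply[OF W h] norm_mult power_mult_distrib)
  also have "\<dots> = (cmod c)\<^sup>2 * (\<Sum>i<s. \<Sum>p<m. (cmod (response u h i p))\<^sup>2)"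
    by (simp only: sum_distrib_left)
  also have "\<dots> \<le> (cmod c)\<^sup>2 * (\<Sum>l<t. \<Sum>q<m. (cmod (u l q))\<^sup>2)"
    using state_energy(1)[OF W h] by (rule mult_left_mono) simp
  finally show ?thesis .
qed

text \<open>\<Gamma> pushes the unit state of Z forward to a state of W with input \<Gamma> u. Its
  output is computed once by \<open>transfer_apply\<close> for W and once by moving \<Gamma> out of
  \<open>response\<close>.\<close>

lemma transfer_intertwine:
  assumes W: "row_contraction d m W" and Z: "row_contraction d m' Z"
    and \<Gamma>: "intertwines d m m' W Z \<Gamma>" and "p < m" "q < m'" "l < t"
  shows "(\<Sum>r<m. transfer c i l W $$ (p, r) * \<Gamma> r q) = (\<Sum>r<m'. \<Gamma> p r * transfer c i l Z $$ (r, q))"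
proof -
  have dim: "dim_row (Z ! 0) = m'" using row_contraction_dim[OF Z d_pos] by simp
  define u :: "nat \<Rightarrow> nat \<Rightarrow> complex" where "u = (\<lambda>l' p. kdelta l' l * kdelta p q)"
  define h where "h = unit_state m' Z l q"
  have h: "state m' Z u h" unfolding u_def h_def by (rule unit_state[OF Z])
  have "(\<Sum>l'<t. \<Sum>r<m. transfer c i l' W $$ (p, r) * (\<Sum>q'<m'. \<Gamma> r q' * u l' q')) =
      c * response (\<lambda>l p. \<Sum>q'<m'. \<Gamma> p q' * u l q') (\<lambda>k p. \<Sum>q'<m'. \<Gamma> p q' * h k q') i p"
    by (rule transfer_apply[OF W state_intertwine[OF \<Gamma> h] \<open>p < m\<close>])
  also have "(\<Sum>l'<t. \<Sum>r<m. transfer c i l' W $$ (p, r) * (\<Sum>q'<m'. \<Gamma> r q' * u l' q')) =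
      (\<Sum>l'<t. if l' = l then \<Sum>r<m. transfer c i l' W $$ (p, r) * \<Gamma> r q else 0)"
  proof (intro sum.cong refl)
    fix l'
    have "(\<Sum>q'<m'. \<Gamma> r q' * u l' q') = (if l' = l then \<Gamma> r q else 0)" for r
      using \<open>q < m'\<close> by (simp add: u_def kdelta_def if_distrib[of "\<lambda>z. _ * z"] cong: if_cong)
    then show "(\<Sum>r<m. transfer c i l' W $$ (p, r) * (\<Sum>q'<m'. \<Gamma> r q' * u l' q')) =
        (if l' = l then \<Sum>r<m. transfer c i l' W $$ (p, r) * \<Gamma> r q else 0)" by simp
  qed
  also have "\<dots> = (\<Sum>r<m. transfer c i l W $$ (p, r) * \<Gamma> r q)" using \<open>l < t\<close> by simp
  also have "response (\<lambda>l p. \<Sum>q'<m'. \<Gamma> p q' * u l q') (\<lambda>k p. \<Sum>q'<m'. \<Gamma> p q' * h k q') i p =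
      (\<Sum>q'<m'. \<Gamma> p q' * response u h i q')"
  proof -
    have "(\<Sum>l<t. D i l * (\<Sum>q'<m'. \<Gamma> p q' * u l q')) = (\<Sum>q'<m'. \<Sum>l<t. \<Gamma> p q' * (D i l * u l q'))"
      unfolding sum_distrib_left by (subst sum.swap) (simp add: mult_ac)
    moreover have "(\<Sum>k\<in>K. C i k * (\<Sum>q'<m'. \<Gamma> p q' * h k q')) = (\<Sum>q'<m'. \<Sum>k\<in>K. \<Gamma> p q' * (C i k * h k q'))"
      unfolding sum_distrib_left by (subst sum.swap) (simp add: mult_ac)
    ultimately show ?thesis
      by (simp add: response_def distrib_left sum.distrib sum_distrib_left)
  qed
  also have "c * (\<Sum>q'<m'. \<Gamma> p q' * response u h i q') = (\<Sum>r<m'. \<Gamma> p r * transfer c i l Z $$ (r, q))"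
    using \<open>q < m'\<close> by (simp add: transfer_def Let_def dim u_def h_def sum_distrib_left mult_ac)
  finally show ?thesis .
qed

end

section \<open>Operator norms and the row ball\<close>

lemma cvec_norm_eq: "cvec_norm v = norm_on {..<dim_vec v} (\<lambda>i. v $ i)"
  by (simp add: cvec_norm_def L2_set_def norm_on_def norm2_on_def)

lemma cvec_norm_vec: "v \<in> carrier_vec b \<Longrightarrow> cvec_norm v = norm_on {..<b} (\<lambda>i. v $ i)"
  by (simp add: cvec_norm_eq)

lemma cvec_norm_mult_vec:
  assumes "A \<in> carrier_mat a b" "v \<in> carrier_vec b"
  shows "cvec_norm (A *\<^sub>v v) = norm_on {..<a} (app_on {..<b} (entries A) (\<lambda>i. v $ i))"
proof -
  have "norm2_on {..<a} (\<lambda>i. (A *\<^sub>v v) $ i) = norm2_on {..<a} (app_on {..<b} (entries A) (\<lambda>i. v $ i))"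
    using assms by (intro norm2_on_cong) (auto simp: app_on_def entries_def scalar_prod_def lessThan_atLeast0)
  then show ?thesis using assms by (simp add: cvec_norm_eq norm_on_def)
qed

lemma norm_on_app_frobenius:
  assumes "finite J"
  shows "norm_on I (app_on J A x) \<le> sqrt (\<Sum>i\<in>I. \<Sum>j\<in>J. (cmod (A i j))\<^sup>2) * norm_on J x"
proof -
  have "(cmod (app_on J A x i))\<^sup>2 \<le> (\<Sum>j\<in>J. (cmod (A i j))\<^sup>2) * norm2_on J x" for i
  proof -
    have "app_on J A x i = inner_on J (A i) (\<lambda>j. cnj (x j))" by (simp add: app_on_def inner_on_def)
    then show ?thesis
      using cauchy_schwarz_on[OF assms, of "A i" "\<lambda>j. cnj (x j)"] by (simp add: norm2_on_def)
  qed
  then have "norm2_on I (app_on J A x) \<le> (\<Sum>i\<in>I. \<Sum>j\<in>J. (cmod (A i j))\<^sup>2) * norm2_on J x"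
    unfolding norm2_on_def[of I] sum_distrib_right by (rule sum_mono)
  then show ?thesis unfolding norm_on_def real_sqrt_mult[symmetric] by (rule real_sqrt_le_mono)
qed

text \<open>A supremum of reals is only usable once the set is known to be bounded; the Frobenius
  norm provides the bound, and the zero vector gives nonnegativity.\<close>

lemma op_norm_bound:
  assumes "A \<in> carrier_mat a b" "v \<in> carrier_vec b"
  shows "cvec_norm (A *\<^sub>v v) \<le> op_norm A * cvec_norm v" "0 \<le> op_norm A"
proof -
  let ?S = "{v \<in> carrier_vec b. cvec_norm v \<le> 1}"
  define M where "M = sqrt (\<Sum>i<a. \<Sum>j<b. (cmod (entries A i j))\<^sup>2)"
  have M: "0 \<le> M" by (simp add: M_def sum_nonneg)
  have "cvec_norm (A *\<^sub>v w) \<le> M" if "w \<in> ?S" for w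
  proof -
    have "cvec_norm (A *\<^sub>v w) \<le> M * cvec_norm w"
      using norm_on_app_frobenius[of "{..<b}" "{..<a}" "entries A" "\<lambda>i. w $ i"] that
        cvec_norm_mult_vec[OF assms(1), of w] cvec_norm_vec[of w b]
      by (simp add: M_def)
    also have "\<dots> \<le> M * 1" using that M by (intro mult_left_mono) auto
    finally show ?thesis by simp
  qed
  then have bdd: "bdd_above ((\<lambda>w. cvec_norm (A *\<^sub>v w)) ` ?S)" by (auto intro!: bdd_aboveI)
  have op: "op_norm A = (SUP w\<in>?S. cvec_norm (A *\<^sub>v w))"
    using assms(1) by (simp add: op_norm_def)
  have upper: "cvec_norm (A *\<^sub>v w) \<le> op_norm A" if "w \<in> ?S" for w
    unfolding op using that bdd by (rule cSUP_upper)
  have "0\<^sub>v b \<in> ?S" by (simp add: cvec_norm_eq norm_on_def norm2_on_def)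
  from order.trans[OF _ upper[OF this]] show "0 \<le> op_norm A" by (simp add: cvec_norm_eq)
  show "cvec_norm (A *\<^sub>v v) \<le> op_norm A * cvec_norm v"
  proof (cases "cvec_norm v = 0")
    case True
    then have "norm2_on {..<b} (\<lambda>i. v $ i) = 0" using assms(2) by (simp add: cvec_norm_eq norm_on_def)
    then have "norm_on {..<a} (app_on {..<b} (entries A) (\<lambda>i. v $ i)) = 0"
      by (simp add: norm_on_def norm2_on_eq_0) (simp add: app_on_def)
    then show ?thesis using True by (simp add: cvec_norm_mult_vec[OF assms])
  next
    case False
    define N where "N = cvec_norm v"
    have N: "0 < N" using False by (simp add: N_def cvec_norm_eq order_less_le)
    define w where "w = complex_of_real (1 / N) \<cdot>\<^sub>v v"
    have w: "w \<in> carrier_vec b" using assms by (simp add: w_def)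
    have idx: "norm_on {..<b} (\<lambda>i. w $ i) = norm_on {..<b} (\<lambda>i. complex_of_real (1 / N) * v $ i)"
      using assms(2) by (auto simp: norm_on_def w_def intro!: norm2_on_cong)
    have "cvec_norm w = 1"
      using assms(2) w idx N by (simp add: cvec_norm_eq norm_on_scale N_def del: of_real_divide)
    then have "cvec_norm (A *\<^sub>v w) \<le> op_norm A" using w by (intro upper) auto
    moreover have "app_on {..<b} (entries A) (\<lambda>i. w $ i) = app_on {..<b} (entries A) (\<lambda>i. complex_of_real (1 / N) * v $ i)"
      using assms(2) by (intro app_on_cong) (auto simp: w_def)
    ultimately have "1 / N * cvec_norm (A *\<^sub>v v) \<le> op_norm A"
      using N by (simp add: cvec_norm_mult_vec[OF assms(1)] w assms(2) app_on_scale norm_on_scale norm_divide del: of_real_divide)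
    then show ?thesis using N by (simp add: N_def field_simps)
  qed
qed

lemma op_norm_app_bound:
  assumes "A \<in> carrier_mat a b"
  shows "norm_on {..<a} (app_on {..<b} (entries A) x) \<le> op_norm A * norm_on {..<b} x"
proof -
  have "norm_on {..<b} (\<lambda>i. vec b x $ i) = norm_on {..<b} x"
    unfolding norm_on_def by (intro arg_cong[where f = sqrt] norm2_on_cong) simp
  moreover have "app_on {..<b} (entries A) (\<lambda>i. vec b x $ i) = app_on {..<b} (entries A) x"
    by (rule app_on_cong) simp
  ultimately show ?thesis
    using op_norm_bound(1)[OF assms, of "vec b x"] cvec_norm_mult_vec[OF assms, of "vec b x"]
      cvec_norm_vec[of "vec b x" b] by simp
qed

lemma op_norm_leI:
  assumes A: "A \<in> carrier_mat a b" and c: "0 \<le> c"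
    and le: "\<And>x. norm_on {..<a} (app_on {..<b} (entries A) x) \<le> c * norm_on {..<b} x"
  shows "op_norm A \<le> c"
  unfolding op_norm_def
proof (rule cSUP_least)
  have "0\<^sub>v (dim_col A) \<in> {v \<in> carrier_vec (dim_col A). cvec_norm v \<le> 1}"
    by (simp add: cvec_norm_eq norm_on_def norm2_on_def)
  then show "{v \<in> carrier_vec (dim_col A). cvec_norm v \<le> 1} \<noteq> {}" by blast
  fix v assume "v \<in> {v \<in> carrier_vec (dim_col A). cvec_norm v \<le> 1}"
  then have v: "v \<in> carrier_vec b" "cvec_norm v \<le> 1" using A by auto
  have "cvec_norm (A *\<^sub>v v) \<le> c * cvec_norm v"
    using le[of "\<lambda>i. v $ i"] cvec_norm_mult_vec[OF A v(1)] cvec_norm_vec[OF v(1)] by simp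
  also have "\<dots> \<le> c * 1" using v c by (intro mult_left_mono) auto
  finally show "cvec_norm (A *\<^sub>v v) \<le> c" by simp
qed

lemma norm_on_le_iff: "0 \<le> c \<Longrightarrow> norm_on I x \<le> c * norm_on J y \<longleftrightarrow> norm2_on I x \<le> c\<^sup>2 * norm2_on J y"
proof -
  assume "0 \<le> c"
  then have "c * norm_on J y = sqrt (c\<^sup>2 * norm2_on J y)" by (simp add: norm_on_def real_sqrt_mult)
  then show ?thesis by (simp add: norm_on_def)
qed

lemma block_mat_carrier: "block_mat s t m Y \<in> carrier_mat (s * m) (t * m)"
  by (simp add: block_mat_def)

lemma norm2_on_block_mat:
  "norm2_on {..<s * m} (app_on {..<t * m} (entries (block_mat s t m Y)) x) =
    (\<Sum>i<s. \<Sum>p<m. (cmod (\<Sum>l<t. \<Sum>q<m. Y i l $$ (p, q) * x (l * m + q)))\<^sup>2)"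
  unfolding norm2_on_def app_on_def sum_lessThan_mult
  by (intro sum.cong refl arg_cong[where f = "\<lambda>z. (cmod z)\<^sup>2"])
     (simp add: entries_def block_mat_def mult_add_less)

lemma op_norm_block_leI:
  assumes "0 \<le> c" and "\<And>u. (\<Sum>i<s. \<Sum>p<m. (cmod (\<Sum>l<t. \<Sum>q<m. Y i l $$ (p, q) * u l q))\<^sup>2) \<le>
    c\<^sup>2 * (\<Sum>l<t. \<Sum>q<m. (cmod (u l q))\<^sup>2)"
  shows "op_norm (block_mat s t m Y) \<le> c"
proof (rule op_norm_leI[OF block_mat_carrier assms(1)])
  fix x
  show "norm_on {..<s * m} (app_on {..<t * m} (entries (block_mat s t m Y)) x) \<le> c * norm_on {..<t * m} x"
    unfolding norm_on_le_iff[OF assms(1)] norm2_on_block_mat norm2_on_def[of "{..<t * m}"] sum_lessThan_mult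
    by (rule assms(2))
qed

lemma block_mat_bound:
  "(\<Sum>i<s. \<Sum>p<m. (cmod (\<Sum>l<t. \<Sum>q<m. Y i l $$ (p, q) * u l q))\<^sup>2) \<le>
    (op_norm (block_mat s t m Y))\<^sup>2 * (\<Sum>l<t. \<Sum>q<m. (cmod (u l q))\<^sup>2)"
proof -
  let ?x = "\<lambda>k. u (k div m) (k mod m)"
  have nn: "0 \<le> op_norm (block_mat s t m Y)"
    by (rule op_norm_bound(2)[OF block_mat_carrier, of "0\<^sub>v (t * m)"]) simp
  have "norm2_on {..<s * m} (app_on {..<t * m} (entries (block_mat s t m Y)) ?x) \<le>
      (op_norm (block_mat s t m Y))\<^sup>2 * norm2_on {..<t * m} ?x"
    using op_norm_app_bound[OF block_mat_carrier[of s t m Y], of ?x] unfolding norm_on_le_iff[OF nn] .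
  then show ?thesis
    unfolding norm2_on_block_mat unfolding norm2_on_def sum_lessThan_mult by simp
qed

text \<open>\<open>row_square\<close> is R R^* for the row operator R, so its norm q bounds the
  squared norm of R^*, and \<open>app_on_adj_bound\<close> passes this to R.\<close>

lemma row_ball_contraction:
  assumes W: "W \<in> row_ball d m"
  shows "row_contraction d m W"
proof -
  have tup: "W \<in> mat_tuples d m" and lt: "op_norm (row_square m W) < 1"
    using W by (auto simp: row_ball_def)
  have len: "length W = d" and We: "\<And>e. e < d \<Longrightarrow> W ! e \<in> carrier_mat m m"
    using tup by (auto simp: mat_tuples_def)
  define q where "q = op_norm (row_square m W)"
  have RS: "row_square m W \<in> carrier_mat m m" by (simp add: row_square_def mat_sum_def)
  have q: "0 \<le> q" "q < 1"
    unfolding q_def using op_norm_bound(2)[OF RS, of "0\<^sub>v m"] lt by auto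
  let ?J = "{..<d} \<times> {..<m}"
  define R where "R = (\<lambda>p x. W ! fst x $$ (p, snd x))"
  have RR: "mult_on ?J R (adj R) p p' = entries (row_square m W) p p'" if "p < m" "p' < m" for p p'
  proof -
    have "(W ! e * mat_adjoint (W ! e)) $$ (p, p') = (\<Sum>r<m. W ! e $$ (p, r) * cnj (W ! e $$ (p', r)))" if "e < d" for e
      using We[OF that] \<open>p < m\<close> \<open>p' < m\<close> by (simp add: scalar_prod_def index_mat_adjoint lessThan_atLeast0)
    then have "entries (row_square m W) p p' = (\<Sum>e<d. \<Sum>r<m. W ! e $$ (p, r) * cnj (W ! e $$ (p', r)))"
      using that by (simp add: entries_def row_square_def mat_sum_def len)
    then show ?thesis
      by (simp add: mult_on_def adj_def R_def sum.cartesian_product case_prod_unfold)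
  qed
  have adj: "norm2_on ?J (app_on {..<m} (adj R) y) \<le> q * norm2_on {..<m} y" for y
  proof -
    have "complex_of_real (norm2_on ?J (app_on {..<m} (adj R) y)) =
        inner_on {..<m} (app_on ?J R (app_on {..<m} (adj R) y)) y"
      by (simp add: inner_on_app_on inner_on_self)
    also have "\<dots> = form_on {..<m} (mult_on ?J R (adj R)) y"
      by (simp add: form_on_def app_on_mult)
    also have "\<dots> = form_on {..<m} (entries (row_square m W)) y"
      by (rule form_on_cong) (simp add: RR)
    finally have "norm2_on ?J (app_on {..<m} (adj R) y) \<le> cmod (form_on {..<m} (entries (row_square m W)) y)"
      by (metis abs_of_nonneg norm2_on_nonneg norm_of_real order.refl)
    also have "\<dots> \<le> q * norm2_on {..<m} y"
    proof (rule form_on_opbound)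
      show "opbound_on {..<m} q (entries (row_square m W))"
        unfolding opbound_on_def q_def using op_norm_app_bound[OF RS] by blast
    qed simp
    finally show ?thesis .
  qed
  have "norm2_on {..<m} (app_on ?J R g) \<le> q * norm2_on ?J g" for g
    using app_on_adj_bound[of ?J "{..<m}" "adj R" q g] adj q by simp
  then have "(\<Sum>p<m. (cmod (\<Sum>e<d. \<Sum>r<m. W ! e $$ (p, r) * g e r))\<^sup>2) \<le>
      q * (\<Sum>e<d. \<Sum>r<m. (cmod (g e r))\<^sup>2)" for g
    using spec[of _ "\<lambda>x. g (fst x) (snd x)"]
    by (force simp: norm2_on_def app_on_def R_def sum.cartesian_product case_prod_unfold)
  then show ?thesis unfolding row_contraction_def using tup q by blast
qed

lemma direct_sum_carrier:
  "A \<in> carrier_mat m m \<Longrightarrow> B \<in> carrier_mat k k \<Longrightarrow> direct_sum A B \<in> carrier_mat (m + k) (m + k)"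
  by (auto simp: direct_sum_def Let_def)

lemma index_direct_sum:
  assumes "A \<in> carrier_mat m m" "B \<in> carrier_mat k k" "i < m + k" "j < m + k"
  shows "direct_sum A B $$ (i, j) = (if i < m then if j < m then A $$ (i, j) else 0
    else if j < m then 0 else B $$ (i - m, j - m))"
  using assms by (auto simp: direct_sum_def Let_def)

lemma sum_lessThan_add:
  fixes f :: "nat \<Rightarrow> 'a::comm_monoid_add"
  shows "(\<Sum>r<m + k. f r) = (\<Sum>r<m. f r) + (\<Sum>r<k. f (m + r))"
proof -
  have "{..<m + k} = {..<m} \<union> {m..<m + k}" by auto
  then have "(\<Sum>r<m + k. f r) = (\<Sum>r<m. f r) + (\<Sum>r=m..<m + k. f r)"
    by (simp add: sum.union_disjoint ivl_disj_int)
  also have "(\<Sum>r=m..<m + k. f r) = (\<Sum>r<k. f (m + r))"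
    using sum.shift_bounds_nat_ivl[of f 0 m k] by (simp add: add.commute lessThan_atLeast0)
  finally show ?thesis .
qed

text \<open>The first nc axiom evaluates a function at a direct sum, where the transfer function is
  controlled only for row contractions. The row operator splits into two independent parts, so the
  larger constant works.\<close>

lemma row_contraction_direct_sum:
  assumes X: "row_contraction d m X" and Z: "row_contraction d k Z"
  shows "row_contraction d (m + k) (map2 direct_sum X Z)"
proof -
  have len: "length X = d" "length Z = d"
    and Xe: "\<And>e. e < d \<Longrightarrow> X ! e \<in> carrier_mat m m" and Ze: "\<And>e. e < d \<Longrightarrow> Z ! e \<in> carrier_mat k k"
    using X Z by (auto simp: row_contraction_def mat_tuples_def)
  obtain q1 where q1: "0 \<le> q1" "q1 < 1" "\<And>g. (\<Sum>p<m. (cmod (\<Sum>e<d. \<Sum>r<m. X ! e $$ (p, r) * g e r))\<^sup>2) \<le>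
      q1 * (\<Sum>e<d. \<Sum>r<m. (cmod (g e r))\<^sup>2)" using X unfolding row_contraction_def by blast
  obtain q2 where q2: "0 \<le> q2" "q2 < 1" "\<And>g. (\<Sum>p<k. (cmod (\<Sum>e<d. \<Sum>r<k. Z ! e $$ (p, r) * g e r))\<^sup>2) \<le>
      q2 * (\<Sum>e<d. \<Sum>r<k. (cmod (g e r))\<^sup>2)" using Z unfolding row_contraction_def by blast
  let ?W = "map2 direct_sum X Z"
  have We: "?W ! e = direct_sum (X ! e) (Z ! e)" if "e < d" for e using that len by simp
  have tup: "?W \<in> mat_tuples d (m + k)"
    unfolding mat_tuples_def using len We Xe Ze direct_sum_carrier
    by (auto simp: in_set_conv_nth)
  let ?q = "max q1 q2"
  have "(\<Sum>p<m + k. (cmod (\<Sum>e<d. \<Sum>r<m + k. ?W ! e $$ (p, r) * g e r))\<^sup>2) \<le>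
      ?q * (\<Sum>e<d. \<Sum>r<m + k. (cmod (g e r))\<^sup>2)" for g
  proof -
    have top: "(\<Sum>e<d. \<Sum>r<m + k. ?W ! e $$ (p, r) * g e r) = (\<Sum>e<d. \<Sum>r<m. X ! e $$ (p, r) * g e r)"
      if "p < m" for p
      unfolding sum_lessThan_add
      using that by (intro sum.cong) (auto simp: We index_direct_sum[OF Xe Ze])
    have bot: "(\<Sum>e<d. \<Sum>r<m + k. ?W ! e $$ (m + p, r) * g e r) = (\<Sum>e<d. \<Sum>r<k. Z ! e $$ (p, r) * g e (m + r))"
      if "p < k" for p
      unfolding sum_lessThan_add
      using that by (intro sum.cong) (auto simp: We index_direct_sum[OF Xe Ze])
    have "(\<Sum>p<m + k. (cmod (\<Sum>e<d. \<Sum>r<m + k. ?W ! e $$ (p, r) * g e r))\<^sup>2) =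
        (\<Sum>p<m. (cmod (\<Sum>e<d. \<Sum>r<m. X ! e $$ (p, r) * g e r))\<^sup>2) +
        (\<Sum>p<k. (cmod (\<Sum>e<d. \<Sum>r<k. Z ! e $$ (p, r) * g e (m + r)))\<^sup>2)"
      unfolding sum_lessThan_add[of _ m k, where 'a = real] 
      by (intro arg_cong2[where f = "(+)"] sum.cong refl) (simp_all add: top bot)
    also have "\<dots> \<le> q1 * (\<Sum>e<d. \<Sum>r<m. (cmod (g e r))\<^sup>2) + q2 * (\<Sum>e<d. \<Sum>r<k. (cmod (g e (m + r)))\<^sup>2)"
      by (intro add_mono q1(3) q2(3))
    also have "\<dots> \<le> ?q * (\<Sum>e<d. \<Sum>r<m. (cmod (g e r))\<^sup>2) + ?q * (\<Sum>e<d. \<Sum>r<k. (cmod (g e (m + r)))\<^sup>2)"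
      by (intro add_mono mult_right_mono sum_nonneg) auto
    also have "\<dots> = ?q * (\<Sum>e<d. \<Sum>r<m + k. (cmod (g e r))\<^sup>2)"
      by (simp add: sum_lessThan_add sum.distrib distrib_left)
    finally show ?thesis .
  qed
  moreover have "0 \<le> ?q" "?q < 1" using q1 q2 by auto
  ultimately show ?thesis unfolding row_contraction_def using tup by blast
qed

section \<open>Transfer functions as bounded nc functions\<close>

context contractive_realization
begin

text \<open>The two coordinate inclusions intertwine the direct sum with its summands and determine
  the left and right columns of the value. For similarities, S itself intertwines X with S^(-1) X
  S.\<close>

lemma transfer_nc_function:
  assumes l: "l < t"
  shows "nc_function d (transfer c i l)"
  unfolding nc_function_def
proof (intro conjI allI impI ballI)
  fix m X assume "X \<in> row_ball d m"
  then show "transfer c i l X \<in> carrier_mat m m" by (intro transfer_carrier row_ball_contraction)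
next
  fix m k X Z assume "X \<in> row_ball d m" "Z \<in> row_ball d k"
  then have X: "row_contraction d m X" and Z: "row_contraction d k Z" by (auto intro: row_ball_contraction)
  let ?W = "map2 direct_sum X Z"
  have W: "row_contraction d (m + k) ?W" by (rule row_contraction_direct_sum[OF X Z])
  have len: "length X = d" "length Z = d" using X Z by (auto simp: row_contraction_def mat_tuples_def)
  have We: "?W ! e = direct_sum (X ! e) (Z ! e)" if "e < d" for e using that len by simp
  note idx = index_direct_sum[OF row_contraction_dim[OF X] row_contraction_dim[OF Z]]
  note carr = transfer_carrier[OF X, of c i l] transfer_carrier[OF Z, of c i l] transfer_carrier[OF W, of c i l]
  have kd: "(\<Sum>r<N. f r * kdelta r q) = (if q < N then f q else 0)"
    "(\<Sum>r<N. kdelta q r * f r) = (if q < N then f q else 0)" for f :: "nat \<Rightarrow> complex" and N q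
    by (simp_all add: kdelta_def if_distrib[of "\<lambda>z. _ * z"] if_distrib[of "\<lambda>z. z * _"] cong: if_cong)
  have i1: "intertwines d (m + k) m ?W X kdelta"
    unfolding intertwines_def by (auto simp: kd We idx)
  have i2: "intertwines d (m + k) k ?W Z (\<lambda>p q. kdelta p (m + q))"
    unfolding intertwines_def
  proof (intro allI impI)
    fix e p q assume e: "e < d" and p: "p < m + k" and q: "q < k"
    show "(\<Sum>r<m + k. ?W ! e $$ (p, r) * kdelta r (m + q)) = (\<Sum>r<k. kdelta p (m + r) * Z ! e $$ (r, q))"
    proof (cases "p < m")
      case True
      then show ?thesis using e p q by (simp add: kd We idx) (simp add: kdelta_def)
    next
      case False
      then have "kdelta p (m + r) = kdelta (p - m) r" for r by (auto simp: kdelta_def)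
      then show ?thesis using e p q False by (simp add: kd We idx)
    qed
  qed
  show "transfer c i l ?W = direct_sum (transfer c i l X) (transfer c i l Z)"
  proof (rule eq_matI)
    fix p q assume "p < dim_row (direct_sum (transfer c i l X) (transfer c i l Z))"
      "q < dim_col (direct_sum (transfer c i l X) (transfer c i l Z))"
    then have pq: "p < m + k" "q < m + k" using direct_sum_carrier[OF carr(1,2)] by auto
    show "transfer c i l ?W $$ (p, q) = direct_sum (transfer c i l X) (transfer c i l Z) $$ (p, q)"
    proof (cases "q < m")
      case True
      then show ?thesis
        using transfer_intertwine[OF W X i1 pq(1) True l, of c i] pq
        by (simp add: kd index_direct_sum[OF carr(1,2)])
    next
      case False
      then have q: "q - m < k" "m + (q - m) = q" using pq by auto
      have eq: "transfer c i l ?W $$ (p, q) = (\<Sum>r<k. kdelta p (m + r) * transfer c i l Z $$ (r, q - m))"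
        using transfer_intertwine[OF W Z i2 pq(1) q(1) l, of c i] pq by (simp add: kd q)
      show ?thesis
      proof (cases "p < m")
        case True
        then show ?thesis unfolding eq using pq False by (simp add: index_direct_sum[OF carr(1,2)]) (simp add: kdelta_def)
      next
        case p: False
        then have "kdelta p (m + r) = kdelta (p - m) r" for r by (auto simp: kdelta_def)
        then show ?thesis unfolding eq using pq False p by (simp add: kd index_direct_sum[OF carr(1,2)])
      qed
    qed
  qed (use carr direct_sum_carrier[OF carr(1,2)] in auto)
next
  fix m X S assume "X \<in> row_ball d m" and S: "S \<in> carrier_mat m m" "invertible_mat S"
    and Z: "map (\<lambda>A. mat_inv S * A * S) X \<in> row_ball d m"
  let ?Z = "map (\<lambda>A. mat_inv S * A * S) X"
  have X: "row_contraction d m X" and Zc: "row_contraction d m ?Z"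
    using \<open>X \<in> row_ball d m\<close> Z by (auto intro: row_ball_contraction)
  have len: "length X = d" using X by (auto simp: row_contraction_def mat_tuples_def)
  have "det S \<noteq> 0"
  proof -
    obtain R where R: "S * R = 1\<^sub>m m" "R * S = 1\<^sub>m (dim_row R)"
      using S by (auto simp: invertible_mat_def inverts_mat_def)
    have "dim_col R = m" using arg_cong[OF R(1), of dim_col] by simp
    moreover have "dim_row R = m" using arg_cong[OF R(2), of dim_col] S(1) by simp
    ultimately have "R \<in> carrier_mat m m" by (intro carrier_matI)
    then have "det S * det R = 1" using det_mult[OF S(1), of R] R(1) by simp
    then show ?thesis by auto
  qed
  note Si = mat_inv_invertible[OF S(1) this]
  note carr = transfer_carrier[OF X, of c i l] transfer_carrier[OF Zc, of c i l]
  have swap: "S * (mat_inv S * M * S) = M * S" if "M \<in> carrier_mat m m" for M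
  proof -
    have "S * (mat_inv S * M * S) = (S * mat_inv S) * (M * S)"
      using that S(1) Si(1) by (simp add: assoc_mult_mat[of _ m m _ m _ m])
    then show ?thesis using that S(1) Si(2) by simp
  qed
  have "intertwines d m m X ?Z (\<lambda>p q. S $$ (p, q))"
    unfolding intertwines_def
  proof (intro allI impI)
    fix e p q assume epq: "e < d" "p < m" "q < m"
    have Xe: "X ! e \<in> carrier_mat m m" by (rule row_contraction_dim[OF X epq(1)])
    have "(\<Sum>r<m. X ! e $$ (p, r) * S $$ (r, q)) = (X ! e * S) $$ (p, q)"
      using Xe S(1) epq by (simp add: scalar_prod_def lessThan_atLeast0)
    also have "\<dots> = (S * ?Z ! e) $$ (p, q)" using swap[OF Xe] epq len by simp
    also have "\<dots> = (\<Sum>r<m. S $$ (p, r) * ?Z ! e $$ (r, q))"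
      using row_contraction_dim[OF Zc epq(1)] S(1) epq by (simp add: scalar_prod_def lessThan_atLeast0 del: nth_map)
    finally show "(\<Sum>r<m. X ! e $$ (p, r) * S $$ (r, q)) = (\<Sum>r<m. S $$ (p, r) * ?Z ! e $$ (r, q))" .
  qed
  note tr = transfer_intertwine[OF X Zc this _ _ l, of _ _ c i]
  have "transfer c i l X * S = S * transfer c i l ?Z"
  proof (rule eq_matI)
    fix p q assume "p < dim_row (S * transfer c i l ?Z)" "q < dim_col (S * transfer c i l ?Z)"
    then have pq: "p < m" "q < m" using S(1) carr by auto
    then show "(transfer c i l X * S) $$ (p, q) = (S * transfer c i l ?Z) $$ (p, q)"
      using tr[OF pq] S(1) carr by (simp add: scalar_prod_def lessThan_atLeast0)
  qed (use S(1) carr in auto)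
  then have "mat_inv S * (transfer c i l X * S) = mat_inv S * (S * transfer c i l ?Z)" by simp
  also have "\<dots> = (mat_inv S * S) * transfer c i l ?Z"
    using S(1) Si(1) carr by (simp add: assoc_mult_mat[of _ m m _ m _ m])
  also have "\<dots> = transfer c i l ?Z" using Si(3) carr by simp
  finally show "transfer c i l ?Z = mat_inv S * transfer c i l X * S"
    using S(1) Si(1) carr by (simp add: assoc_mult_mat[of _ m m _ m _ m])
qed

text \<open>A single block is a corner of the block matrix: the input is supported in component l,
  and all outputs but i are dropped.\<close>

lemma transfer_op_norm:
  assumes W: "row_contraction d m W" and il: "i < s" "l < t"
  shows "op_norm (transfer c i l W) \<le> cmod c"
proof (rule op_norm_leI[OF transfer_carrier[OF W]])
  fix x
  define u :: "nat \<Rightarrow> nat \<Rightarrow> complex" where "u = (\<lambda>l' q. if l' = l then x q else 0)"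
  have sum_u: "(\<Sum>l'<t. \<Sum>q<m. transfer c i' l' W $$ (p, q) * u l' q) = (\<Sum>q<m. transfer c i' l W $$ (p, q) * x q)" for i' p
  proof -
    have "(\<Sum>l'<t. \<Sum>q<m. transfer c i' l' W $$ (p, q) * u l' q) =
        (\<Sum>l'<t. if l' = l then \<Sum>q<m. transfer c i' l' W $$ (p, q) * x q else 0)"
      by (intro sum.cong) (auto simp: u_def)
    then show ?thesis using il by simp
  qed
  have norm_u: "(\<Sum>l'<t. \<Sum>q<m. (cmod (u l' q))\<^sup>2) = norm2_on {..<m} x"
  proof -
    have "(\<Sum>l'<t. \<Sum>q<m. (cmod (u l' q))\<^sup>2) = (\<Sum>l'<t. if l' = l then norm2_on {..<m} x else 0)"
      by (intro sum.cong) (auto simp: u_def norm2_on_def)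
    then show ?thesis using il by simp
  qed
  have "norm2_on {..<m} (app_on {..<m} (entries (transfer c i l W)) x) =
      (\<Sum>p<m. (cmod (\<Sum>l'<t. \<Sum>q<m. transfer c i l' W $$ (p, q) * u l' q))\<^sup>2)"
    by (simp add: sum_u norm2_on_def app_on_def entries_def)
  also have "\<dots> \<le> (\<Sum>i'<s. \<Sum>p<m. (cmod (\<Sum>l'<t. \<Sum>q<m. transfer c i' l' W $$ (p, q) * u l' q))\<^sup>2)"
    by (rule member_le_sum[of i "{..<s}" "\<lambda>i'. \<Sum>p<m. (cmod (\<Sum>l'<t. \<Sum>q<m. transfer c i' l' W $$ (p, q) * u l' q))\<^sup>2"])
       (use il in \<open>auto intro: sum_nonneg\<close>)
  also have "\<dots> \<le> (cmod c)\<^sup>2 * norm2_on {..<m} x"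
    using transfer_bound[OF W, of c u] by (simp only: norm_u)
  finally show "norm_on {..<m} (app_on {..<m} (entries (transfer c i l W)) x) \<le> cmod c * norm_on {..<m} x"
    by (simp add: norm_on_le_iff)
qed simp

lemma transfer_H_infinity:
  assumes "i < s" "l < t"
  shows "transfer c i l \<in> H_infinity d"
proof -
  have "(SUP m\<in>{1..}. SUP X\<in>row_ball d m. ereal (op_norm (transfer c i l X))) \<le> ereal (cmod c)"
    by (intro SUP_least) (use transfer_op_norm[OF row_ball_contraction assms] in simp)
  also have "\<dots> < \<infinity>" by simp
  finally show ?thesis unfolding H_infinity_def using transfer_nc_function[OF assms(2)] by simp
qed

lemma transfer_sup_norm: "sup_norm d s t (transfer c) \<le> ereal (cmod c)"
  unfolding sup_norm_def
proof (intro SUP_least)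
  fix m W assume "W \<in> row_ball d m"
  then have W: "row_contraction d m W" by (rule row_ball_contraction)
  have "op_norm (block_mat s t m (\<lambda>i j. transfer c i j W)) \<le> cmod c"
    by (rule op_norm_block_leI) (simp_all add: transfer_bound[OF W])
  then show "ereal (op_norm (block_mat s t m (\<lambda>i j. transfer c i j W))) \<le> ereal (cmod c)" by simp
qed

end

section \<open>Interpolation\<close>

lemma pos_on_injective:
  assumes "finite I" "pos_on I c A" "0 < c" and "\<And>i. i \<in> I \<Longrightarrow> app_on I A x i = 0" and "i \<in> I"
  shows "x i = 0"
proof -
  have "form_on I A x = 0" unfolding form_on_def inner_on_def using assms(4) by simp
  then have "c * norm2_on I x \<le> 0" using pos_onD[OF assms(2), of x] by simp
  then have "norm2_on I x = 0"
    using assms(3) norm2_on_nonneg[of I x] by (simp add: mult_le_0_iff)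
  then show ?thesis using assms by (simp add: norm2_on_eq_0)
qed

lemma sum_Times: "(\<Sum>x\<in>A \<times> B. f x) = (\<Sum>a\<in>A. \<Sum>b\<in>B. f (a, b))"
  by (simp add: sum.cartesian_product case_prod_unfold)

text \<open>The contraction is \<open>N\<^sup>* (N N\<^sup>*)\<^sup>-\<^sup>1 M\<close>.\<close>

lemma lurking_contraction:
  assumes fin: "finite I" "finite J" "finite L"
    and eq: "\<And>x y. x \<in> I \<Longrightarrow> y \<in> I \<Longrightarrow> mult_on J M (adj M) x y = mult_on L N (adj N) x y"
    and pos: "pos_on I c (mult_on L N (adj N))" "0 < c"
  obtains U where "\<And>x j. x \<in> I \<Longrightarrow> mult_on L N U x j = M x j"
    and "\<And>w. norm2_on L (app_on J U w) \<le> norm2_on J w"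
proof -
  define Q where "Q = mult_on L N (adj N)"
  obtain R where R: "\<And>x y. x \<in> I \<Longrightarrow> y \<in> I \<Longrightarrow> mult_on I Q R x y = kdelta x y"
      "\<And>x y. x \<in> I \<Longrightarrow> y \<in> I \<Longrightarrow> mult_on I R Q x y = kdelta x y"
  proof (rule finite_linear_inverse[OF fin(1), of Q])
    show "x i = 0" if "\<And>i. i \<in> I \<Longrightarrow> app_on I Q x i = 0" "i \<in> I" for x i
      using pos_on_injective[OF fin(1) pos] that unfolding Q_def by blast
  qed (use that in blast)
  have hQ: "cnj (Q x y) = Q y x" for x y
    by (simp add: Q_def mult_on_def adj_def mult.commute)
  define U where "U = mult_on I (adj N) (mult_on I R M)"
  have NU: "mult_on L N U x j = M x j" if "x \<in> I" for x j
  proof -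
    have "mult_on L N U x j = mult_on I (mult_on I Q R) M x j"
      by (simp add: U_def Q_def mult_on_assoc)
    also have "\<dots> = (\<Sum>y\<in>I. if x = y then M y j else 0)"
      unfolding mult_on_def[of I "mult_on I Q R"] using R(1) that by (intro sum.cong) (auto simp: kdelta_def)
    also have "\<dots> = M x j" using that fin by simp
    finally show ?thesis .
  qed
  have adjU: "app_on L (adj U) y = app_on I (adj M) (app_on I (adj R) (app_on L N y))" for y
  proof -
    have adj_mult: "adj (mult_on K A B) = mult_on K (adj B) (adj A)" for K :: "'k set" and A :: "'x \<Rightarrow> 'k \<Rightarrow> complex" and B :: "'k \<Rightarrow> 'y \<Rightarrow> complex"
      by (simp add: adj_def mult_on_def mult.commute)
    show ?thesis unfolding U_def adj_mult app_on_mult by (simp add: mult_on_assoc)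
  qed
  have contr: "norm2_on J (app_on L (adj U) y) \<le> 1 * norm2_on L y" for y
  proof -
    \<comment> \<open>U^* y = M^* z, while N^* z is the orthogonal projection of y to the range of
      N^*. The two have equal norms because M M^* = N N^*, so U^* is a contraction.\<close>
    define z where "z = app_on I (adj R) (app_on L N y)"
    have Qz: "app_on I Q z x = app_on L N y x" if "x \<in> I" for x
      unfolding z_def
    proof (rule app_on_mult_kdelta[OF fin(1) _ that])
      fix x y assume xy: "x \<in> I" "y \<in> I"
      have "mult_on I Q (adj R) x y = cnj (mult_on I R Q y x)"
        by (simp add: mult_on_def adj_def hQ mult.commute)
      then show "mult_on I Q (adj R) x y = kdelta x y" using R(2)[OF xy(2,1)] by (simp add: kdelta_def)
    qed
    have "complex_of_real (norm2_on J (app_on I (adj M) z)) = form_on I (mult_on J M (adj M)) z"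
      unfolding form_on_def app_on_mult[symmetric] by (subst inner_on_app_on) (simp add: inner_on_self)
    also have "\<dots> = form_on I Q z" unfolding Q_def by (rule form_on_cong) (rule eq)
    finally have M: "complex_of_real (norm2_on J (app_on I (adj M) z)) = form_on I Q z" .
    let ?n = "norm2_on L (app_on I (adj N) z)"
    have N: "form_on I Q z = of_real ?n"
      unfolding form_on_def Q_def app_on_mult[symmetric] by (subst inner_on_app_on) (simp add: inner_on_self)
    have MN: "norm2_on J (app_on I (adj M) z) = ?n" using M unfolding N by (simp only: of_real_eq_iff)
    have "form_on I Q z = inner_on I (app_on L N y) z"
      unfolding form_on_def by (rule inner_on_cong) (simp_all add: Qz)
    also have "\<dots> = inner_on L y (app_on I (adj N) z)" by (rule inner_on_app_on)
    finally have "complex_of_real ?n = inner_on L y (app_on I (adj N) z)" unfolding N .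
    then have "?n\<^sup>2 \<le> norm2_on L y * ?n"
      using cauchy_schwarz_on[OF fin(3), of y "app_on I (adj N) z"] by (metis abs_of_nonneg norm2_on_nonneg norm_of_real)
    then have "?n \<le> norm2_on L y"
      using norm2_on_nonneg[of L "app_on I (adj N) z"] norm2_on_nonneg[of L y]
      by (cases "?n = 0") (auto simp: power2_eq_square)
    then show ?thesis by (simp add: adjU MN flip: z_def)
  qed
  have "norm2_on L (app_on J U w) \<le> norm2_on J w" for w
    using app_on_adj_bound[OF fin(2) contr, of w] by simp
  then show ?thesis using that NU by blast
qed

text \<open>With P = E^2 and w = (E \<otimes> 1) v the form of P \<otimes> Q splits into the sum of
  the forms of Q at the components w_k. Each contributes at least \<beta> times its norm, and the
  total norm of w is the form of P \<otimes> 1 at v.\<close>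

lemma pos_on_tensor:
  assumes fin: "finite I" "finite J" and P: "pos_on I \<alpha> P" "0 < \<alpha>" and Q: "pos_on J \<beta> Q" "0 < \<beta>"
  shows "pos_on (I \<times> J) (\<alpha> * \<beta>) (\<lambda>x y. P (fst x) (fst y) * Q (snd x) (snd y))"
proof -
  obtain c E where E: "pos_on I c E" "\<And>a b. a \<in> I \<Longrightarrow> b \<in> I \<Longrightarrow> mult_on I E E a b = P a b"
    by (rule square_root_exists[OF fin(1) P]) blast
  have hE: "E a k = cnj (E k a)" if "a \<in> I" "k \<in> I" for a k
    using pos_on_hermitian[OF E(1)] that by (simp add: hermitian_on_def)
  let ?T = "\<lambda>x y. P (fst x) (fst y) * Q (snd x) (snd y)"
  have "hermitian_on (I \<times> J) ?T"
    using pos_on_hermitian[OF P(1)] pos_on_hermitian[OF Q(1)] by (auto simp: hermitian_on_def)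
  moreover have "\<alpha> * \<beta> * norm2_on (I \<times> J) v \<le> Re (form_on (I \<times> J) ?T v)" for v
  proof -
    define w where "w k = (\<lambda>p. \<Sum>b\<in>I. E k b * v (b, p))" for k
    let ?f = "\<lambda>k a p b q. cnj (E k a * v (a, p)) * Q p q * (E k b * v (b, q))"
    have "form_on (I \<times> J) ?T v =
        (\<Sum>a\<in>I. \<Sum>p\<in>J. \<Sum>b\<in>I. \<Sum>q\<in>J. \<Sum>k\<in>I. ?f k a p b q)"
    proof -
      have "form_on (I \<times> J) ?T v = (\<Sum>a\<in>I. \<Sum>p\<in>J. \<Sum>b\<in>I. \<Sum>q\<in>J. cnj (v (a, p)) * (P a b * Q p q) * v (b, q))"
        by (simp add: form_on_eq sum_Times)
      also have "\<dots> = (\<Sum>a\<in>I. \<Sum>p\<in>J. \<Sum>b\<in>I. \<Sum>q\<in>J. \<Sum>k\<in>I. ?f k a p b q)"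
      proof (intro sum.cong refl)
        fix a p b q assume "a \<in> I" "b \<in> I"
        then have "P a b = (\<Sum>k\<in>I. cnj (E k a) * E k b)"
          unfolding E(2)[symmetric, OF \<open>a \<in> I\<close> \<open>b \<in> I\<close>] mult_on_def by (intro sum.cong) (auto simp flip: hE)
        then show "cnj (v (a, p)) * (P a b * Q p q) * v (b, q) =
            (\<Sum>k\<in>I. ?f k a p b q)"
          by (simp add: sum_distrib_left sum_distrib_right mult_ac)
      qed
      finally show ?thesis .
    qed
    also have "\<dots> = (\<Sum>a\<in>I. \<Sum>p\<in>J. \<Sum>b\<in>I. \<Sum>k\<in>I. \<Sum>q\<in>J. ?f k a p b q)"
      by (intro sum.cong refl sum.swap)
    also have "\<dots> = (\<Sum>a\<in>I. \<Sum>p\<in>J. \<Sum>k\<in>I. \<Sum>b\<in>I. \<Sum>q\<in>J. ?f k a p b q)"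
      by (intro sum.cong refl sum.swap)
    also have "\<dots> = (\<Sum>a\<in>I. \<Sum>k\<in>I. \<Sum>p\<in>J. \<Sum>b\<in>I. \<Sum>q\<in>J. ?f k a p b q)"
      by (intro sum.cong refl sum.swap)
    also have "\<dots> = (\<Sum>k\<in>I. \<Sum>a\<in>I. \<Sum>p\<in>J. \<Sum>b\<in>I. \<Sum>q\<in>J. ?f k a p b q)"
      by (rule sum.swap)
    also have "\<dots> = (\<Sum>k\<in>I. form_on J Q (w k))"
    proof (intro sum.cong refl)
      fix k
      have "(\<Sum>a\<in>I. \<Sum>p\<in>J. \<Sum>b\<in>I. \<Sum>q\<in>J. ?f k a p b q) =
          (\<Sum>p\<in>J. \<Sum>a\<in>I. \<Sum>q\<in>J. \<Sum>b\<in>I. ?f k a p b q)"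
        by (subst sum.swap, intro sum.cong refl sum.swap)
      also have "\<dots> = (\<Sum>p\<in>J. \<Sum>q\<in>J. \<Sum>a\<in>I. \<Sum>b\<in>I. ?f k a p b q)"
        by (intro sum.cong refl sum.swap)
      also have "\<dots> = (\<Sum>p\<in>J. \<Sum>q\<in>J. \<Sum>b\<in>I. \<Sum>a\<in>I. ?f k a p b q)"
        by (intro sum.cong refl sum.swap)
      also have "\<dots> = form_on J Q (w k)"
        by (simp add: form_on_eq w_def sum_distrib_left sum_distrib_right)
      finally show "(\<Sum>a\<in>I. \<Sum>p\<in>J. \<Sum>b\<in>I. \<Sum>q\<in>J. ?f k a p b q) =
          form_on J Q (w k)" .
    qed
    finally have form: "Re (form_on (I \<times> J) ?T v) = (\<Sum>k\<in>I. Re (form_on J Q (w k)))" by simp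
    have col: "\<alpha> * (\<Sum>b\<in>I. (cmod (v (b, p)))\<^sup>2) \<le> (\<Sum>k\<in>I. (cmod (w k p))\<^sup>2)" for p
    proof -
      have "form_on I P (\<lambda>b. v (b, p)) = form_on I (mult_on I E E) (\<lambda>b. v (b, p))"
        by (rule form_on_cong) (simp add: E(2))
      also have "\<dots> = inner_on I (app_on I E (\<lambda>b. v (b, p))) (app_on I E (\<lambda>b. v (b, p)))"
        unfolding form_on_def app_on_mult[symmetric] by (rule inner_on_hermitian[OF pos_on_hermitian[OF E(1)]])
      also have "\<dots> = of_real (\<Sum>k\<in>I. (cmod (w k p))\<^sup>2)"
        by (simp add: inner_on_self norm2_on_def app_on_def w_def)
      finally show ?thesis using pos_onD[OF P(1), of "\<lambda>b. v (b, p)"] by (simp add: norm2_on_def)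
    qed
    have "\<alpha> * \<beta> * norm2_on (I \<times> J) v = \<beta> * (\<Sum>p\<in>J. \<alpha> * (\<Sum>b\<in>I. (cmod (v (b, p)))\<^sup>2))"
    proof -
      have "norm2_on (I \<times> J) v = (\<Sum>b\<in>I. \<Sum>p\<in>J. (cmod (v (b, p)))\<^sup>2)"
        by (simp add: norm2_on_def sum.cartesian_product case_prod_unfold)
      also have "\<dots> = (\<Sum>p\<in>J. \<Sum>b\<in>I. (cmod (v (b, p)))\<^sup>2)" by (rule sum.swap)
      finally show ?thesis by (simp add: sum_distrib_left mult_ac)
    qed
    also have "\<dots> \<le> \<beta> * (\<Sum>p\<in>J. \<Sum>k\<in>I. (cmod (w k p))\<^sup>2)"
      using Q(2) by (intro mult_left_mono sum_mono col) auto
    also have "\<dots> = (\<Sum>k\<in>I. \<beta> * norm2_on J (w k))"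
      by (subst sum.swap) (simp add: norm2_on_def sum_distrib_left)
    also have "\<dots> \<le> (\<Sum>k\<in>I. Re (form_on J Q (w k)))" by (intro sum_mono pos_onD[OF Q(1)])
    finally show ?thesis by (simp add: form)
  qed
  ultimately show ?thesis by (simp add: pos_on_def)
qed

section \<open>The Pick matrix and its Stein equation\<close>

context row_coisometry
begin

text \<open>The transpose of id - r^2 \<Phi>, acting on the indices of the matrix unit in a
  resolvent. The left inverse equations of \<open>resolvent\<close> say that it sends g to a product
  of deltas.\<close>

definition stein :: "real \<Rightarrow> (nat \<Rightarrow> nat \<Rightarrow> complex) \<Rightarrow> nat \<Rightarrow> nat \<Rightarrow> complex" where
  "stein r F a b = F a b - of_real (r\<^sup>2) * (\<Sum>e<d. \<Sum>k<n. \<Sum>l<n. X e k a * F k l * cnj (X e l b))"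

lemma stein_scale: "stein r (\<lambda>k l. z * F k l) a b = z * stein r F a b"
  by (simp add: stein_def sum_distrib_left right_diff_distrib mult_ac)

lemma stein_diff: "stein r (\<lambda>k l. F k l - G k l) a b = stein r F a b - stein r G a b"
  by (simp add: stein_def algebra_simps sum_subtractf)

lemma stein_sum: "stein r (\<lambda>k l. \<Sum>j\<in>J. F j k l) a b = (\<Sum>j\<in>J. stein r (F j) a b)"
proof -
  let ?f = "\<lambda>e k l j. X e k a * F j k l * cnj (X e l b)"
  have "(\<Sum>e<d. \<Sum>k<n. \<Sum>l<n. X e k a * (\<Sum>j\<in>J. F j k l) * cnj (X e l b)) =
      (\<Sum>e<d. \<Sum>k<n. \<Sum>l<n. \<Sum>j\<in>J. ?f e k l j)"
    by (simp add: sum_distrib_left sum_distrib_right)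
  also have "\<dots> = (\<Sum>e<d. \<Sum>k<n. \<Sum>j\<in>J. \<Sum>l<n. ?f e k l j)"
    by (intro sum.cong refl sum.swap)
  also have "\<dots> = (\<Sum>e<d. \<Sum>j\<in>J. \<Sum>k<n. \<Sum>l<n. ?f e k l j)"
    by (intro sum.cong refl sum.swap)
  also have "\<dots> = (\<Sum>j\<in>J. \<Sum>e<d. \<Sum>k<n. \<Sum>l<n. ?f e k l j)"
    by (rule sum.swap)
  finally show ?thesis by (simp add: stein_def sum_subtractf sum_distrib_left)
qed

lemma stein_resolvent:
  assumes "resolvent r g" "a < n" "b < n" "p < n" "q < n"
  shows "stein r (\<lambda>k l. g k l p q) a b = kdelta a p * kdelta b q"
  using assms unfolding resolvent_def stein_def by blast

text \<open>The Choi matrix of \<open>A \<mapsto> c\<^sup>2 G(A) \<otimes> I - Y (G(A) \<otimes> I) Y\<^sup>*\<close>, where \<open>G\<close> is the map with Choi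
  matrix \<open>g\<close>; an index is a triple of a column, a row, and a block row.\<close>

definition pick :: "nat \<Rightarrow> real \<Rightarrow> (nat \<Rightarrow> nat \<Rightarrow> complex mat) \<Rightarrow> (nat \<Rightarrow> nat \<Rightarrow> nat \<Rightarrow> nat \<Rightarrow> complex) \<Rightarrow>
    nat \<times> nat \<times> nat \<Rightarrow> nat \<times> nat \<times> nat \<Rightarrow> complex" where
  "pick t c Y g = (\<lambda>(a, p, i) (b, q, j). of_real (c\<^sup>2) * kdelta i j * g a b p q -
    (\<Sum>l<t. \<Sum>k<n. \<Sum>m<n. (entries (Y i l) p k * cnj (entries (Y j l) q m)) * g a b k m))"

text \<open>\<open>stein\<close> touches only a and b, whereas Y is attached to the other indices;
  so it passes through the sums and collapses g, leaving c^2 times the vectorized identity squared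
  minus a product of entries of Y.\<close>

lemma pick_stein:
  assumes g: "resolvent r g" and "a < n" "b < n" "p < n" "q < n"
  shows "stein r (\<lambda>k l. pick t c Y g (k, p, i) (l, q, j)) a b =
    of_real (c\<^sup>2) * kdelta i j * (kdelta a p * kdelta b q) -
    (\<Sum>l<t. entries (Y i l) p a * cnj (entries (Y j l) q b))"
proof -
  have "(\<Sum>k<n. \<Sum>m<n. (entries (Y i l) p k * cnj (entries (Y j l) q m)) * (kdelta a k * kdelta b m)) =
      entries (Y i l) p a * cnj (entries (Y j l) q b)" for l
  proof -
    have "(\<Sum>k<n. \<Sum>m<n. (entries (Y i l) p k * cnj (entries (Y j l) q m)) * (kdelta a k * kdelta b m)) =
        (\<Sum>k<n. \<Sum>m<n. if k = a then if m = b then entries (Y i l) p k * cnj (entries (Y j l) q m) else 0 else 0)"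
      by (intro sum.cong) (auto simp: kdelta_def)
    also have "\<dots> = entries (Y i l) p a * cnj (entries (Y j l) q b)"
      by (rule sum_pair_delta) (use assms in auto)
    finally show ?thesis .
  qed
  then show ?thesis
    using assms
    by (simp add: pick_def stein_diff stein_sum stein_scale stein_resolvent[OF g])
qed

lemma pick_hermitian:
  assumes g: "resolvent r g"
  shows "hermitian_on ({..<n} \<times> {..<n} \<times> {..<s}) (pick t c Y g)"
proof -
  have "cnj (pick t c Y g (a, p, i) (b, q, j)) = pick t c Y g (b, q, j) (a, p, i)"
    if ab: "a < n" "b < n" "p < n" "q < n" for a b p q i j
  proof -
    have "cnj (\<Sum>l<t. \<Sum>k<n. \<Sum>m<n. (entries (Y i l) p k * cnj (entries (Y j l) q m)) * g a b k m) =
        (\<Sum>l<t. \<Sum>k<n. \<Sum>m<n. (entries (Y j l) q m * cnj (entries (Y i l) p k)) * g b a m k)"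
      using resolvent_hermitian[OF g ab(1,2)] by (simp add: mult_ac)
    also have "\<dots> = (\<Sum>l<t. \<Sum>m<n. \<Sum>k<n. (entries (Y j l) q m * cnj (entries (Y i l) p k)) * g b a m k)"
      by (intro sum.cong refl sum.swap)
    finally show ?thesis
      using resolvent_hermitian[OF g ab] by (simp add: pick_def) (simp add: kdelta_def)
  qed
  then show ?thesis by (auto simp: hermitian_on_def)
qed

lemma d_pos: "0 < d"
proof (rule ccontr)
  assume "\<not> 0 < d"
  then show False using coisometry[OF n_pos n_pos] by (simp add: kdelta_def)
qed

end

section \<open>Interpolation at the scaled tuple\<close>

context row_coisometry_mat
begin

lemma scale_tuple_row_ball:
  assumes r: "0 \<le> r" "r < 1"
  shows "scale_tuple r X \<in> row_ball d n"
proof -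
  have len: "length X = d" and Xe: "\<And>e. e < d \<Longrightarrow> X ! e \<in> carrier_mat n n"
    using X by (auto simp: mat_tuples_def)
  have tup: "scale_tuple r X \<in> mat_tuples d n"
    using X by (auto simp: mat_tuples_def scale_tuple_def)
  have RS: "row_square n (scale_tuple r X) \<in> carrier_mat n n" by (simp add: row_square_def mat_sum_def)
  have idx: "entries (row_square n (scale_tuple r X)) p q = of_real (r\<^sup>2) * kdelta p q" if pq: "p < n" "q < n" for p q
  proof -
    have "(scale_tuple r X ! e * mat_adjoint (scale_tuple r X ! e)) $$ (p, q) =
        of_real (r\<^sup>2) * mult_on {..<n} (entries (X ! e)) (adj (entries (X ! e))) p q" if "e < d" for e
      using Xe[OF that] that len pq
      by (simp add: scale_tuple_def scalar_prod_def index_mat_adjoint mult_on_def adj_def entries_def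
          sum_distrib_left lessThan_atLeast0 power2_eq_square mult_ac)
    then have "entries (row_square n (scale_tuple r X)) p q =
        (\<Sum>e<d. of_real (r\<^sup>2) * mult_on {..<n} (entries (X ! e)) (adj (entries (X ! e))) p q)"
      using pq tup by (simp add: entries_def row_square_def mat_sum_def mat_tuples_def)
    also have "\<dots> = of_real (r\<^sup>2) * kdelta p q"
      by (simp only: sum_distrib_left[symmetric] coisometry[OF pq])
    finally show ?thesis .
  qed
  have "op_norm (row_square n (scale_tuple r X)) \<le> r\<^sup>2"
  proof (rule op_norm_leI[OF RS])
    fix x
    have "app_on {..<n} (entries (row_square n (scale_tuple r X))) x i = of_real (r\<^sup>2) * x i" if "i < n" for i
    proof -
      have "app_on {..<n} (entries (row_square n (scale_tuple r X))) x i = (\<Sum>j<n. if j = i then of_real (r\<^sup>2) * x j else 0)"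
        unfolding app_on_def using that by (intro sum.cong) (auto simp: idx kdelta_def)
      then show ?thesis using that by simp
    qed
    then have "norm_on {..<n} (app_on {..<n} (entries (row_square n (scale_tuple r X))) x) =
        norm_on {..<n} (\<lambda>i. of_real (r\<^sup>2) * x i)"
      unfolding norm_on_def by (intro arg_cong[where f = sqrt] norm2_on_cong) auto
    then show "norm_on {..<n} (app_on {..<n} (entries (row_square n (scale_tuple r X))) x) \<le> r\<^sup>2 * norm_on {..<n} x"
      by (simp only: norm_on_scale) (simp add: norm_power)
  qed simp
  also have "r\<^sup>2 < 1" using r by (simp add: abs_square_less_1)
  finally show ?thesis using tup by (simp add: row_ball_def)
qed

text \<open>With \<open>pick = V V\<^sup>*\<close>, the Stein identity \<open>pick_stein\<close> says that the matrices \<open>M = [Y | V]\<close> and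
  \<open>N = [c I | V Z]\<close>, \<open>Z = r X\<close>, satisfy \<open>M M\<^sup>* = N N\<^sup>*\<close>. The contraction \<open>U\<close> with \<open>M = N U\<close> is the
  realization of an interpolant.\<close>

lemma interpolation:
  assumes g: "resolvent r \<rho>" and r: "0 \<le> r" "r < 1" and c: "0 \<le> c"
    and Y: "\<And>i j. i < s \<Longrightarrow> j < t \<Longrightarrow> Y i j \<in> carrier_mat n n"
    and pos: "pos_on ({..<n} \<times> {..<n} \<times> {..<s}) \<gamma> (pick t c Y \<rho>)" "0 < \<gamma>"
  shows "\<exists>f. (\<forall>i<s. \<forall>j<t. f i j \<in> H_infinity d) \<and> (\<forall>i<s. \<forall>j<t. f i j (scale_tuple r X) = Y i j) \<and>
    sup_norm d s t f \<le> ereal c"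
proof -
  define I where "I = {..<n} \<times> {..<n} \<times> {..<s}"
  have finI: "finite I" by (simp add: I_def)
  have posI: "pos_on I \<gamma> (pick t c Y \<rho>)" using pos(1) by (simp add: I_def)
  obtain c' V where V: "pos_on I c' V" "\<And>x y. x \<in> I \<Longrightarrow> y \<in> I \<Longrightarrow> mult_on I V V x y = pick t c Y \<rho> x y"
    by (rule square_root_exists[OF finI posI pos(2)]) blast
  have hV: "cnj (V x y) = V y x" if "x \<in> I" "y \<in> I" for x y
    using pos_on_hermitian[OF V(1)] that by (simp add: hermitian_on_def)
  have VV: "(\<Sum>k\<in>I. V x k * cnj (V y k)) = pick t c Y \<rho> x y" if "x \<in> I" "y \<in> I" for x y
    unfolding V(2)[OF that, symmetric] mult_on_def using that by (intro sum.cong) (auto simp: hV)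
  \<comment> \<open>J indexes inputs and states, L indexes outputs and d copies of the states; the
    state space has the index set I of the Pick matrix.\<close>
  define J where "J = {..<t} <+> I"
  define L where "L = {..<s} <+> I \<times> {..<d}"
  define M where "M = (\<lambda>(a, p, i) j. case j of Inl l \<Rightarrow> entries (Y i l) p a | Inr k \<Rightarrow> V (a, p, i) k)"
  define N where "N = (\<lambda>(a, p, i) j. case j of Inl i' \<Rightarrow> of_real c * kdelta i i' * kdelta p a
    | Inr (k, e) \<Rightarrow> (\<Sum>x<n. V (x, p, i) k * (of_real r * entries (X ! e) x a)))"
  have fin: "finite J" "finite L" by (simp_all add: J_def L_def finI)
  have sumJ: "(\<Sum>j\<in>J. f j) = (\<Sum>l<t. f (Inl l)) + (\<Sum>k\<in>I. f (Inr k))" for f :: "_ \<Rightarrow> 'z::comm_monoid_add"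
    by (simp add: J_def sum.Plus finI)
  have sumL: "(\<Sum>j\<in>L. f j) = (\<Sum>i<s. f (Inl i)) + (\<Sum>k\<in>I. \<Sum>e<d. f (Inr (k, e)))" for f :: "_ \<Rightarrow> 'z::comm_monoid_add"
    by (simp add: L_def sum.Plus finI sum_Times)
  have MM: "mult_on J M (adj M) (a, p, i) (b, q, j) =
      (\<Sum>l<t. entries (Y i l) p a * cnj (entries (Y j l) q b)) + pick t c Y \<rho> (a, p, i) (b, q, j)"
    if "(a, p, i) \<in> I" "(b, q, j) \<in> I" for a p i b q j
    using VV[OF that] by (simp add: mult_on_def adj_def sumJ M_def)
  have NN: "mult_on L N (adj N) (a, p, i) (b, q, j) = of_real (c\<^sup>2) * kdelta i j * (kdelta a p * kdelta b q) +
      of_real (r\<^sup>2) * (\<Sum>e<d. \<Sum>x<n. \<Sum>y<n. entries (X ! e) x a * pick t c Y \<rho> (x, p, i) (y, q, j) * cnj (entries (X ! e) y b))"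
    if "(a, p, i) \<in> I" "(b, q, j) \<in> I" for a p i b q j
  proof -
    have b: "a < n" "p < n" "i < s" "b < n" "q < n" "j < s" using that by (auto simp: I_def)
    let ?f = "\<lambda>e x y k. of_real (r\<^sup>2) * (entries (X ! e) x a * (V (x, p, i) k * cnj (V (y, q, j) k)) * cnj (entries (X ! e) y b))"
    have "(\<Sum>i'<s. (of_real c * kdelta i i' * kdelta p a) * cnj (of_real c * kdelta j i' * kdelta q b)) =
        (\<Sum>i'<s. if i' = i then of_real (c\<^sup>2) * kdelta i j * (kdelta a p * kdelta b q) else 0)"
      by (intro sum.cong) (auto simp: kdelta_def power2_eq_square)
    then have 1: "(\<Sum>i'<s. (of_real c * kdelta i i' * kdelta p a) * cnj (of_real c * kdelta j i' * kdelta q b)) =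
        of_real (c\<^sup>2) * kdelta i j * (kdelta a p * kdelta b q)" using b by simp
    have "(\<Sum>k\<in>I. \<Sum>e<d. (\<Sum>x<n. V (x, p, i) k * (of_real r * entries (X ! e) x a)) *
        cnj (\<Sum>y<n. V (y, q, j) k * (of_real r * entries (X ! e) y b))) =
        (\<Sum>k\<in>I. \<Sum>e<d. \<Sum>x<n. \<Sum>y<n. ?f e x y k)"
      by (simp add: sum_product power2_eq_square mult_ac)
    also have "\<dots> = (\<Sum>e<d. \<Sum>k\<in>I. \<Sum>x<n. \<Sum>y<n. ?f e x y k)"
      by (rule sum.swap)
    also have "\<dots> = (\<Sum>e<d. \<Sum>x<n. \<Sum>k\<in>I. \<Sum>y<n. ?f e x y k)"
      by (intro sum.cong refl sum.swap)
    also have "\<dots> = (\<Sum>e<d. \<Sum>x<n. \<Sum>y<n. \<Sum>k\<in>I. ?f e x y k)"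
      by (intro sum.cong refl sum.swap)
    also have "\<dots> = (\<Sum>e<d. \<Sum>x<n. \<Sum>y<n. of_real (r\<^sup>2) * (entries (X ! e) x a * pick t c Y \<rho> (x, p, i) (y, q, j) * cnj (entries (X ! e) y b)))"
    proof (intro sum.cong refl)
      fix e x y assume "x \<in> {..<n}" "y \<in> {..<n}"
      then have xy: "(x, p, i) \<in> I" "(y, q, j) \<in> I" using b by (auto simp: I_def)
      show "(\<Sum>k\<in>I. ?f e x y k) =
          of_real (r\<^sup>2) * (entries (X ! e) x a * pick t c Y \<rho> (x, p, i) (y, q, j) * cnj (entries (X ! e) y b))"
        unfolding VV[OF xy, symmetric] by (simp only: sum_distrib_left sum_distrib_right)
    qed
    finally show ?thesis using 1
      by (simp add: mult_on_def adj_def sumL N_def sum_distrib_left)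
  qed
  have eq: "mult_on J M (adj M) x y = mult_on L N (adj N) x y" if xy: "x \<in> I" "y \<in> I" for x y
  proof -
    obtain a p i b q j where [simp]: "x = (a, p, i)" "y = (b, q, j)" by (metis prod_cases3)
    have b: "a < n" "p < n" "b < n" "q < n" using xy by (auto simp: I_def)
    show ?thesis
      using pick_stein[OF g b(1,3,2,4), of t c Y i j] MM[of a p i b q j] NN[of a p i b q j] xy
      by (simp add: stein_def diff_eq_eq algebra_simps)
  qed
  \<comment> \<open>N N^* = M M^* is the Pick matrix plus the semidefinite contribution of Y, so it
    keeps the bound \<gamma>.\<close>
  have posN: "pos_on I \<gamma> (mult_on L N (adj N))"
    unfolding pos_on_def
  proof (intro conjI allI)
    show "hermitian_on I (mult_on L N (adj N))"
      by (simp add: hermitian_on_def mult_on_def adj_def mult.commute)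
    fix v
    define M1 :: "nat \<times> nat \<times> nat \<Rightarrow> nat \<Rightarrow> complex" where "M1 = (\<lambda>(a, p, i) l. entries (Y i l) p a)"
    have "form_on I (mult_on L N (adj N)) v =
        form_on I (\<lambda>x y. mult_on {..<t} M1 (adj M1) x y + pick t c Y \<rho> x y) v"
    proof (rule form_on_cong)
      fix x y assume xy: "x \<in> I" "y \<in> I"
      obtain a p i b q j where [simp]: "x = (a, p, i)" "y = (b, q, j)" by (metis prod_cases3)
      show "mult_on L N (adj N) x y = mult_on {..<t} M1 (adj M1) x y + pick t c Y \<rho> x y"
        unfolding eq[OF xy, symmetric] using MM xy by (simp add: M1_def) (simp add: mult_on_def adj_def)
    qed
    also have "\<dots> = of_real (norm2_on {..<t} (app_on I (adj M1) v)) + form_on I (pick t c Y \<rho>) v"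
      unfolding form_on_add unfolding form_on_def[of I "mult_on {..<t} M1 (adj M1)"] app_on_mult[symmetric]
      by (subst (1) inner_on_app_on) (simp add: inner_on_self)
    finally show "\<gamma> * norm2_on I v \<le> Re (form_on I (mult_on L N (adj N)) v)"
      using pos_onD[OF posI, of v] by (simp add: add_increasing)
  qed
  obtain U where U: "\<And>x j. x \<in> I \<Longrightarrow> mult_on L N U x j = M x j"
    and contr: "\<And>w. norm2_on L (app_on J U w) \<le> norm2_on J w"
  proof (rule lurking_contraction[OF finI fin eq posN pos(2)])
    fix U
    assume "\<And>x j. x \<in> I \<Longrightarrow> mult_on L N U x j = M x j" "\<And>w. norm2_on L (app_on J U w) \<le> norm2_on J w"
    then show thesis by (rule that)
  qed
  interpret R: contractive_realization s t d I "\<lambda>i l. U (Inl i) (Inl l)" "\<lambda>i k. U (Inl i) (Inr k)"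
    "\<lambda>k e l. U (Inr (k, e)) (Inl l)" "\<lambda>k e k'. U (Inr (k, e)) (Inr k')"
  proof
    fix u :: "nat \<Rightarrow> complex" and h :: "nat \<times> nat \<times> nat \<Rightarrow> complex"
    show "(\<Sum>i<s. (cmod ((\<Sum>l<t. U (Inl i) (Inl l) * u l) + (\<Sum>k\<in>I. U (Inl i) (Inr k) * h k)))\<^sup>2) +
        (\<Sum>k\<in>I. \<Sum>e<d. (cmod ((\<Sum>l<t. U (Inr (k, e)) (Inl l) * u l) + (\<Sum>k'\<in>I. U (Inr (k, e)) (Inr k') * h k')))\<^sup>2) \<le>
        (\<Sum>l<t. (cmod (u l))\<^sup>2) + (\<Sum>k\<in>I. (cmod (h k))\<^sup>2)"
      using contr[of "\<lambda>j. case j of Inl l \<Rightarrow> u l | Inr k \<Rightarrow> h k"]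
      by (simp add: norm2_on_def app_on_def sumJ sumL)
  qed (use finI d_pos in auto)
  let ?Z = "scale_tuple r X"
  have Z: "row_contraction d n ?Z" by (rule row_ball_contraction[OF scale_tuple_row_ball[OF r]])
  have "R.transfer (of_real c) i l ?Z = Y i l" if il: "i < s" "l < t" for i l
  proof (rule eq_matI)
    fix p q assume "p < dim_row (Y i l)" "q < dim_col (Y i l)"
    then have pq: "p < n" "q < n" using Y[OF il] by auto
    define u :: "nat \<Rightarrow> nat \<Rightarrow> complex" where "u = (\<lambda>l' p. kdelta l' l * kdelta p q)"
    define h where "h = R.unit_state n ?Z l q"
    have st: "R.state n ?Z u h" unfolding u_def h_def by (rule R.unit_state[OF Z])
    \<comment> \<open>Row (a, p, i) of M w = N (U w) is summed over a, which turns the column index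
      a into matrix multiplication at level n. On the right U w consists of response and drive, and
      Z times the drive is the state again; V h then occurs on both sides, and c times the response
      equals Y u.\<close>
    define w where "w a = (\<lambda>j. case j of Inl l' \<Rightarrow> u l' a | Inr k \<Rightarrow> h k a)" for a
    have "(\<Sum>a<n. app_on J M (w a) (a, p, i)) = (\<Sum>a<n. app_on L N (app_on J U (w a)) (a, p, i))"
      unfolding app_on_mult using il pq
      by (intro sum.cong refl) (simp add: app_on_def U I_def)
    also have "\<dots> = (\<Sum>a<n. of_real c * kdelta p a * R.response u h i a +
        (\<Sum>k\<in>I. \<Sum>e<d. (\<Sum>x<n. V (x, p, i) k * (of_real r * entries (X ! e) x a)) * R.drive u h k e a))"
    proof (intro sum.cong refl)
      fix a
      have U1: "app_on J U (w a) (Inl i') = R.response u h i' a" for i'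
        by (simp add: app_on_def sumJ w_def R.response_def)
      have U2: "app_on J U (w a) (Inr (k, e)) = R.drive u h k e a" for k e
        by (simp add: app_on_def sumJ w_def R.drive_def)
      have "(\<Sum>i'<s. of_real c * kdelta i i' * kdelta p a * R.response u h i' a) =
          (\<Sum>i'<s. if i' = i then of_real c * kdelta p a * R.response u h i' a else 0)"
        by (intro sum.cong) (auto simp: kdelta_def)
      then have "(\<Sum>i'<s. of_real c * kdelta i i' * kdelta p a * R.response u h i' a) =
          of_real c * kdelta p a * R.response u h i a" using il by simp
      then show "app_on L N (app_on J U (w a)) (a, p, i) = of_real c * kdelta p a * R.response u h i a +
          (\<Sum>k\<in>I. \<Sum>e<d. (\<Sum>x<n. V (x, p, i) k * (of_real r * entries (X ! e) x a)) * R.drive u h k e a)"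
        unfolding app_on_def[of L] sumL U1 U2 by (simp add: N_def)
    qed
    also have "\<dots> = of_real c * R.response u h i p + (\<Sum>k\<in>I. \<Sum>x<n. V (x, p, i) k * h k x)"
    proof -
      have "(\<Sum>a<n. of_real c * kdelta p a * R.response u h i a) =
          (\<Sum>a<n. if a = p then of_real c * R.response u h i a else 0)"
        by (intro sum.cong) (auto simp: kdelta_def)
      then have 1: "(\<Sum>a<n. of_real c * kdelta p a * R.response u h i a) = of_real c * R.response u h i p"
        using pq by simp
      have "(\<Sum>a<n. \<Sum>k\<in>I. \<Sum>e<d. (\<Sum>x<n. V (x, p, i) k * (of_real r * entries (X ! e) x a)) * R.drive u h k e a) =
          (\<Sum>k\<in>I. \<Sum>a<n. \<Sum>e<d. \<Sum>x<n. V (x, p, i) k * (?Z ! e $$ (x, a) * R.drive u h k e a))"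
      proof -
        have "?Z ! e $$ (x, a) = of_real r * entries (X ! e) x a" if "e < d" "x < n" "a < n" for e x a
        proof -
          have "length X = d" "X ! e \<in> carrier_mat n n" using X that by (auto simp: mat_tuples_def)
          then show ?thesis using that by (simp add: scale_tuple_def entries_def)
        qed
        then show ?thesis
          by (subst sum.swap, intro sum.cong refl) (simp add: sum_distrib_right mult.assoc)
      qed
      also have "\<dots> = (\<Sum>k\<in>I. \<Sum>e<d. \<Sum>a<n. \<Sum>x<n. V (x, p, i) k * (?Z ! e $$ (x, a) * R.drive u h k e a))"
        by (intro sum.cong refl sum.swap)
      also have "\<dots> = (\<Sum>k\<in>I. \<Sum>e<d. \<Sum>x<n. \<Sum>a<n. V (x, p, i) k * (?Z ! e $$ (x, a) * R.drive u h k e a))"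
        by (intro sum.cong refl sum.swap)
      also have "\<dots> = (\<Sum>k\<in>I. \<Sum>x<n. \<Sum>e<d. \<Sum>a<n. V (x, p, i) k * (?Z ! e $$ (x, a) * R.drive u h k e a))"
        by (intro sum.cong refl sum.swap)
      also have "\<dots> = (\<Sum>k\<in>I. \<Sum>x<n. V (x, p, i) k * h k x)"
        using st by (intro sum.cong refl) (simp add: R.state_def sum_distrib_left)
      finally show ?thesis using 1 by (simp add: sum.distrib)
    qed
    finally have "(\<Sum>a<n. app_on J M (w a) (a, p, i)) =
        of_real c * R.response u h i p + (\<Sum>k\<in>I. \<Sum>x<n. V (x, p, i) k * h k x)" .
    moreover have "(\<Sum>a<n. app_on J M (w a) (a, p, i)) = entries (Y i l) p q + (\<Sum>k\<in>I. \<Sum>x<n. V (x, p, i) k * h k x)"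
    proof -
      have "(\<Sum>a<n. \<Sum>l'<t. entries (Y i l') p a * u l' a) =
          (\<Sum>a<n. \<Sum>l'<t. if a = q then if l' = l then entries (Y i l') p a else 0 else 0)"
        by (intro sum.cong) (auto simp: u_def kdelta_def)
      also have "\<dots> = entries (Y i l) p q" by (rule sum_pair_delta) (use pq il in auto)
      finally have "(\<Sum>a<n. \<Sum>l'<t. entries (Y i l') p a * u l' a) = entries (Y i l) p q" .
      moreover have "(\<Sum>a<n. \<Sum>k\<in>I. V (a, p, i) k * h k a) = (\<Sum>k\<in>I. \<Sum>x<n. V (x, p, i) k * h k x)"
        by (rule sum.swap)
      ultimately show ?thesis by (simp add: app_on_def sumJ M_def w_def sum.distrib)
    qed
    ultimately have "of_real c * R.response u h i p = entries (Y i l) p q" by simp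
    moreover have "dim_row (?Z ! 0) = n" using R.row_contraction_dim[OF Z d_pos] by simp
    ultimately show "R.transfer (of_real c) i l ?Z $$ (p, q) = Y i l $$ (p, q)"
      using pq by (simp add: R.transfer_def Let_def u_def h_def entries_def)
  qed (use R.transfer_carrier[OF Z] Y[OF il] in auto)
  moreover have "R.transfer (of_real c) i l \<in> H_infinity d" if "i < s" "l < t" for i l
    by (rule R.transfer_H_infinity[OF that])
  moreover have "sup_norm d s t (R.transfer (of_real c)) \<le> ereal c"
    using R.transfer_sup_norm[of "of_real c"] c by simp
  ultimately show ?thesis by blast
qed

end

section \<open>Convergence\<close>

lemma block_mat_cong:
  "(\<And>i j. i < s \<Longrightarrow> j < t \<Longrightarrow> Y i j = Y' i j) \<Longrightarrow> block_mat s t m Y = block_mat s t m Y'"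
  unfolding block_mat_def by (intro cong_mat refl) (auto simp: less_mult_imp_div_less)

section \<open>The limit of the Nevanlinna-Pick norms\<close>

context row_coisometry_mat
begin

lemma NP_norm_lower:
  assumes "0 \<le> r" "r < 1"
  shows "ereal (op_norm (block_mat s t n Y)) \<le> NP_norm d s t (scale_tuple r X) Y"
  unfolding NP_norm_def
proof (rule Inf_greatest)
  fix b
  assume "b \<in> {sup_norm d s t f | f. (\<forall>i<s. \<forall>j<t. f i j \<in> H_infinity d) \<and>
    (\<forall>i<s. \<forall>j<t. f i j (scale_tuple r X) = Y i j)}"
  then obtain f where f: "b = sup_norm d s t f" "\<forall>i<s. \<forall>j<t. f i j (scale_tuple r X) = Y i j" by auto
  have "block_mat s t n (\<lambda>i j. f i j (scale_tuple r X)) = block_mat s t n Y"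
    by (rule block_mat_cong) (use f(2) in auto)
  then have "ereal (op_norm (block_mat s t n Y)) = ereal (op_norm (block_mat s t n (\<lambda>i j. f i j (scale_tuple r X))))"
    by simp
  also have "\<dots> \<le> (SUP Z\<in>row_ball d n. ereal (op_norm (block_mat s t n (\<lambda>i j. f i j Z))))"
    by (rule SUP_upper) (rule scale_tuple_row_ball[OF assms])
  also have "\<dots> \<le> b"
    unfolding f(1) sup_norm_def
    by (rule SUP_upper[of n "{1..}" "\<lambda>m. SUP Z\<in>row_ball d m. ereal (op_norm (block_mat s t m (\<lambda>i j. f i j Z)))"])
       (use n_pos in simp)
  finally show "ereal (op_norm (block_mat s t n Y)) \<le> b" .
qed

definition defect :: "nat \<Rightarrow> real \<Rightarrow> (nat \<Rightarrow> nat \<Rightarrow> complex mat) \<Rightarrow> nat \<times> nat \<Rightarrow> nat \<times> nat \<Rightarrow> complex" where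
  "defect t c Y = (\<lambda>(p, i) (q, j). of_real (c\<^sup>2) * kdelta i j * kdelta p q -
    (\<Sum>l<t. \<Sum>k<n. entries (Y i l) p k * cnj (entries (Y j l) q k)))"

text \<open>\<open>defect\<close> is c^2 - Y Y^* in the index order of the Pick matrix, and Y^* has
  the same norm as Y.\<close>

lemma defect_pos:
  assumes "op_norm (block_mat s t n Y) < c"
  shows "pos_on ({..<n} \<times> {..<s}) (c\<^sup>2 - (op_norm (block_mat s t n Y))\<^sup>2) (defect t c Y)"
  unfolding pos_on_def
proof (intro conjI allI)
  let ?I = "{..<n} \<times> {..<s}" and ?J = "{..<t} \<times> {..<n}" and ?y = "op_norm (block_mat s t n Y)"
  define B where "B = (\<lambda>x z. entries (Y (snd x) (fst z)) (fst x) (snd z) :: complex)"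
  have def: "defect t c Y x y = of_real (c\<^sup>2) * kdelta x y - mult_on ?J B (adj B) x y" for x y
    by (cases x; cases y) (auto simp: defect_def kdelta_def mult_on_def adj_def B_def sum_Times)
  show "hermitian_on ?I (defect t c Y)"
    unfolding hermitian_on_def def by (simp add: mult_on_def adj_def mult.commute) (simp add: kdelta_def)
  fix v
  have fin: "finite ?I" "finite ?J" by auto
  have "norm2_on ?I (app_on ?J B w) \<le> ?y\<^sup>2 * norm2_on ?J w" for w
  proof -
    have "norm2_on ?I (app_on ?J B w) =
        (\<Sum>p<n. \<Sum>i<s. (cmod (\<Sum>l<t. \<Sum>q<n. Y i l $$ (p, q) * w (l, q)))\<^sup>2)"
      by (simp add: norm2_on_def app_on_def sum_Times B_def entries_def)
    also have "\<dots> = (\<Sum>i<s. \<Sum>p<n. (cmod (\<Sum>l<t. \<Sum>q<n. Y i l $$ (p, q) * w (l, q)))\<^sup>2)"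
      by (rule sum.swap)
    also have "\<dots> \<le> ?y\<^sup>2 * (\<Sum>l<t. \<Sum>q<n. (cmod (w (l, q)))\<^sup>2)"
      by (rule block_mat_bound[where u = "\<lambda>l q. w (l, q)"])
    finally show ?thesis by (simp add: norm2_on_def sum_Times)
  qed
  then have "norm2_on ?J (app_on ?I (adj B) v) \<le> ?y\<^sup>2 * norm2_on ?I v"
    by (intro app_on_adj_bound fin) auto
  moreover have "form_on ?I (mult_on ?J B (adj B)) v = of_real (norm2_on ?J (app_on ?I (adj B) v))"
    unfolding form_on_def app_on_mult[symmetric] by (subst inner_on_app_on) (simp add: inner_on_self)
  moreover have "form_on ?I (defect t c Y) v = of_real (c\<^sup>2 * norm2_on ?I v) - form_on ?I (mult_on ?J B (adj B)) v"
    unfolding def form_on_diff form_on_scale by (simp add: form_on_kdelta)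
  ultimately show "(c\<^sup>2 - ?y\<^sup>2) * norm2_on ?I v \<le> Re (form_on ?I (defect t c Y) v)"
    by (simp add: left_diff_distrib)
qed

text \<open>The residue of g in its last two indices is a multiple of the identity, so the double
  sum over k and m collapses to Y Y^*.\<close>

lemma pick_tendsto:
  assumes "a < n" "b < n" "p < n" "q < n"
  shows "((\<lambda>r. of_real (1 - r\<^sup>2) * pick t c Y (g r) (a, p, i) (b, q, j)) \<longlongrightarrow>
    \<phi> a b * defect t c Y (p, i) (q, j)) (at_left 1)"
proof -
  let ?y = "\<lambda>l k m. entries (Y i l) p k * cnj (entries (Y j l) q m)"
  have eq: "of_real (1 - r\<^sup>2) * pick t c Y (g r) (a, p, i) (b, q, j) =
      of_real (c\<^sup>2) * kdelta i j * (of_real (1 - r\<^sup>2) * g r a b p q) -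
      (\<Sum>l<t. \<Sum>k<n. \<Sum>m<n. ?y l k m * (of_real (1 - r\<^sup>2) * g r a b k m))" for r
    by (simp add: pick_def right_diff_distrib sum_distrib_left mult_ac)
  have "((\<lambda>r. of_real (1 - r\<^sup>2) * pick t c Y (g r) (a, p, i) (b, q, j)) \<longlongrightarrow>
      of_real (c\<^sup>2) * kdelta i j * (kdelta p q * \<phi> a b) -
      (\<Sum>l<t. \<Sum>k<n. \<Sum>m<n. ?y l k m * (kdelta k m * \<phi> a b))) (at_left 1)"
    unfolding eq by (intro tendsto_diff tendsto_mult tendsto_const tendsto_sum g_tendsto assms) auto
  also have "(\<Sum>l<t. \<Sum>k<n. \<Sum>m<n. ?y l k m * (kdelta k m * \<phi> a b)) =
      (\<Sum>l<t. \<Sum>k<n. ?y l k k * \<phi> a b)"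
  proof (intro sum.cong refl)
    fix l k assume "k \<in> {..<n}"
    have "(\<Sum>m<n. ?y l k m * (kdelta k m * \<phi> a b)) =
        (\<Sum>m<n. if m = k then entries (Y i l) p k * cnj (entries (Y j l) q m) * \<phi> a b else 0)"
      by (intro sum.cong) (auto simp: kdelta_def)
    then show "(\<Sum>m<n. ?y l k m * (kdelta k m * \<phi> a b)) =
        ?y l k k * \<phi> a b" using \<open>k \<in> {..<n}\<close> by simp
  qed
  also have "of_real (c\<^sup>2) * kdelta i j * (kdelta p q * \<phi> a b) -
      (\<Sum>l<t. \<Sum>k<n. ?y l k k * \<phi> a b) = \<phi> a b * defect t c Y (p, i) (q, j)"
    by (simp add: defect_def right_diff_distrib sum_distrib_left mult_ac)
  finally show ?thesis .
qed

lemma NP_norm_upper: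
  assumes Y: "\<And>i j. i < s \<Longrightarrow> j < t \<Longrightarrow> Y i j \<in> carrier_mat n n"
    and c: "op_norm (block_mat s t n Y) < c"
  shows "\<forall>\<^sub>F r in at_left 1. NP_norm d s t (scale_tuple r X) Y \<le> ereal c"
proof -
  let ?I = "{..<n} \<times> {..<n} \<times> {..<s}"
  have y: "0 \<le> op_norm (block_mat s t n Y)"
    by (rule op_norm_bound(2)[OF block_mat_carrier, of "0\<^sub>v (t * n)"]) simp
  obtain \<alpha> where \<alpha>: "0 < \<alpha>" "pos_on {..<n} \<alpha> \<phi>" by (rule \<phi>_pos)
  define \<beta> where "\<beta> = c\<^sup>2 - (op_norm (block_mat s t n Y))\<^sup>2"
  have \<beta>: "0 < \<beta>" unfolding \<beta>_def using c y by (simp add: power_strict_mono)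
  have lim_pos: "pos_on ?I (\<alpha> * \<beta>) (\<lambda>x y. \<phi> (fst x) (fst y) * defect t c Y (snd x) (snd y))"
    unfolding \<beta>_def by (rule pos_on_tensor[OF _ _ \<alpha>(2,1) defect_pos[OF c]]) (use \<beta> in \<open>auto simp: \<beta>_def\<close>)
  have "\<forall>\<^sub>F r in at_left 1. pos_on ?I (\<alpha> * \<beta> / 2) (\<lambda>x y. of_real (1 - r\<^sup>2) * pick t c Y (g r) x y)"
  proof (rule pos_on_perturb[OF _ lim_pos])
    show "((\<lambda>r. of_real (1 - r\<^sup>2) * pick t c Y (g r) x y) \<longlongrightarrow>
        \<phi> (fst x) (fst y) * defect t c Y (snd x) (snd y)) (at_left 1)" if "x \<in> ?I" "y \<in> ?I" for x y
    proof -
      obtain a p i b q j where [simp]: "x = (a, p, i)" "y = (b, q, j)" by (metis prod_cases3)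
      show ?thesis using pick_tendsto[of a b p q t c Y i j] that by simp
    qed
    show "\<forall>\<^sub>F r in at_left 1. hermitian_on ?I (\<lambda>x y. of_real (1 - r\<^sup>2) * pick t c Y (g r) x y)"
      using eventually_T
    proof eventually_elim
      case (elim r)
      show ?case by (rule hermitian_on_scale[OF pick_hermitian[OF resolvent_g]]) (use elim in auto)
    qed
  qed (use \<alpha> \<beta> in auto)
  with eventually_T show ?thesis
  proof eventually_elim
    case (elim r)
    \<comment> \<open>The scaling is undone here. The bound may depend on r, since
      \<open>interpolation\<close> is applied for each r separately.\<close>
    define \<delta> where "\<delta> = \<alpha> * \<beta> / 2 / (1 - r\<^sup>2)"
    have r2: "0 < 1 - r\<^sup>2" using elim by simp
    have "pos_on ?I \<delta> (pick t c Y (g r))"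
      unfolding pos_on_def
    proof (intro conjI allI)
      show "hermitian_on ?I (pick t c Y (g r))" by (rule pick_hermitian[OF resolvent_g]) (use elim in auto)
      fix x
      have "\<alpha> * \<beta> / 2 * norm2_on ?I x \<le> (1 - r\<^sup>2) * Re (form_on ?I (pick t c Y (g r)) x)"
        using pos_onD[OF elim(2), of x] unfolding form_on_scale by (simp del: of_real_diff)
      then show "\<delta> * norm2_on ?I x \<le> Re (form_on ?I (pick t c Y (g r)) x)"
        using r2 by (simp add: \<delta>_def field_simps)
    qed
    moreover have "0 < \<delta>" using \<alpha> \<beta> r2 by (simp add: \<delta>_def)
    ultimately obtain f where f: "\<forall>i<s. \<forall>j<t. f i j \<in> H_infinity d"
      "\<forall>i<s. \<forall>j<t. f i j (scale_tuple r X) = Y i j" "sup_norm d s t f \<le> ereal c"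
      using interpolation[OF resolvent_g, of r c s t Y \<delta>] elim c y Y by auto
    have "NP_norm d s t (scale_tuple r X) Y \<le> sup_norm d s t f"
      unfolding NP_norm_def by (rule Inf_lower) (use f in blast)
    then show ?case using f(3) by (rule order.trans)
  qed
qed

lemma NP_norm_tendsto:
  assumes Y: "\<And>i j. i < s \<Longrightarrow> j < t \<Longrightarrow> Y i j \<in> carrier_mat n n"
  shows "((\<lambda>r. NP_norm d s t (scale_tuple r X) Y) \<longlongrightarrow> ereal (op_norm (block_mat s t n Y))) (at_left 1)"
proof (rule order_tendstoI)
  fix a assume a: "a < ereal (op_norm (block_mat s t n Y))"
  show "\<forall>\<^sub>F r in at_left 1. a < NP_norm d s t (scale_tuple r X) Y"
    using eventually_T
  proof eventually_elim
    case (elim r)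
    then show ?case using order.strict_trans2[OF a NP_norm_lower[of r]] by simp
  qed
next
  fix a assume "ereal (op_norm (block_mat s t n Y)) < a"
  \<comment> \<open>A real number strictly between, also for infinite a, gives the slack that the
    positivity argument needs.\<close>
  then obtain c where c: "op_norm (block_mat s t n Y) < c" "ereal c < a"
    using ereal_dense2[of "ereal (op_norm (block_mat s t n Y))" a] by auto
  show "\<forall>\<^sub>F r in at_left 1. NP_norm d s t (scale_tuple r X) Y < a"
  proof -
    have "\<forall>\<^sub>F r in at_left 1. NP_norm d s t (scale_tuple r X) Y \<le> ereal c"
      by (rule NP_norm_upper) (use Y c(1) in auto)
    then show ?thesis by eventually_elim (use c(2) in auto)
  qed
qed

end

section \<open>The limit of the conjugation by square roots\<close>

lemma kron_smult_left: "kron (z \<cdot>\<^sub>m A) B = z \<cdot>\<^sub>m kron A B"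
proof (rule eq_matI)
  fix k l assume kl: "k < dim_row (z \<cdot>\<^sub>m kron A B)" "l < dim_col (z \<cdot>\<^sub>m kron A B)"
  then have "k div dim_row B < dim_row A" "l div dim_col B < dim_col A"
    by (auto simp: less_mult_imp_div_less)
  then show "kron (z \<cdot>\<^sub>m A) B $$ (k, l) = (z \<cdot>\<^sub>m kron A B) $$ (k, l)"
    using kl by (simp add: kron_def mult.assoc)
qed auto

lemma pos_on_lessThan_mult:
  fixes a b :: nat
  assumes "pos_on ({..<a} \<times> {..<b}) c (\<lambda>x y. A (fst x * b + snd x) (fst y * b + snd y))"
  shows "pos_on {..<a * b} c A"
  unfolding pos_on_def
proof (intro conjI allI)
  show "hermitian_on {..<a * b} A"
    unfolding hermitian_on_def
  proof (intro ballI)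
    fix k l assume "k \<in> {..<a * b}" "l \<in> {..<a * b}"
    then obtain i p j q where *: "i < a" "p < b" "k = i * b + p" "j < a" "q < b" "l = j * b + q"
      using ex_mult_add[of k a b] ex_mult_add[of l a b] by auto
    then show "cnj (A k l) = A l k"
      using pos_on_hermitian[OF assms] unfolding hermitian_on_def by force
  qed
  fix v :: "nat \<Rightarrow> complex"
  let ?v = "\<lambda>x. v (fst x * b + snd x)"
  have "norm2_on {..<a * b} v = norm2_on ({..<a} \<times> {..<b}) ?v"
    by (simp add: norm2_on_def sum_lessThan_mult sum_Times)
  moreover have "form_on {..<a * b} A v =
      form_on ({..<a} \<times> {..<b}) (\<lambda>x y. A (fst x * b + snd x) (fst y * b + snd y)) ?v"
    by (simp add: form_on_eq sum_lessThan_mult sum_Times)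
  ultimately show "c * norm2_on {..<a * b} v \<le> Re (form_on {..<a * b} A v)"
    using pos_onD[OF assms, of ?v] by simp
qed

lemma pos_on_det:
  assumes "A \<in> carrier_mat n n" "pos_on {..<n} c (entries A)" "0 < c"
  shows "det A \<noteq> 0"
proof
  assume "det A = 0"
  then obtain v where v: "v \<in> carrier_vec n" "v \<noteq> 0\<^sub>v n" "A *\<^sub>v v = 0\<^sub>v n"
    using det_0_iff_vec_prod_zero[OF assms(1)] by auto
  have "app_on {..<n} (entries A) (\<lambda>i. v $ i) i = 0" if "i < n" for i
  proof -
    have "(A *\<^sub>v v) $ i = 0" using v(3) that by simp
    then show ?thesis using assms(1) v(1) that by (simp add: app_on_def entries_def scalar_prod_def lessThan_atLeast0)
  qed
  then have "v $ i = 0" if "i < n" for i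
    using pos_on_injective[OF _ assms(2,3), of "\<lambda>i. v $ i" i] that by auto
  then show False using v(1,2) by (auto intro: eq_vecI)
qed

lemma entries_mult: "A \<in> carrier_mat a b \<Longrightarrow> B \<in> carrier_mat b c \<Longrightarrow> i < a \<Longrightarrow> j < c \<Longrightarrow>
    mult_on {..<b} (entries A) (entries B) i j = (A * B) $$ (i, j)"
  by (simp add: mult_on_def entries_def scalar_prod_def lessThan_atLeast0)

lemma mat_tendsto_cong:
  assumes "\<forall>\<^sub>F r in F. A r = B r" "mat_tendsto A L F"
  shows "mat_tendsto B L F"
  unfolding mat_tendsto_def
proof (intro conjI allI impI)
  have "\<forall>\<^sub>F r in F. A r \<in> carrier_mat (dim_row L) (dim_col L)" using assms(2) by (simp add: mat_tendsto_def)
  with assms(1) show "\<forall>\<^sub>F r in F. B r \<in> carrier_mat (dim_row L) (dim_col L)" by eventually_elim simp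
  fix p q assume "p < dim_row L" "q < dim_col L"
  from mat_tendsto_index[OF assms(2) this]
  show "((\<lambda>r. B r $$ (p, q)) \<longlongrightarrow> L $$ (p, q)) F"
    by (rule Lim_transform_eventually) (use assms(1) in \<open>eventually_elim, simp\<close>)
qed

context row_coisometry_mat
begin

text \<open>The scaled root is the semidefinite root of the scaled P, whose limit is the square of D
  \<otimes> 1 with D the root of \<phi>; \<open>square_root_tendsto\<close> applies because D
  \<otimes> 1 is bounded below. \<open>mat_sqrt\<close> is identified as a root only where P is
  positive definite, hence only eventually.\<close>

lemma mat_sqrt_P_tendsto:
  obtains D c where "D \<in> carrier_mat n n" "pos_on {..<n} c (entries D)" "0 < c"
    and "mat_tendsto (\<lambda>r. of_real (sqrt (1 - r\<^sup>2)) \<cdot>\<^sub>m mat_sqrt (P_mat n (scale_tuple r X)))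
      (kron D (1\<^sub>m n)) (at_left 1)"
proof -
  let ?P = "\<lambda>r. P_mat n (scale_tuple r X)" and ?n = "{..<n * n}"
  obtain \<alpha> where \<alpha>: "0 < \<alpha>" "pos_on {..<n} \<alpha> \<phi>" by (rule \<phi>_pos)
  obtain c E where E: "0 < c" "pos_on {..<n} c E" "\<And>i j. i \<in> {..<n} \<Longrightarrow> j \<in> {..<n} \<Longrightarrow> mult_on {..<n} E E i j = \<phi> i j"
    by (rule square_root_exists[OF finite_lessThan \<alpha>(2,1)]) blast
  define D where "D = mat n n (\<lambda>(i, j). E i j)"
  have Dc: "D \<in> carrier_mat n n" by (simp add: D_def)
  have D: "entries D i j = E i j" if "i < n" "j < n" for i j using that by (simp add: D_def entries_def)
  have Dpos: "pos_on {..<n} c (entries D)"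
    using E(2) pos_on_cong[of "{..<n}" "entries D" E c] D by simp
  let ?C = "kron D (1\<^sub>m n)"
  have C: "entries ?C (i * n + p) (j * n + q) = entries D i j * kdelta p q" if "i < n" "p < n" "j < n" "q < n" for i p j q
    using that index_kron[of i D p "1\<^sub>m n" j q] Dc by (simp add: entries_def kdelta_def)
  \<comment> \<open>A is the flattened A0 \<otimes> 1. It is applied to D \<otimes> 1 and to the
    limit of the scaled P.\<close>
  have tensor: "pos_on ?n (a * 1) A"
    if A: "pos_on {..<n} a A0" "0 < a"
      and eq: "\<And>i p j q. i < n \<Longrightarrow> p < n \<Longrightarrow> j < n \<Longrightarrow> q < n \<Longrightarrow> A (i * n + p) (j * n + q) = A0 i j * kdelta p q"
    for a A A0
  proof (rule pos_on_lessThan_mult)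
    have "pos_on ({..<n} \<times> {..<n}) (a * 1) (\<lambda>x y. A0 (fst x) (fst y) * kdelta (snd x) (snd y))"
      by (rule pos_on_tensor[OF _ _ A pos_on_kdelta]) auto
    then show "pos_on ({..<n} \<times> {..<n}) (a * 1) (\<lambda>x y. A (fst x * n + snd x) (fst y * n + snd y))"
      by (subst pos_on_cong[where B = "\<lambda>x y. A0 (fst x) (fst y) * kdelta (snd x) (snd y)"]) (auto simp: eq)
  qed
  have Cpos: "pos_on ?n (c * 1) (entries ?C)" by (rule tensor[OF Dpos E(1)]) (rule C)
  define Q where "Q = mult_on ?n (entries ?C) (entries ?C)"
  have Cc: "?C \<in> carrier_mat (n * n) (n * n)" using Dc by auto
  have Q: "Q (i * n + p) (j * n + q) = \<phi> i j * kdelta p q" if "i < n" "p < n" "j < n" "q < n" for i p j q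
  proof -
    have lt: "i * n + p < n * n" "j * n + q < n * n" using that by (auto intro: mult_add_less)
    have "Q (i * n + p) (j * n + q) = (?C * ?C) $$ (i * n + p, j * n + q)"
      unfolding Q_def by (rule entries_mult[OF Cc Cc lt])
    also have "?C * ?C = kron (D * D) (1\<^sub>m n)" using kron_mult[OF Dc Dc one_carrier_mat[of n] one_carrier_mat] by simp
    also have "kron (D * D) (1\<^sub>m n) $$ (i * n + p, j * n + q) = (D * D) $$ (i, j) * kdelta p q"
      using that index_kron[of i "D * D" p "1\<^sub>m n" j q] Dc by (simp add: kdelta_def)
    also have "(D * D) $$ (i, j) = mult_on {..<n} E E i j"
      unfolding entries_mult[OF Dc Dc that(1,3), symmetric] by (simp add: mult_on_def D that)
    finally show ?thesis using E(3) that by simp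
  qed
  have Qpos: "pos_on ?n (\<alpha> * 1) Q" by (rule tensor[OF \<alpha>(2,1) Q])
  have Plim: "((\<lambda>r. of_real (1 - r\<^sup>2) * entries (?P r) k l) \<longlongrightarrow> Q k l) (at_left 1)" if kl: "k \<in> ?n" "l \<in> ?n" for k l
  proof -
    obtain a p b q where *: "a < n" "p < n" "k = a * n + p" "b < n" "q < n" "l = b * n + q"
      using kl ex_mult_add[of k n n] ex_mult_add[of l n n] by auto
    have "((\<lambda>r. of_real (1 - r\<^sup>2) * g r a b p q) \<longlongrightarrow> Q k l) (at_left 1)"
      using g_tendsto[OF *(1,4,2,5)] by (simp add: Q * mult.commute)
    then show ?thesis
    proof (rule Lim_transform_eventually)
      show "\<forall>\<^sub>F r in at_left 1. of_real (1 - r\<^sup>2) * g r a b p q = of_real (1 - r\<^sup>2) * entries (?P r) k l"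
        using eventually_T by eventually_elim (simp add: entries_def * P_mat_index)
    qed
  qed
  have Pherm: "\<forall>\<^sub>F r in at_left 1. hermitian_on ?n (entries (?P r))"
    using eventually_T
  proof eventually_elim
    case (elim r)
    show ?case
      unfolding hermitian_on_def
    proof (intro ballI)
      fix k l assume "k \<in> ?n" "l \<in> ?n"
      then obtain a p b q where *: "a < n" "p < n" "k = a * n + p" "b < n" "q < n" "l = b * n + q"
        using ex_mult_add[of k n n] ex_mult_add[of l n n] by auto
      show "cnj (entries (?P r) k l) = entries (?P r) l k"
        using elim * resolvent_hermitian[OF resolvent_g[of r], of a b p q]
        by (simp add: entries_def P_mat_index)
    qed
  qed
  have "\<forall>\<^sub>F r in at_left 1. hermitian_on ?n (\<lambda>k l. of_real (1 - r\<^sup>2) * entries (?P r) k l)"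
    using Pherm by eventually_elim (rule hermitian_on_scale)
  from pos_on_perturb[OF _ Qpos _ Plim this]
  have Ppos: "\<forall>\<^sub>F r in at_left 1. pos_on ?n (\<alpha> * 1 / 2) (\<lambda>k l. of_real (1 - r\<^sup>2) * entries (?P r) k l)"
    using \<alpha> by simp
  have S: "\<forall>\<^sub>F r in at_left 1. mat_sqrt (?P r) \<in> carrier_mat (n * n) (n * n) \<and>
      mat_sqrt (?P r) * mat_sqrt (?P r) = ?P r \<and> pos_on ?n 0 (entries (mat_sqrt (?P r)))"
    using eventually_T Ppos Pherm
  proof eventually_elim
    case (elim r)
    have r2: "0 < 1 - r\<^sup>2" using elim by simp
    have "pos_on ?n (\<alpha> / 2 / (1 - r\<^sup>2)) (entries (?P r))"
      unfolding pos_on_def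
    proof (intro conjI allI elim(3))
      fix x
      have "\<alpha> / 2 * norm2_on ?n x \<le> (1 - r\<^sup>2) * Re (form_on ?n (entries (?P r)) x)"
        using pos_onD[OF elim(2), of x] unfolding form_on_scale by (simp del: of_real_diff)
      then show "\<alpha> / 2 / (1 - r\<^sup>2) * norm2_on ?n x \<le> Re (form_on ?n (entries (?P r)) x)"
        using r2 by (simp add: field_simps)
    qed
    moreover have "0 < \<alpha> / 2 / (1 - r\<^sup>2)" using \<alpha> r2 by simp
    ultimately obtain c' B where B: "0 < c'" "pos_on ?n c' B"
      "\<And>i j. i \<in> ?n \<Longrightarrow> j \<in> ?n \<Longrightarrow> mult_on ?n B B i j = entries (?P r) i j"
      by (rule square_root_exists[OF finite_lessThan]) blast
    define Bm where "Bm = mat (n * n) (n * n) (\<lambda>(i, j). B i j)"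
    have Bc: "Bm \<in> carrier_mat (n * n) (n * n)" by (simp add: Bm_def)
    have Bpos: "pos_on ?n c' (entries Bm)"
      using B(2) pos_on_cong[of ?n "entries Bm" B c'] by (simp add: Bm_def entries_def)
    have Pc: "?P r \<in> carrier_mat (n * n) (n * n)" by (simp add: P_mat_def psi_def)
    have BB: "Bm * Bm = ?P r"
    proof (rule eq_matI)
      fix i j assume "i < dim_row (?P r)" "j < dim_col (?P r)"
      then have ij: "i < n * n" "j < n * n" using Pc by auto
      have "(Bm * Bm) $$ (i, j) = mult_on ?n B B i j"
        unfolding entries_mult[OF Bc Bc ij, symmetric] using ij by (simp add: mult_on_def Bm_def entries_def)
      then show "(Bm * Bm) $$ (i, j) = ?P r $$ (i, j)" using B(3) ij by (simp add: entries_def)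
    qed (use Bc Pc in auto)
    have "mat_sqrt (?P r) = Bm"
      by (rule mat_sqrt_eqI[OF Pc Bc BB]) (use Bpos B(1) in \<open>auto simp: entries_def\<close>)
    then show ?case using Bc BB pos_on_mono[OF Bpos, of 0] B(1) by simp
  qed
  define W where "W = (\<lambda>r. of_real (sqrt (1 - r\<^sup>2)) \<cdot>\<^sub>m mat_sqrt (?P r))"
  have W: "((\<lambda>r. of_real (sqrt (1 - r\<^sup>2)) * entries (mat_sqrt (?P r)) i j) \<longlongrightarrow> entries ?C i j) (at_left 1)"
    if ij: "i \<in> ?n" "j \<in> ?n" for i j
  proof (rule square_root_tendsto[OF finite_lessThan Cpos _ _ _ ij])
    show "\<forall>\<^sub>F r in at_left 1. pos_on ?n 0 (\<lambda>i j. of_real (sqrt (1 - r\<^sup>2)) * entries (mat_sqrt (?P r)) i j)"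
      using S eventually_T
    proof eventually_elim
      case (elim r)
      have "0 \<le> sqrt (1 - r\<^sup>2)" using elim by simp
      moreover have "0 \<le> Re (form_on ?n (entries (mat_sqrt (?P r))) x)" for x
        using pos_onD[of ?n 0 "entries (mat_sqrt (?P r))" x] elim by simp
      ultimately show ?case
        using elim unfolding pos_on_def form_on_scale by (auto intro!: hermitian_on_scale)
    qed
    fix k l assume kl: "k \<in> ?n" "l \<in> ?n"
    have "((\<lambda>r. of_real (1 - r\<^sup>2) * entries (?P r) k l) \<longlongrightarrow> mult_on ?n (entries ?C) (entries ?C) k l) (at_left 1)"
      using Plim[OF kl] by (simp add: Q_def)
    then show "((\<lambda>r. mult_on ?n (\<lambda>i j. of_real (sqrt (1 - r\<^sup>2)) * entries (mat_sqrt (?P r)) i j)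
        (\<lambda>i j. of_real (sqrt (1 - r\<^sup>2)) * entries (mat_sqrt (?P r)) i j) k l) \<longlongrightarrow>
        mult_on ?n (entries ?C) (entries ?C) k l) (at_left 1)"
    proof (rule Lim_transform_eventually)
      show "\<forall>\<^sub>F r in at_left 1. of_real (1 - r\<^sup>2) * entries (?P r) k l =
          mult_on ?n (\<lambda>i j. of_real (sqrt (1 - r\<^sup>2)) * entries (mat_sqrt (?P r)) i j)
            (\<lambda>i j. of_real (sqrt (1 - r\<^sup>2)) * entries (mat_sqrt (?P r)) i j) k l"
        using S eventually_T
      proof eventually_elim
        case (elim r)
        let ?S = "mat_sqrt (?P r)"
        have "entries (?P r) k l = mult_on ?n (entries ?S) (entries ?S) k l"
          using elim kl entries_mult[of ?S "n * n" "n * n" ?S "n * n" k l] by (simp add: entries_def)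
        moreover have "complex_of_real (1 - r\<^sup>2) = of_real (sqrt (1 - r\<^sup>2)) * of_real (sqrt (1 - r\<^sup>2))"
          unfolding of_real_mult[symmetric] using elim by simp
        ultimately show ?case by (simp only: mult_on_def sum_distrib_left) (simp only: mult_ac)
      qed
    qed
  qed (use E in auto)
  have "mat_tendsto W ?C (at_left 1)"
    unfolding mat_tendsto_def
  proof (intro conjI allI impI)
    show "\<forall>\<^sub>F r in at_left 1. W r \<in> carrier_mat (dim_row ?C) (dim_col ?C)"
      using S by eventually_elim (use Dc in \<open>auto simp: W_def\<close>)
    fix p q assume "p < dim_row ?C" "q < dim_col ?C"
    then have pq: "p \<in> ?n" "q \<in> ?n" using Dc by auto
    have "((\<lambda>r. of_real (sqrt (1 - r\<^sup>2)) * entries (mat_sqrt (?P r)) p q) \<longlongrightarrow> ?C $$ (p, q)) (at_left 1)"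
      using W[OF pq] by (simp add: entries_def)
    then show "((\<lambda>r. W r $$ (p, q)) \<longlongrightarrow> ?C $$ (p, q)) (at_left 1)"
    proof (rule Lim_transform_eventually)
      show "\<forall>\<^sub>F r in at_left 1. of_real (sqrt (1 - r\<^sup>2)) * entries (mat_sqrt (?P r)) p q = W r $$ (p, q)"
        using S by eventually_elim (use pq in \<open>auto simp: W_def entries_def\<close>)
    qed
  qed
  then show ?thesis using that[OF Dc Dpos E(1)] by (simp add: W_def)
qed

text \<open>Only the scaled roots W converge, to an invertible limit, so the limit is computed for W
  in place of the roots; the scalars in W and its inverse cancel.\<close>

lemma block_tensor_tendsto:
  assumes BT: "BT \<in> carrier_mat (n * s) (n * t)"
  shows "mat_tendsto
      (\<lambda>r. kron (mat_inv (mat_sqrt (P_mat n (scale_tuple r X)))) (1\<^sub>m s) * kron (1\<^sub>m n) BT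
           * kron (mat_sqrt (P_mat n (scale_tuple r X))) (1\<^sub>m t))
      (kron (1\<^sub>m n) BT) (at_left 1)"
proof -
  let ?S = "\<lambda>r. mat_sqrt (P_mat n (scale_tuple r X))"
  define W where "W = (\<lambda>r. of_real (sqrt (1 - r\<^sup>2)) \<cdot>\<^sub>m ?S r)"
  obtain D c where D: "D \<in> carrier_mat n n" "pos_on {..<n} c (entries D)" "0 < c"
    and lim: "mat_tendsto W (kron D (1\<^sub>m n)) (at_left 1)"
    unfolding W_def by (rule mat_sqrt_P_tendsto) blast
  let ?C = "kron D (1\<^sub>m n)"
  have Cc: "?C \<in> carrier_mat (n * n) (n * n)" using D(1) by auto
  note Di = mat_inv_invertible[OF D(1) pos_on_det[OF D]]
  have Cinv: "?C * kron (mat_inv D) (1\<^sub>m n) = 1\<^sub>m (n * n)"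
    using kron_mult[OF D(1) Di(1) one_carrier_mat[of n] one_carrier_mat] Di(2) by (simp add: kron_one)
  have Ci: "mat_inv ?C = kron (mat_inv D) (1\<^sub>m n)"
    by (rule mat_inv_eqI[OF Cc _ Cinv]) (use Di(1) in auto)
  have "det ?C * det (kron (mat_inv D) (1\<^sub>m n)) = 1"
    using det_mult[OF Cc kron_carrier[OF Di(1) one_carrier_mat]] Cinv by simp
  then have detC: "det ?C \<noteq> 0" by auto
  have "mat_tendsto (\<lambda>r. kron (mat_inv (W r)) (1\<^sub>m s) * kron (1\<^sub>m n) BT * kron (W r) (1\<^sub>m t))
      (kron (mat_inv ?C) (1\<^sub>m s) * kron (1\<^sub>m n) BT * kron ?C (1\<^sub>m t)) (at_left 1)"
    using BT Di(1) D(1)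
    by (intro mat_tendsto_mult mat_tendsto_kron_left mat_tendsto_mat_inv(1)[OF lim Cc detC] mat_tendsto_const lim)
       (auto simp: Ci)
  also have "kron (mat_inv ?C) (1\<^sub>m s) * kron (1\<^sub>m n) BT * kron ?C (1\<^sub>m t) = kron (1\<^sub>m n) BT"
  proof -
    \<comment> \<open>Regrouping the factors turns both outer matrices into D-parts tensored with an
      identity on the whole space of BT, where the mixed product rule moves them past 1 \<otimes>
      BT.\<close>
    have "kron (mat_inv ?C) (1\<^sub>m s) = kron (mat_inv D) (1\<^sub>m (n * s))" "kron ?C (1\<^sub>m t) = kron D (1\<^sub>m (n * t))"
      unfolding Ci by (simp_all add: kron_assoc kron_one)
    then show ?thesis
      using kron_mult[OF Di(1) one_carrier_mat[of n] one_carrier_mat[of "n * s"] BT]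
        kron_mult[OF Di(1) D(1) BT one_carrier_mat[of "n * t"]]
      by (simp add: right_mult_one_mat[OF Di(1)] left_mult_one_mat[OF BT] right_mult_one_mat[OF BT] Di(3))
  qed
  finally have W_lim: "mat_tendsto (\<lambda>r. kron (mat_inv (W r)) (1\<^sub>m s) * kron (1\<^sub>m n) BT * kron (W r) (1\<^sub>m t))
      (kron (1\<^sub>m n) BT) (at_left 1)" .
  show ?thesis
  proof (rule mat_tendsto_cong[OF _ W_lim])
    show "\<forall>\<^sub>F r in at_left 1. kron (mat_inv (W r)) (1\<^sub>m s) * kron (1\<^sub>m n) BT * kron (W r) (1\<^sub>m t) =
        kron (mat_inv (?S r)) (1\<^sub>m s) * kron (1\<^sub>m n) BT * kron (?S r) (1\<^sub>m t)"
      using mat_tendsto_mat_inv(2)[OF lim Cc detC] eventually_T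
    proof eventually_elim
      case (elim r)
      define \<beta> where "\<beta> = complex_of_real (sqrt (1 - r\<^sup>2))"
      have \<beta>: "\<beta> \<noteq> 0" using elim by (simp add: \<beta>_def)
      have Sc: "?S r \<in> carrier_mat (n * n) (n * n)"
        using carrier_matD[of "W r" "n * n" "n * n"] elim by (intro carrier_matI) (simp_all add: W_def)
      have WS: "W r = \<beta> \<cdot>\<^sub>m ?S r" by (simp add: W_def \<beta>_def)
      note Wi = mat_inv_invertible[of "W r" "n * n"]
      have Wc: "mat_inv (W r) \<in> carrier_mat (n * n) (n * n)" "W r * mat_inv (W r) = 1\<^sub>m (n * n)"
        using Wi elim by auto
      \<comment> \<open>The inverse of the root is \<beta> times the inverse of W, while W is
        \<beta> times the root: the same scalar, moved from the right factor to the left.\<close>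
      have Si: "mat_inv (?S r) = \<beta> \<cdot>\<^sub>m mat_inv (W r)"
      proof (rule mat_inv_eqI[OF Sc])
        show "?S r * (\<beta> \<cdot>\<^sub>m mat_inv (W r)) = 1\<^sub>m (n * n)"
          using Wc Sc unfolding WS by (simp add: mult_smult_distrib[of _ "n * n" "n * n" _ "n * n"]
              mult_smult_assoc_mat[of _ "n * n" "n * n" _ "n * n"] WS)
      qed (use Wc in simp)
      let ?K1 = "kron (mat_inv (W r)) (1\<^sub>m s)" and ?K2 = "kron (1\<^sub>m n) BT" and ?K3 = "kron (?S r) (1\<^sub>m t)"
      have K: "?K1 \<in> carrier_mat (n * n * s) (n * n * s)" "?K2 \<in> carrier_mat (n * n * s) (n * n * t)"
        "?K3 \<in> carrier_mat (n * n * t) (n * n * t)"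
        using Wc Sc BT by (auto simp: mult.assoc)
      have "?K1 * ?K2 * (\<beta> \<cdot>\<^sub>m ?K3) = \<beta> \<cdot>\<^sub>m (?K1 * ?K2 * ?K3)"
        by (rule mult_smult_distrib[OF mult_carrier_mat[OF K(1,2)] K(3)])
      moreover have "(\<beta> \<cdot>\<^sub>m ?K1) * ?K2 * ?K3 = \<beta> \<cdot>\<^sub>m (?K1 * ?K2 * ?K3)"
        using mult_smult_assoc_mat[OF K(1,2), of \<beta>] mult_smult_assoc_mat[OF mult_carrier_mat[OF K(1,2)] K(3), of \<beta>]
        by simp
      ultimately show ?case
        unfolding Si kron_smult_left unfolding WS kron_smult_left by (simp add: WS)
    qed
  qed
qed

end

theorem theorem3p9:
  fixes X :: "complex mat list"
    and Y :: "nat \<Rightarrow> nat \<Rightarrow> complex mat"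
    and d n s t :: nat
  assumes "n \<ge> 1" and "s \<ge> 1" and "t \<ge> 1"
    and "X \<in> mat_tuples d n"
    and "row_square n X = 1\<^sub>m n"
    and "gen_algebra n (set X) = carrier_mat n n"
    and "\<And>i j. i < s \<Longrightarrow> j < t \<Longrightarrow> Y i j \<in> carrier_mat n n"
  shows "mat_tendsto
      (\<lambda>r. kron (mat_inv (mat_sqrt (P_mat n (scale_tuple r X)))) (1\<^sub>m s)
           * kron (1\<^sub>m n) (block_tensor s t n Y)
           * kron (mat_sqrt (P_mat n (scale_tuple r X))) (1\<^sub>m t))
      (kron (1\<^sub>m n) (block_tensor s t n Y))
      (at_left (1::real))
    \<and> ((\<lambda>r. NP_norm d s t (scale_tuple r X) Y) \<longlongrightarrow> ANP_norm d s t X Y) (at_left (1::real))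
    \<and> ANP_norm d s t X Y = ereal (op_norm (block_mat s t n Y))"
proof -
  interpret row_coisometry n d "\<lambda>e. entries (X ! e)"
    by (rule row_coisometryI[OF assms(1,4,5,6)])
  interpret row_coisometry_mat n d X
    by unfold_locales (rule assms(4))
  have NP: "((\<lambda>r. NP_norm d s t (scale_tuple r X) Y) \<longlongrightarrow> ereal (op_norm (block_mat s t n Y))) (at_left 1)"
    by (rule NP_norm_tendsto[OF assms(7)])
  \<comment> \<open>\<open>Lim\<close> is a choice of limit; the convergence just obtained, along a
    nontrivial filter, determines it.\<close>
  then have "ANP_norm d s t X Y = ereal (op_norm (block_mat s t n Y))"
    unfolding ANP_norm_def by (intro tendsto_Lim) simp_all
  moreover have "block_tensor s t n Y \<in> carrier_mat (n * s) (n * t)"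
    by (simp add: block_tensor_def mat_sum_def)
  ultimately show ?thesis using NP block_tensor_tendsto by simp
qed

end
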